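(* Let $0<i_1<\dots<i_m=n$ and let $\widetilde Y=\mathrm{Sp}(i_1,\dots,i_m)$. The map $S\mapsto \mathrm{pr}(Y_{\varphi(S)})$ is a bijection from the set of standard tableaux of type $(i_1,\dots,i_m)$ and shape $(n-k,k)$ onto the set of irreducible components of $\widetilde Y$.
   Context: Fix integers $n\ge 2k\ge 0$; $V$ is an $n$-dimensional complex vector space with basis $e_1,\dots,e_{n-k},f_1,\dots,f_k$ and $N$ is the nilpotent endomorphism $Ne_i=e_{i-1}$, $Nf_i=f_{i-1}$, $e_0=f_0=0$. $N^{-d}(U)$ denotes the preimage of a subspace $U$ under $N^d$. A partial flag of type $(i_1,\dots,i_m)$ ($0<i_1<\dots<i_m=n$) is a chain $F_{i_1}\subset\dots\subset F_{i_m}$ with $\dim F_{i_l}=i_l$; it is $N$-invariant if $NF_{i_l}\subset F_{i_{l-1}}$ for all $l$ ($F_{i_0}=\{0\}$). The Spaltenstein variety $\mathrm{Sp}(i_1,\dots,i_m)$ is the variety of $N$-invariant partial flags of type $(i_1,\dots,i_m)$; $\mathrm{Sp}(1,2,\dots,n)=Y$ is the Springer fibre. The map $\mathrm{pr}:Y\to\{\text{partial flags of type }(i_1,\dots,i_m)\}$ forgets the $F_j$ with $j\notin\{i_1,\dots,i_m\}$. Tableaux: a tableau of type $(i_1,\dots,i_m)$ (shape $(n-k,k)$) is a two-row Young diagram, top row of $n-k$ boxes, bottom row of $k$ boxes, filled so that $i_l$ occurs exactly $i_l-i_{l-1}$ times ($i_0=0$). It is row strict if entries strictly decrease from left to right along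 each row, and standard if moreover in each column the top entry is $\ge$ the bottom entry. An entry $i_l$ with $i_l-i_{l-1}=2$ (occurring once in each row) is a double entry. For a standard tableau $S$ of type $(i_1,\dots,i_m)$, $\varphi(S)$ is the standard tableau of type $(1,\dots,n)$ obtained by replacing, for each double entry $i_l$, its copy in the bottom row by $i_l-1$. Springer components: for a standard tableau $\sigma$ of type $(1,\dots,n)$, $Y_\sigma$ is the irreducible component of $Y$ attached to $\sigma$ by the Spaltenstein–Vargas bijection; explicitly (Fung), with the conventions $F_0=\{0\}=\operatorname{im}N^{n-k}$ and $0$ regarded as lying in the top row, $Y_\sigma$ is the set of full flags $F_1\subset\dots\subset F_n$ such that: (i) $F_i\subset N^{-1}(F_{i-1})$ for all $i$; (ii) if $i$ is in the top row of $\sigma$ and $i-1$ in the bottom row, then $F_i=N^{-1}(F_{i-2})$; (iii) if $i$ and $i-1$ are both in the top row, then: if $F_{i-1}=N^{-d}(F_r)$ with $r$ in the bottom row, then $F_i=N^{-d-1}(F_{r-1})$; if $F_{i-1}=N^{-d}(\operatorname{im}N^{n-k-j})$ with $0\le j<n-2k$, then $F_i=N^{-d}(\operatorname{im}N^{n-k-j-1})$ (these equalities $F_{i-1}=\dots$ refer to relations forced by the preceding conditions). *)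

theory Defs
  imports Complex_Main "HOL-Library.Multiset" "HOL-Library.Function_Algebras"
begin

text \<open>V is modelled as the vectors v :: nat => complex with v j = 0 for j >= n.
  Coordinate j-1 (j = 1..n-k) is the e_j coordinate, coordinate n-k+j-1 (j = 1..k)
  is the f_j coordinate.\<close>

definition cscale :: "complex \<Rightarrow> (nat \<Rightarrow> complex) \<Rightarrow> (nat \<Rightarrow> complex)" where
  "cscale c v = (\<lambda>i. c * v i)"

definition Vsp :: "nat \<Rightarrow> (nat \<Rightarrow> complex) set" where
  "Vsp n = {v. \<forall>j\<ge>n. v j = 0}"

definition csubspace :: "(nat \<Rightarrow> complex) set \<Rightarrow> bool" where
  "csubspace U = module.subspace cscale U"

definition cspan :: "(nat \<Rightarrow> complex) set \<Rightarrow> (nat \<Rightarrow> complex) set" where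
  "cspan A = module.span cscale A"

definition cdim :: "(nat \<Rightarrow> complex) set \<Rightarrow> nat" where
  "cdim U = vector_space.dim cscale U"

text \<open>N e_i = e_(i-1), N f_i = f_(i-1), e_0 = f_0 = 0.\<close>
definition Nop :: "nat \<Rightarrow> nat \<Rightarrow> (nat \<Rightarrow> complex) \<Rightarrow> (nat \<Rightarrow> complex)" where
  "Nop n k v = (\<lambda>j. if j + 1 < n - k \<or> (n - k \<le> j \<and> j + 1 < n) then v (j + 1) else 0)"

definition Npre :: "nat \<Rightarrow> nat \<Rightarrow> nat \<Rightarrow> (nat \<Rightarrow> complex) set \<Rightarrow> (nat \<Rightarrow> complex) set" where
  "Npre n k d U = {v \<in> Vsp n. (Nop n k ^^ d) v \<in> U}"

definition Nim :: "nat \<Rightarrow> nat \<Rightarrow> nat \<Rightarrow> (nat \<Rightarrow> complex) set" where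
  "Nim n k d = (Nop n k ^^ d) ` Vsp n"

definition is_type :: "nat \<Rightarrow> nat list \<Rightarrow> bool" where
  "is_type n is \<longleftrightarrow> is \<noteq> [] \<and> sorted_wrt (<) is \<and> 0 < hd is \<and> last is = n"

text \<open>A partial flag of type is: F i for i in is is the flag member of dimension i;
  all other indices carry the dummy value {}.\<close>
definition pflags :: "nat \<Rightarrow> nat list \<Rightarrow> (nat \<Rightarrow> (nat \<Rightarrow> complex) set) set" where
  "pflags n is = {F. (\<forall>j. j \<notin> set is \<longrightarrow> F j = {})
      \<and> (\<forall>i\<in>set is. csubspace (F i) \<and> F i \<subseteq> Vsp n \<and> cdim (F i) = i)
      \<and> (\<forall>l. Suc l < length is \<longrightarrow> F (is ! l) \<subseteq> F (is ! Suc l))}"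

definition prevF :: "nat list \<Rightarrow> (nat \<Rightarrow> (nat \<Rightarrow> complex) set) \<Rightarrow> nat \<Rightarrow> (nat \<Rightarrow> complex) set" where
  "prevF is F l = (if l = 0 then {0} else F (is ! (l - 1)))"

definition Spalt :: "nat \<Rightarrow> nat \<Rightarrow> nat list \<Rightarrow> (nat \<Rightarrow> (nat \<Rightarrow> complex) set) set" where
  "Spalt n k is = {F \<in> pflags n is. \<forall>l<length is. Nop n k ` F (is ! l) \<subseteq> prevF is F l}"

definition full_type :: "nat \<Rightarrow> nat list" where
  "full_type n = [1..<Suc n]"

definition Springer :: "nat \<Rightarrow> nat \<Rightarrow> (nat \<Rightarrow> (nat \<Rightarrow> complex) set) set" where
  "Springer n k = Spalt n k (full_type n)"

definition pr :: "nat list \<Rightarrow> (nat \<Rightarrow> (nat \<Rightarrow> complex) set) \<Rightarrow> (nat \<Rightarrow> (nat \<Rightarrow> complex) set)" where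
  "pr is F = (\<lambda>j. if j \<in> set is then F j else {})"

inductive_set polyfun :: "nat \<Rightarrow> ((nat \<Rightarrow> nat \<Rightarrow> complex) \<Rightarrow> complex) set" for n where
  pconst: "(\<lambda>_. c) \<in> polyfun n"
| pcoord: "i < n \<Longrightarrow> j < n \<Longrightarrow> (\<lambda>g. g i j) \<in> polyfun n"
| padd: "p \<in> polyfun n \<Longrightarrow> q \<in> polyfun n \<Longrightarrow> (\<lambda>g. p g + q g) \<in> polyfun n"
| pmult: "p \<in> polyfun n \<Longrightarrow> q \<in> polyfun n \<Longrightarrow> (\<lambda>g. p g * q g) \<in> polyfun n"

definition col :: "(nat \<Rightarrow> nat \<Rightarrow> complex) \<Rightarrow> nat \<Rightarrow> (nat \<Rightarrow> complex)" where
  "col g j = (\<lambda>i. g i j)"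

definition GL :: "nat \<Rightarrow> (nat \<Rightarrow> nat \<Rightarrow> complex) set" where
  "GL n = {g. (\<forall>i j. n \<le> i \<or> n \<le> j \<longrightarrow> g i j = 0) \<and> cspan (col g ` {..<n}) = Vsp n}"

definition flag_of :: "nat list \<Rightarrow> (nat \<Rightarrow> nat \<Rightarrow> complex) \<Rightarrow> (nat \<Rightarrow> (nat \<Rightarrow> complex) set)" where
  "flag_of is g = (\<lambda>j. if j \<in> set is then cspan (col g ` {..<j}) else {})"

text \<open>Zariski closed sets of the partial flag variety (quotient topology of GL_n / P).\<close>
definition zclosed :: "nat \<Rightarrow> nat list \<Rightarrow> (nat \<Rightarrow> (nat \<Rightarrow> complex) set) set \<Rightarrow> bool" where
  "zclosed n is C \<longleftrightarrow> C \<subseteq> pflags n is \<and>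
     (\<exists>P \<subseteq> polyfun n. {g \<in> GL n. flag_of is g \<in> C} = {g \<in> GL n. \<forall>p\<in>P. p g = 0})"

definition irreducible_set :: "nat \<Rightarrow> nat list \<Rightarrow> (nat \<Rightarrow> (nat \<Rightarrow> complex) set) set \<Rightarrow> bool" where
  "irreducible_set n is Z \<longleftrightarrow> Z \<noteq> {} \<and>
     (\<forall>C1 C2. zclosed n is C1 \<longrightarrow> zclosed n is C2 \<longrightarrow> Z \<subseteq> C1 \<union> C2 \<longrightarrow> Z \<subseteq> C1 \<or> Z \<subseteq> C2)"

definition irr_components :: "nat \<Rightarrow> nat list \<Rightarrow> (nat \<Rightarrow> (nat \<Rightarrow> complex) set) set
    \<Rightarrow> (nat \<Rightarrow> (nat \<Rightarrow> complex) set) set set" where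
  "irr_components n is X = {Z. Z \<subseteq> X \<and> irreducible_set n is Z \<and>
     (\<forall>W. irreducible_set n is W \<and> Z \<subseteq> W \<and> W \<subseteq> X \<longrightarrow> W = Z)}"

text \<open>A tableau is a pair (top row, bottom row), rows read left to right.\<close>
type_synonym tableau = "nat list \<times> nat list"

definition gap :: "nat list \<Rightarrow> nat \<Rightarrow> nat" where
  "gap is l = is ! l - (if l = 0 then 0 else is ! (l - 1))"

definition type_mset :: "nat list \<Rightarrow> nat multiset" where
  "type_mset is = mset (concat (map (\<lambda>l. replicate (gap is l) (is ! l)) [0..<length is]))"

definition std_tableaux :: "nat \<Rightarrow> nat \<Rightarrow> nat list \<Rightarrow> tableau set" where
  "std_tableaux n k is = {(t, b). length t = n - k \<and> length b = k
      \<and> mset (t @ b) = type_mset is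
      \<and> sorted_wrt (>) t \<and> sorted_wrt (>) b
      \<and> (\<forall>c<k. b ! c \<le> t ! c)}"

definition double_entry :: "nat list \<Rightarrow> nat \<Rightarrow> bool" where
  "double_entry is x \<longleftrightarrow> (\<exists>l<length is. is ! l = x \<and> gap is l = 2)"

definition phi :: "nat list \<Rightarrow> tableau \<Rightarrow> tableau" where
  "phi is S = (fst S, map (\<lambda>x. if double_entry is x then x - 1 else x) (snd S))"

section \<open>Springer components (Fung's description)\<close>

datatype base = Ref nat | Img nat

definition in_top :: "tableau \<Rightarrow> nat \<Rightarrow> bool" where
  "in_top \<sigma> i \<longleftrightarrow> i = 0 \<or> i \<in> set (fst \<sigma>)"

definition in_bot :: "tableau \<Rightarrow> nat \<Rightarrow> bool" where
  "in_bot \<sigma> i \<longleftrightarrow> i \<in> set (snd \<sigma>)"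

text \<open>forced n k sigma: the relations F_i = N^(-d)(X) forced by the conditions
  (ii), (iii) (and F_0 = im N^(n-k)), closed under composition of preimages.
  (i, d, Ref m) means F_i = N^(-d)(F_m); (i, d, Img j) means F_i = N^(-d)(im N^(n-k-j)).\<close>
inductive_set forced :: "nat \<Rightarrow> nat \<Rightarrow> tableau \<Rightarrow> (nat \<times> nat \<times> base) set"
  for n k \<sigma> where
  f0: "(0, 0, Img 0) \<in> forced n k \<sigma>"
| fii: "in_top \<sigma> i \<Longrightarrow> i \<ge> 1 \<Longrightarrow> in_bot \<sigma> (i - 1) \<Longrightarrow> (i, 1, Ref (i - 2)) \<in> forced n k \<sigma>"
| ftrans: "(i, a, Ref m) \<in> forced n k \<sigma> \<Longrightarrow> (m, b, X) \<in> forced n k \<sigma> \<Longrightarrow> (i, a + b, X) \<in> forced n k \<sigma>"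
| fiii1: "in_top \<sigma> i \<Longrightarrow> i \<ge> 1 \<Longrightarrow> in_top \<sigma> (i - 1) \<Longrightarrow> (i - 1, d, Ref r) \<in> forced n k \<sigma> \<Longrightarrow>
           in_bot \<sigma> r \<Longrightarrow> (i, d + 1, Ref (r - 1)) \<in> forced n k \<sigma>"
| fiii2: "in_top \<sigma> i \<Longrightarrow> i \<ge> 1 \<Longrightarrow> in_top \<sigma> (i - 1) \<Longrightarrow> (i - 1, d, Img j) \<in> forced n k \<sigma> \<Longrightarrow>
           j < n - 2 * k \<Longrightarrow> (i, d, Img (j + 1)) \<in> forced n k \<sigma>"

definition Fz :: "(nat \<Rightarrow> (nat \<Rightarrow> complex) set) \<Rightarrow> nat \<Rightarrow> (nat \<Rightarrow> complex) set" where
  "Fz F i = (if i = 0 then {0} else F i)"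

fun eval_base :: "nat \<Rightarrow> nat \<Rightarrow> (nat \<Rightarrow> (nat \<Rightarrow> complex) set) \<Rightarrow> base \<Rightarrow> (nat \<Rightarrow> complex) set" where
  "eval_base n k F (Ref m) = Fz F m"
| "eval_base n k F (Img j) = Nim n k (n - k - j)"

definition Ycomp :: "nat \<Rightarrow> nat \<Rightarrow> tableau \<Rightarrow> (nat \<Rightarrow> (nat \<Rightarrow> complex) set) set" where
  "Ycomp n k \<sigma> = {F \<in> pflags n (full_type n).
      (\<forall>i\<in>{1..n}. F i \<subseteq> Npre n k 1 (Fz F (i - 1)))
      \<and> (\<forall>i d X. (i, d, X) \<in> forced n k \<sigma> \<longrightarrow> Fz F i = Npre n k d (eval_base n k F X))}"

end

theory Submission
  imports Defs "Jordan_Normal_Form.Determinant"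
begin

text \<open>For a standard tableau \<open>S\<close> the set \<open>pr (Ycomp n k (phi is S))\<close> is cut out by one condition \<open>F i \<subseteq> N\<^sup>-\<^sup>e(X)\<close> per
  member of the flag, where \<open>X\<close> is an earlier member or an image of a power of \<open>N\<close>; expressing these conditions by
  determinants shows that it is closed. It is irreducible since any two of its points lie on a polynomial curve:
  choose bases adapted to the two flags and interpolate them vector by vector, lifting through \<open>N\<^sup>e\<close> with a linear
  section. The sets cover the Spaltenstein variety: read off the top row from the steps at which the nilpotency index
  of \<open>N\<close> on \<open>V / F i\<close> drops. Finally they are pairwise incomparable, because at a bottom entry the flag member is not
  determined by the smaller ones whereas at a top entry it is, so an inclusion of the sets gives an inclusion of the
  sets of bottom entries, which have the same size. Hence they are precisely the maximal irreducible subsets.\<close>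

section \<open>Linear algebra\<close>

text \<open>The components are defined by forced equalities, but only inclusions are imposed here.
  One application of \<open>N\<^sup>-\<^sup>1\<close> raises the dimension by at most two, so the
  inclusions become equalities by counting; and inclusions are closed conditions that can be checked
  one basis vector at a time. The obstacle is the opposite estimate. A preimage under
  \<open>N\<^sup>e\<close> gains the full \<open>2 * e\<close> only if the subspace lies in the
  image of \<open>N\<^sup>e\<close>, and the linear section lifts correctly only there. Both are
  secured by one invariant: a flag member with \<open>b\<close> bottom entries up to its index lies
  in the image of \<open>N\<close> to the power \<open>k - b\<close>. It holds because a standard
  tableau has at most \<open>n - 2 * k\<close> rays, that is, unmatched top entries. Forgetting
  members of the flag fits into this scheme because a dimension omitted from the type and its
  successor form the shortest possible cup. Every condition at a surviving index then mentions
  surviving indices only, and these conditions alone cut out the projected set.\<close>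

interpretation cv: vector_space cscale
  by unfold_locales (auto simp: cscale_def fun_eq_iff algebra_simps)

interpretation cvp: vector_space_pair cscale cscale ..

declare csubspace_def [simp] cspan_def [simp] cdim_def [simp]

definition uvec :: "nat \<Rightarrow> nat \<Rightarrow> complex" where
  "uvec i = (\<lambda>j. if j = i then 1 else 0)"

lemma cscale_apply: "cscale c v i = c * v i"
  by (simp add: cscale_def)

lemma sum_fun_apply: "(\<Sum>a\<in>A. f a) x = (\<Sum>a\<in>A. f a x)"
  for f :: "'a \<Rightarrow> nat \<Rightarrow> complex"
  by (induction A rule: infinite_finite_induct) auto

lemma subspace_Vsp [simp]: "cv.subspace (Vsp n)"
  by (auto simp: cv.subspace_def Vsp_def cscale_apply)

lemma uvec_in_Vsp: "i < n \<Longrightarrow> uvec i \<in> Vsp n"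
  by (auto simp: uvec_def Vsp_def)

lemma Vsp_eq_span: "Vsp n = cv.span (uvec ` {..<n})"
proof
  show "Vsp n \<subseteq> cv.span (uvec ` {..<n})"
  proof
    fix v assume v: "v \<in> Vsp n"
    have "v = (\<Sum>i<n. cscale (v i) (uvec i))"
    proof
      fix j
      have "(\<Sum>i<n. v i * uvec i j) = (\<Sum>i<n. if i = j then v i else 0)"
        by (rule sum.cong) (auto simp: uvec_def)
      also have "\<dots> = v j"
        using v by (simp add: Vsp_def)
      finally show "v j = (\<Sum>i<n. cscale (v i) (uvec i)) j"
        by (simp add: sum_fun_apply cscale_apply)
    qed
    also have "\<dots> \<in> cv.span (uvec ` {..<n})"
      by (intro cv.span_sum cv.span_scale cv.span_base) auto
    finally show "v \<in> cv.span (uvec ` {..<n})" .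
  qed
  show "cv.span (uvec ` {..<n}) \<subseteq> Vsp n"
    by (rule cv.span_minimal) (auto simp: uvec_in_Vsp)
qed

lemma finite_independent_Vsp:
  assumes "cv.independent B" "B \<subseteq> Vsp n"
  shows "finite B"
  using cv.independent_span_bound[of "uvec ` {..<n}" B] assms by (auto simp: Vsp_eq_span)

section \<open>Dimensions of subspaces of the ambient space\<close>

lemma cdim_mono:
  assumes "U \<subseteq> W" "W \<subseteq> Vsp n"
  shows "cv.dim U \<le> cv.dim W"
proof -
  obtain B where B: "B \<subseteq> W" "cv.independent B" "W \<subseteq> cv.span B" "card B = cv.dim W"
    using cv.basis_exists by metis
  then have "finite B" using finite_independent_Vsp assms by blast
  then show ?thesis using cv.dim_le_card[of U B] B assms by auto
qed

lemma cdim_insert: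
  assumes "S \<subseteq> Vsp n" "v \<in> Vsp n" "v \<notin> cv.span S"
  shows "cv.dim (insert v S) = Suc (cv.dim S)"
proof -
  obtain B where B: "B \<subseteq> S" "cv.independent B" "S \<subseteq> cv.span B" "card B = cv.dim S"
    using cv.basis_exists by metis
  have fin: "finite B" using B assms finite_independent_Vsp by blast
  have sp: "cv.span B = cv.span S"
    using B by (meson cv.span_eq cv.span_mono cv.span_superset order_trans)
  have v: "v \<notin> B" using sp assms(3) cv.span_base by blast
  have "cv.independent (insert v B)"
    using B assms sp by (intro cv.independent_insertI) auto
  moreover have "insert v S \<subseteq> cv.span (insert v B)"
    using B by (auto intro: cv.span_base dest: subsetD[OF cv.span_mono[OF subset_insertI]])
  ultimately have "card (insert v B) = cv.dim (insert v S)"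
    using B by (intro cv.basis_card_eq_dim) auto
  then show ?thesis using v fin B by simp
qed

text \<open>Every equality of flag members below comes from an inclusion and a dimension bound
  through this comparison; the ambient \<open>Vsp n\<close> supplies finiteness.\<close>

lemma csubspace_eqI:
  assumes "cv.subspace U" "U \<subseteq> W" "W \<subseteq> Vsp n" "cv.dim W \<le> cv.dim U"
  shows "U = W"
proof (rule ccontr)
  assume "U \<noteq> W"
  then obtain w where w: "w \<in> W" "w \<notin> U" using assms by auto
  have "cv.dim (insert w U) = Suc (cv.dim U)"
    using assms w by (intro cdim_insert[of _ n]) (auto simp: cv.span_eq_iff[THEN iffD2])
  moreover have "cv.dim (insert w U) \<le> cv.dim W"
    using assms w by (intro cdim_mono[of _ _ n]) auto
  ultimately show False using assms by simp
qed

section \<open>Powers of the nilpotent operator, their images and preimages\<close>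

definition in_range :: "nat \<Rightarrow> nat \<Rightarrow> nat \<Rightarrow> nat \<Rightarrow> bool" where
  "in_range n k a j \<longleftrightarrow> j + a < n - k \<or> (n - k \<le> j \<and> j + a < n)"

text \<open>Moves each basis vector \<open>e\<close> places up its Jordan block: a linear section of
  the \<open>e\<close>-th power of \<open>N\<close> over its image. Being given by coordinates, it
  preserves polynomial dependence on a parameter.\<close>

definition shift :: "nat \<Rightarrow> nat \<Rightarrow> nat \<Rightarrow> (nat \<Rightarrow> complex) \<Rightarrow> nat \<Rightarrow> complex" where
  "shift n k e v = (\<lambda>j. if (e \<le> j \<and> j < n - k) \<or> (n - k + e \<le> j \<and> j < n) then v (j - e) else 0)"

lemma Nop_in_Vsp: "Nop n k v \<in> Vsp n"
  by (auto simp: Nop_def Vsp_def)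

lemma Nop_pow_in_Vsp: "v \<in> Vsp n \<Longrightarrow> (Nop n k ^^ e) v \<in> Vsp n"
  by (cases e) (auto simp: Nop_in_Vsp)

lemma Nop_pow_apply:
  assumes "v \<in> Vsp n"
  shows "(Nop n k ^^ e) v = (\<lambda>j. if in_range n k e j then v (j + e) else 0)"
proof (induction e)
  case 0
  then show ?case using assms by (auto simp: in_range_def Vsp_def fun_eq_iff)
next
  case (Suc e)
  show ?case
    by (simp add: Suc.IH) (auto simp: Nop_def in_range_def fun_eq_iff)
qed

lemma linear_Nop: "Vector_Spaces.linear cscale cscale (Nop n k)"
  by (auto simp: Vector_Spaces.linear_iff Nop_def fun_eq_iff cv.vector_space_axioms cscale_apply)

lemma linear_Nop_pow: "Vector_Spaces.linear cscale cscale (Nop n k ^^ e)"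
proof (induction e)
  case 0
  then show ?case by (auto simp: Vector_Spaces.linear_iff cv.vector_space_axioms)
next
  case (Suc e)
  then show ?case
    using linear_Nop[of n k]
    by (auto simp: Vector_Spaces.linear_iff)
qed

lemma Nop_pow_add: "(Nop n k ^^ e) (v + w) = (Nop n k ^^ e) v + (Nop n k ^^ e) w"
  and Nop_pow_scale: "(Nop n k ^^ e) (cscale c v) = cscale c ((Nop n k ^^ e) v)"
  using linear_Nop_pow[of e n k] by (auto simp: Vector_Spaces.linear_iff)

lemma linear_shift: "Vector_Spaces.linear cscale cscale (shift n k e)"
  by (auto simp: Vector_Spaces.linear_iff shift_def fun_eq_iff cv.vector_space_axioms cscale_apply)

lemma shift_in_Vsp: "shift n k e v \<in> Vsp n"
  by (auto simp: shift_def Vsp_def)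

text \<open>The image is a coordinate subspace: \<open>in_range n k a\<close> selects the indices
  from which \<open>a\<close> further steps stay inside the same Jordan block. Membership is thus
  the vanishing of certain coordinates, which makes it a polynomial condition.\<close>

lemma Nim_iff:
  assumes "k \<le> n"
  shows "v \<in> Nim n k a \<longleftrightarrow> (\<forall>j. v j \<noteq> 0 \<longrightarrow> in_range n k a j)" (is "_ \<longleftrightarrow> ?R")
proof
  assume "v \<in> Nim n k a"
  then show ?R by (auto simp: Nim_def Nop_pow_apply split: if_splits)
next
  assume R: ?R
  have "(Nop n k ^^ a) (shift n k a v) = v"
  proof
    fix j
    show "(Nop n k ^^ a) (shift n k a v) j = v j"
      using R[rule_format, of j] assms
      unfolding Nop_pow_apply[OF shift_in_Vsp]
      by (auto simp: in_range_def shift_def)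
  qed
  then show "v \<in> Nim n k a"
    unfolding Nim_def using shift_in_Vsp by (metis imageI)
qed

lemma Nop_pow_shift:
  assumes "k \<le> n" "v \<in> Nim n k a"
  shows "(Nop n k ^^ a) (shift n k a v) = v"
proof
  fix j
  show "(Nop n k ^^ a) (shift n k a v) j = v j"
    using assms(2)[unfolded Nim_iff[OF assms(1)], rule_format, of j] assms
    unfolding Nop_pow_apply[OF shift_in_Vsp]
    by (auto simp: in_range_def shift_def)
qed

lemma Nim_subspace [simp]: "cv.subspace (Nim n k a)"
  unfolding Nim_def using linear_Nop_pow subspace_Vsp
  by (rule cvp.linear_subspace_image)

lemma Nim_subset_Vsp: "Nim n k a \<subseteq> Vsp n"
  by (auto simp: Nim_def Nop_pow_in_Vsp)

lemma Nim_antimono: "k \<le> n \<Longrightarrow> a \<le> b \<Longrightarrow> Nim n k b \<subseteq> Nim n k a"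
  by (auto simp: Nim_iff in_range_def) (meson add_le_mono le_refl le_trans not_le)+

lemma Nim_full:
  assumes "2 * k \<le> n"
  shows "Nim n k (n - k) = {0}"
proof -
  have "\<not> in_range n k (n - k) j" for j
    unfolding in_range_def using assms by arith
  then show ?thesis
    using assms by (auto simp: Nim_iff fun_eq_iff)
qed

lemma Npre_subspace [simp]: "cv.subspace U \<Longrightarrow> cv.subspace (Npre n k e U)"
proof -
  assume U: "cv.subspace U"
  have "Npre n k e U = Vsp n \<inter> {v. (Nop n k ^^ e) v \<in> U}"
    by (auto simp: Npre_def)
  then show ?thesis
    using cvp.linear_subspace_linear_preimage[OF linear_Nop_pow U] subspace_Vsp
    by (metis cv.subspace_inter)
qed

lemma Npre_subset_Vsp: "Npre n k e U \<subseteq> Vsp n"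
  by (auto simp: Npre_def)

lemma Npre_mono: "U \<subseteq> W \<Longrightarrow> Npre n k e U \<subseteq> Npre n k e W"
  by (auto simp: Npre_def)

lemma Npre_0: "U \<subseteq> Vsp n \<Longrightarrow> Npre n k 0 U = U"
  by (auto simp: Npre_def)

lemma Npre_Npre: "Npre n k d (Npre n k e U) = Npre n k (d + e) U"
  by (auto simp: Npre_def Nop_pow_in_Vsp add.commute[of d] funpow_add)

lemma Nim_subset_Npre: "k \<le> n \<Longrightarrow> Nim n k a \<subseteq> Npre n k e (Nim n k (a + e))"
  by (auto simp: Npre_def Nim_def Nop_pow_in_Vsp add.commute[of a] funpow_add)

text \<open>The left-hand side is the sum of the image of \<open>N\<^sup>a\<close> and the kernel of
  \<open>N\<^sup>e\<close>. Both blocks have length at least \<open>k\<close>, so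
  \<open>a + e \<le> k\<close> puts that kernel inside the image.\<close>

lemma Npre_Nim_subset:
  assumes "2 * k \<le> n" "a + e \<le> k"
  shows "Npre n k e (Nim n k (a + e)) \<subseteq> Nim n k a"
proof
  fix v assume v: "v \<in> Npre n k e (Nim n k (a + e))"
  have V: "v \<in> Vsp n" using v by (simp add: Npre_def)
  have kn: "k \<le> n" using assms by simp
  have *: "in_range n k e j \<Longrightarrow> v (j + e) \<noteq> 0 \<Longrightarrow> in_range n k (a + e) j" for j
    using v V kn by (auto simp: Npre_def Nim_iff Nop_pow_apply)
  show "v \<in> Nim n k a"
    unfolding Nim_iff[OF kn]
  proof (intro allI impI)
    fix j assume j: "v j \<noteq> 0"
    then have jn: "j < n" using V by (auto simp: Vsp_def not_le[symmetric])
    show "in_range n k a j"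
    \<comment> \<open>In either block use \<open>*\<close> at the index \<open>e\<close> places
      lower. If that leaves the block, \<open>j\<close> is among its first \<open>e\<close> indices
      and \<open>a + e \<le> k\<close> keeps \<open>a\<close> further steps inside.\<close>
    proof (cases "j < n - k")
      case True
      then show ?thesis
        using *[of "j - e"] j assms by (cases "e \<le> j") (auto simp: in_range_def)
    next
      case False
      then show ?thesis
        using *[of "j - e"] j jn assms by (cases "e \<le> j - (n - k)") (auto simp: in_range_def)
    qed
  qed
qed

text \<open>The exponent is at least \<open>k\<close>, so the shorter block is annihilated and only
  the first \<open>j\<close> vectors of the longer one remain.\<close>

lemma dim_Nim:
  assumes "2 * k \<le> n" "j \<le> n - 2 * k"
  shows "cv.dim (Nim n k (n - k - j)) = j"
proof -
  have kn: "k \<le> n" using assms by simp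
  have "Nim n k (n - k - j) = Vsp j"
  proof (rule Set.set_eqI)
    fix v
    have "in_range n k (n - k - j) i \<longleftrightarrow> i < j" for i
      using assms by (auto simp: in_range_def)
    then show "v \<in> Nim n k (n - k - j) \<longleftrightarrow> v \<in> Vsp j"
      by (auto simp: Nim_iff[OF kn] Vsp_def not_less[symmetric])
  qed
  moreover have "cv.dim (Vsp j) = j" for j
  proof (induction j)
    case 0
    have "Vsp 0 = {0}" by (auto simp: Vsp_def)
    then show ?case by (metis cv.dim_span_eq_card_independent cv.independent_empty card.empty cv.span_empty)
  next
    case (Suc j)
    have "cv.dim (insert (uvec j) (uvec ` {..<j})) = Suc (cv.dim (uvec ` {..<j}))"
      by (rule cdim_insert[of _ "Suc j"])
         (auto simp: uvec_in_Vsp Vsp_eq_span[symmetric], auto simp: uvec_def Vsp_def)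
    then show ?case
      using Suc by (simp add: Vsp_eq_span lessThan_Suc)
  qed
  ultimately show ?thesis by simp
qed

lemma dim_Vsp [simp]: "cv.dim (Vsp n) = n"
proof -
  \<comment> \<open>With \<open>k = 0\<close> the whole space is a single Jordan block, so
    \<open>dim_Nim\<close> applies with \<open>j = n\<close>.\<close>
  have "Nim n 0 0 = Vsp n" by (auto simp: Nim_def)
  then show ?thesis using dim_Nim[of 0 n n] by simp
qed

text \<open>A vector differs from the shift of its image by an element of the kernel of
  \<open>N\<close>, which is spanned by the first vectors of the two blocks.\<close>

lemma dim_Npre_1_le:
  assumes "2 * k \<le> n" "cv.subspace U" "U \<subseteq> Vsp n"
  shows "cv.dim (Npre n k 1 U) \<le> cv.dim U + 2"
proof -
  have kn: "k \<le> n" using assms by simp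
  obtain B where B: "B \<subseteq> U \<inter> Nim n k 1" "cv.independent B" "U \<inter> Nim n k 1 \<subseteq> cv.span B"
      "card B = cv.dim (U \<inter> Nim n k 1)"
    using cv.basis_exists by metis
  have fin: "finite B" using B assms finite_independent_Vsp by blast
  let ?C = "{uvec 0, uvec (n - k)} \<union> shift n k 1 ` B"
  have "Npre n k 1 U \<subseteq> cv.span ?C"
  proof
    fix v assume v: "v \<in> Npre n k 1 U"
    then have V: "v \<in> Vsp n" and "Nop n k v \<in> U" by (auto simp: Npre_def)
    moreover have "Nop n k v \<in> Nim n k 1" using V by (auto simp: Nim_def)
    ultimately have "Nop n k v \<in> cv.span B" using B by auto
    then have "shift n k 1 (Nop n k v) \<in> cv.span (shift n k 1 ` B)"
      by (simp add: cvp.linear_span_image[OF linear_shift])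
    then have 1: "shift n k 1 (Nop n k v) \<in> cv.span ?C"
      by (meson Un_upper2 cv.span_mono subsetD)
    \<comment> \<open>For \<open>n - k = 0\<close> both first vectors have index 0; the conditional
      keeps that coordinate from being added twice.\<close>
    have "v = shift n k 1 (Nop n k v) + cscale (v 0) (uvec 0)
        + cscale (if n - k = 0 then 0 else v (n - k)) (uvec (n - k))"
    proof
      fix j
      have "j \<ge> n \<Longrightarrow> v j = 0" using V by (auto simp: Vsp_def)
      then show "v j = (shift n k 1 (Nop n k v) + cscale (v 0) (uvec 0)
        + cscale (if n - k = 0 then 0 else v (n - k)) (uvec (n - k))) j"
        using assms(1) by (auto simp: shift_def Nop_def uvec_def cscale_apply)
    qed
    also have "\<dots> \<in> cv.span ?C"
      by (intro cv.span_add 1 cv.span_scale cv.span_base) auto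
    finally show "v \<in> cv.span ?C" .
  qed
  then have "cv.dim (Npre n k 1 U) \<le> card ?C"
    using fin by (intro cv.dim_le_card) auto
  also have "\<dots> \<le> card {uvec 0, uvec (n - k)} + card (shift n k 1 ` B)" by (rule card_Un_le)
  also have "\<dots> \<le> 2 + card B"
    using card_image_le[OF fin, of "shift n k 1"] by (intro add_mono) (auto simp: card_insert_if)
  also have "\<dots> \<le> cv.dim U + 2"
    using B cdim_mono[of "U \<inter> Nim n k 1" U n] assms by auto
  finally show ?thesis .
qed

lemma dim_Npre_le:
  assumes "2 * k \<le> n" "cv.subspace U" "U \<subseteq> Vsp n"
  shows "cv.dim (Npre n k e U) \<le> cv.dim U + 2 * e"
proof (induction e)
  case 0
  then show ?case using assms by (simp add: Npre_0)
next
  case (Suc e)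
  have "Npre n k (Suc e) U = Npre n k 1 (Npre n k e U)" by (simp add: Npre_Npre)
  then show ?case
    using dim_Npre_1_le[of k n "Npre n k e U"] assms Suc by (simp add: Npre_subset_Vsp)
qed

text \<open>On the image of \<open>N\<close> the shift is injective, and shifted vectors vanish at
  the first coordinate of each block. The first vectors of the blocks, distinct since
  \<open>k \<ge> 1\<close>, are therefore independent of them.\<close>

lemma dim_Npre_1_ge:
  assumes "2 * k \<le> n" "1 \<le> k" "cv.subspace U" "U \<subseteq> Nim n k 1"
  shows "cv.dim U + 2 \<le> cv.dim (Npre n k 1 U)"
proof -
  have kn: "k \<le> n" using assms by simp
  obtain B where B: "B \<subseteq> U" "cv.independent B" "U \<subseteq> cv.span B" "card B = cv.dim U"
    using cv.basis_exists by metis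
  have sB: "cv.span B \<subseteq> Nim n k 1"
    using B assms by (intro cv.span_minimal) auto
  have fin: "finite B"
    using B assms finite_independent_Vsp Nim_subset_Vsp by (meson order_trans)
  have inj: "inj_on (shift n k 1) (cv.span B)"
    by (rule inj_on_inverseI[of _ "Nop n k ^^ 1"]) (use Nop_pow_shift[OF kn] sB in blast)
  have ind: "cv.independent (shift n k 1 ` B)"
    using cvp.linear_independent_injective_image[OF linear_shift B(2) inj] .
  have "cv.span (shift n k 1 ` B) \<subseteq> {v. v 0 = 0 \<and> v (n - k) = 0}"
    by (rule cv.span_minimal) (auto simp: cv.subspace_def shift_def cscale_apply)
  then have u0: "uvec 0 \<notin> cv.span (shift n k 1 ` B)" by (auto simp: uvec_def)
  have "cv.span (insert (uvec 0) (shift n k 1 ` B)) \<subseteq> {v. v (n - k) = 0}"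
    using assms(1,2) by (intro cv.span_minimal) (auto simp: cv.subspace_def shift_def uvec_def cscale_apply)
  then have u1: "uvec (n - k) \<notin> cv.span (insert (uvec 0) (shift n k 1 ` B))" by (auto simp: uvec_def)
  let ?C = "insert (uvec (n - k)) (insert (uvec 0) (shift n k 1 ` B))"
  have indC: "cv.independent ?C"
    by (intro cv.independent_insertI u0 u1 ind)
  have "card (shift n k 1 ` B) = card B"
    using inj cv.span_superset by (meson card_image inj_on_subset)
  moreover have "uvec 0 \<notin> shift n k 1 ` B" "uvec (n - k) \<notin> insert (uvec 0) (shift n k 1 ` B)"
    using u0 u1 by (meson cv.span_base)+
  ultimately have cardC: "card ?C = card B + 2" using fin by simp
  have U0: "0 \<in> U" using assms by (simp add: cv.subspace_0)
  have "?C \<subseteq> Npre n k 1 U"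
  proof -
    have "shift n k 1 b \<in> Npre n k 1 U" if "b \<in> B" for b
    proof -
      have "b \<in> U" "b \<in> Nim n k 1" using that B(1) assms(4) by auto
      then show ?thesis
        using Nop_pow_shift[OF kn, of b 1] shift_in_Vsp by (auto simp: Npre_def)
    qed
    moreover have "Nop n k (uvec 0) = 0" "Nop n k (uvec (n - k)) = 0"
      by (auto simp: Nop_def uvec_def fun_eq_iff)
    ultimately show ?thesis
      using U0 assms(1,2) by (auto simp: Npre_def uvec_in_Vsp)
  qed
  then have "cv.dim ?C \<le> cv.dim (Npre n k 1 U)"
    by (rule cdim_mono[OF _ Npre_subset_Vsp])
  then show ?thesis
    using cardC indC B by (simp add: cv.dim_eq_card_independent)
qed

text \<open>Each step gains exactly two while the preimage reached so far lies in the image of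
  \<open>N\<close>; by \<open>Npre_Nim_subset\<close> this persists as long as
  \<open>e \<le> k\<close>.\<close>

lemma dim_Npre:
  assumes "2 * k \<le> n" "e \<le> k" "cv.subspace U" "U \<subseteq> Nim n k e"
  shows "cv.dim (Npre n k e U) = cv.dim U + 2 * e"
  using assms
proof (induction e)
  case 0
  then show ?case by (simp add: Npre_0 Nim_def)
next
  case (Suc e)
  have kn: "k \<le> n" using assms by simp
  have eq: "Npre n k (Suc e) U = Npre n k 1 (Npre n k e U)" by (simp add: Npre_Npre)
  have IH: "cv.dim (Npre n k e U) = cv.dim U + 2 * e"
    using Suc Nim_antimono[OF kn, of e "Suc e"] by auto
  have "Npre n k e U \<subseteq> Npre n k e (Nim n k (1 + e))"
    using Suc by (intro Npre_mono) auto
  also have "\<dots> \<subseteq> Nim n k 1" using Suc by (intro Npre_Nim_subset) auto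
  finally have "cv.dim (Npre n k e U) + 2 \<le> cv.dim (Npre n k 1 (Npre n k e U))"
    using Suc by (intro dim_Npre_1_ge) auto
  moreover have "cv.dim (Npre n k 1 (Npre n k e U)) \<le> cv.dim (Npre n k e U) + 2"
    using Suc by (intro dim_Npre_1_le) (auto simp: Npre_subset_Vsp)
  ultimately show ?case using IH eq by simp
qed

section \<open>Ballot words and the conditions on flags\<close>

text \<open>A full-type tableau is encoded by the set \<open>B\<close> of its bottom entries: bottom entries are up-steps and
  top entries down-steps of a lattice path of height \<open>ht B\<close>. Cups correspond to balanced intervals and rays
  to new prefix minima.\<close>

definition bcount :: "nat set \<Rightarrow> nat \<Rightarrow> nat" where
  "bcount B i = card (B \<inter> {1..i})"

definition ht :: "nat set \<Rightarrow> nat \<Rightarrow> int" where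
  "ht B i = 2 * int (bcount B i) - int i"

text \<open>The steps after \<open>m\<close> up to \<open>i\<close> form a sequence of complete,
  possibly nested cups; \<open>m = i\<close> is the empty sequence.\<close>

definition balanced :: "nat set \<Rightarrow> nat \<Rightarrow> nat \<Rightarrow> bool" where
  "balanced B m i \<longleftrightarrow> m \<le> i \<and> ht B m = ht B i \<and> (\<forall>x. m \<le> x \<and> x \<le> i \<longrightarrow> ht B i \<le> ht B x)"

text \<open>The minimum is weak: it is attained at each ray and again after every outer cup that
  follows it.\<close>

definition prefix_min :: "nat set \<Rightarrow> nat \<Rightarrow> bool" where
  "prefix_min B i \<longleftrightarrow> (\<forall>x\<le>i. ht B i \<le> ht B x)"

definition has_par :: "nat set \<Rightarrow> nat \<Rightarrow> bool" where
  "has_par B i \<longleftrightarrow> (\<exists>y<i. ht B y = ht B i)"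

text \<open>For a top entry closing a cup this is the index just before the cup, since the path
  stays strictly higher in between. It is meaningful only under \<open>has_par\<close>.\<close>

definition par :: "nat set \<Rightarrow> nat \<Rightarrow> nat" where
  "par B i = Max {y. y < i \<and> ht B y = ht B i}"

text \<open>One condition \<open>F i \<subseteq> N\<^sup>-\<^sup>e(X)\<close> per index: for a bottom entry it is invariance, for the right end of a cup
  \<open>X\<close> is the flag member just before the cup, and for a ray \<open>X\<close> is an image of a power of \<open>N\<close>. All forced
  relations follow from these.\<close>

definition drop_exp :: "nat set \<Rightarrow> nat \<Rightarrow> nat" where
  "drop_exp B i = (if i \<in> B then 1 else if has_par B i then (i - par B i) div 2 else bcount B i)"

definition drop_tgt :: "nat \<Rightarrow> nat \<Rightarrow> nat set \<Rightarrow> (nat \<Rightarrow> (nat \<Rightarrow> complex) set) \<Rightarrow> nat \<Rightarrow> (nat \<Rightarrow> complex) set" where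
  "drop_tgt n k B F i = (if i \<in> B then F (i - 1) else if has_par B i then F (par B i)
     else Nim n k (n - k - (i - 2 * bcount B i)))"

text \<open>An initial segment of a full flag, so that flags can be treated by induction on their
  length. Index 0 carries the zero space here, whereas in \<open>pflags\<close> it carries the dummy
  value; \<open>Fz\<close> mediates.\<close>

definition chain :: "nat \<Rightarrow> nat \<Rightarrow> (nat \<Rightarrow> (nat \<Rightarrow> complex) set) \<Rightarrow> bool" where
  "chain n m F \<longleftrightarrow> F 0 = {0} \<and> (\<forall>i\<le>m. cv.subspace (F i) \<and> F i \<subseteq> Vsp n \<and> cv.dim (F i) = i)
     \<and> (\<forall>i<m. F i \<subseteq> F (Suc i))"

definition good :: "nat \<Rightarrow> nat \<Rightarrow> nat set \<Rightarrow> nat \<Rightarrow> (nat \<Rightarrow> (nat \<Rightarrow> complex) set) \<Rightarrow> bool" where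
  "good n k B m F \<longleftrightarrow> chain n m F \<and> (\<forall>i\<in>{1..m}. F i \<subseteq> Npre n k (drop_exp B i) (drop_tgt n k B F i))"

lemma bcount_0 [simp]: "bcount B 0 = 0"
  by (simp add: bcount_def)

lemma bcount_Suc: "bcount B (Suc i) = bcount B i + (if Suc i \<in> B then 1 else 0)"
proof (cases "Suc i \<in> B")
  case True
  then have "B \<inter> {1..Suc i} = insert (Suc i) (B \<inter> {1..i})" by (auto simp: le_Suc_eq)
  then show ?thesis using True by (simp add: bcount_def)
next
  case False
  then have "B \<inter> {1..Suc i} = B \<inter> {1..i}" by (auto simp: le_Suc_eq)
  then show ?thesis using False by (simp add: bcount_def)
qed

lemma bcount_mono: "i \<le> j \<Longrightarrow> bcount B i \<le> bcount B j"
  by (induction rule: dec_induct) (auto simp: bcount_Suc)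

lemma ht_0 [simp]: "ht B 0 = 0"
  by (simp add: ht_def)

lemma ht_Suc: "ht B (Suc i) = ht B i + (if Suc i \<in> B then 1 else - 1)"
  by (simp add: ht_def bcount_Suc)

lemma ht_pred: "1 \<le> i \<Longrightarrow> ht B (i - 1) = ht B i - (if i \<in> B then 1 else - 1)"
  using ht_Suc[of B "i - 1"] by simp

lemma balanced_refl [simp]: "balanced B i i"
  by (auto simp: balanced_def)

lemma balanced_count:
  assumes "balanced B m i"
  shows "i = m + 2 * ((i - m) div 2)" "bcount B i = bcount B m + (i - m) div 2"
proof -
  have 1: "m \<le> i" "2 * int (bcount B m) - int m = 2 * int (bcount B i) - int i"
    using assms by (auto simp: balanced_def ht_def)
  then have "i + 2 * bcount B m = m + 2 * bcount B i" by linarith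
  then have "i = m + 2 * (bcount B i - bcount B m)" using 1 bcount_mono[of m i B] by linarith
  moreover from this have "(i - m) div 2 = bcount B i - bcount B m" by linarith
  ultimately show "i = m + 2 * ((i - m) div 2)" "bcount B i = bcount B m + (i - m) div 2"
    using bcount_mono[OF 1(1), of B] by simp_all
qed

lemma balanced_not_bottom:
  assumes "balanced B m i" "m < i"
  shows "i \<notin> B"
proof
  assume "i \<in> B"
  then have "ht B (i - 1) < ht B i" using ht_pred[of i B] assms(2) by simp
  moreover have "m \<le> i - 1" using assms(2) by simp
  ultimately show False using assms(1) by (fastforce simp: balanced_def)
qed

lemma prefix_min_not_bottom:
  assumes "prefix_min B i" "1 \<le> i"
  shows "i \<notin> B"
proof
  assume "i \<in> B"
  then have "ht B (i - 1) < ht B i" using ht_pred[of i B] assms(2) by simp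
  moreover have "ht B i \<le> ht B (i - 1)" using assms(1) unfolding prefix_min_def by simp
  ultimately show False by simp
qed

text \<open>Discrete intermediate value theorem: the height changes by one in each step.\<close>

lemma last_below:
  assumes "1 \<le> i" "i \<notin> B" "x < i" "ht B x \<le> ht B i"
  shows "has_par B i" "par B i < i" "x \<le> par B i" "ht B (par B i) = ht B i"
    "\<And>y. par B i < y \<Longrightarrow> y < i \<Longrightarrow> ht B i < ht B y"
proof -
  define S where "S = {y. y < i \<and> ht B y \<le> ht B i}"
  have fin: "finite S" by (simp add: S_def)
  have xS: "x \<in> S" using assms by (simp add: S_def)
  define z where "z = Max S"
  have zS: "z \<in> S" unfolding z_def using fin xS by (intro Max_in) auto
  have zmax: "y \<le> z" if "y \<in> S" for y unfolding z_def using fin that by simp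
  \<comment> \<open>The step into \<open>i\<close> goes down, so \<open>i - 1\<close> is above the
    level of \<open>i\<close>. Hence the path leaves the set \<open>S\<close> right after
    \<open>z\<close>, and a unit step can do so only from that very level.\<close>
  have "z \<noteq> i - 1" using ht_pred[of i B] assms zS by (auto simp: S_def)
  then have z1: "Suc z < i" using zS by (auto simp: S_def)
  then have "Suc z \<notin> S" using zmax by force
  then have hz: "ht B z = ht B i"
    using z1 zS ht_Suc[of B z] by (auto simp: S_def split: if_splits)
  have pz: "par B i = z"
    unfolding par_def
    by (rule Max_eqI) (use zmax zS hz in \<open>auto simp: S_def\<close>)
  show "has_par B i" "par B i < i" "x \<le> par B i" "ht B (par B i) = ht B i"
    using zS hz pz xS zmax by (auto simp: has_par_def S_def)
  fix y assume "par B i < y" "y < i"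
  then have "y \<notin> S" using zmax[of y] pz by auto
  then show "ht B i < ht B y" using \<open>y < i\<close> by (auto simp: S_def)
qed

text \<open>Removing the opening up-step and the closing down-step of a cup leaves a balanced
  interior; adding them back gives a balanced interval again.\<close>

lemma par_props:
  assumes "1 \<le> i" "i \<notin> B" "has_par B i"
  shows "par B i < i" "ht B (par B i) = ht B i" "Suc (par B i) \<in> B" "Suc (par B i) < i"
    "balanced B (Suc (par B i)) (i - 1)" "balanced B (par B i) i"
proof -
  obtain x where x: "x < i" "ht B x \<le> ht B i" using assms(3) by (auto simp: has_par_def)
  note l = last_below[OF assms(1,2) x]
  show 1: "par B i < i" "ht B (par B i) = ht B i" using l by auto
  have h: "ht B (i - 1) = ht B i + 1" using ht_pred[OF assms(1)] assms(2) by simp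
  then have "par B i \<noteq> i - 1" using 1 by auto
  then show s: "Suc (par B i) < i" using 1 by simp
  then have "ht B i < ht B (Suc (par B i))" using l(5) by simp
  then show sB: "Suc (par B i) \<in> B" using ht_Suc[of B "par B i"] 1 by (auto split: if_splits)
  have "ht B (i - 1) \<le> ht B y" if "Suc (par B i) \<le> y" "y \<le> i - 1" for y
  proof -
    have "ht B i < ht B y" using l(5)[of y] that s by linarith
    then show ?thesis using h by simp
  qed
  then show "balanced B (Suc (par B i)) (i - 1)"
    using s sB ht_Suc[of B "par B i"] 1 h by (auto simp: balanced_def)
  have "ht B i \<le> ht B y" if "par B i \<le> y" "y \<le> i" for y
    using l(5)[of y] that 1 by (cases "y = par B i"; cases "y = i") auto
  then show "balanced B (par B i) i" using 1 by (auto simp: balanced_def)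
qed

text \<open>Peels the last cup off a balanced interval. What remains is balanced, which drives the
  inductions over cups.\<close>

lemma balanced_par:
  assumes "balanced B a i" "a < i"
  shows "has_par B i" "a \<le> par B i" "par B i < i" "balanced B a (par B i)"
proof -
  have i: "1 \<le> i" "i \<notin> B" using assms balanced_not_bottom by auto
  note l = last_below[OF i assms(2)]
  have le: "ht B a \<le> ht B i" using assms by (simp add: balanced_def)
  show "has_par B i" "a \<le> par B i" "par B i < i" using l le by auto
  then show "balanced B a (par B i)"
    using l(4)[OF le] assms by (auto simp: balanced_def)
qed

text \<open>By the intermediate value property all earlier heights are strictly larger. The step
  into \<open>i\<close> lowers the height by only one, so \<open>i - 1\<close> already attained the
  previous minimum.\<close>

lemma no_par_new_min:
  assumes "1 \<le> i" "i \<notin> B" "\<not> has_par B i"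
  shows "prefix_min B i" "prefix_min B (i - 1)"
proof -
  have *: "ht B i < ht B y" if "y < i" for y
    using last_below(1)[OF assms(1,2) that] assms(3) by force
  then show "prefix_min B i" by (auto simp: prefix_min_def le_less)
  have "ht B (i - 1) = ht B i + 1" using ht_pred[OF assms(1)] assms(2) by simp
  then show "prefix_min B (i - 1)"
    unfolding prefix_min_def
  proof (intro allI impI)
    fix x assume "x \<le> i - 1"
    then have "ht B i < ht B x" using *[of x] assms(1) by simp
    then show "ht B (i - 1) \<le> ht B x" using \<open>ht B (i - 1) = ht B i + 1\<close> by simp
  qed
qed

lemma prefix_min_par:
  assumes "prefix_min B i" "1 \<le> i" "has_par B i"
  shows "prefix_min B (par B i)"
  using par_props(1,2)[OF assms(2) prefix_min_not_bottom[OF assms(1,2)] assms(3)] assms(1)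
  by (auto simp: prefix_min_def)

lemma prefix_min_bcount: "prefix_min B i \<Longrightarrow> 2 * bcount B i \<le> i"
proof -
  assume "prefix_min B i"
  then have "ht B i \<le> ht B 0" unfolding prefix_min_def by blast
  then show ?thesis by (simp add: ht_def)
qed

section \<open>Flags satisfying the conditions of a ballot word\<close>

lemma chain_mono: "chain n m F \<Longrightarrow> i \<le> j \<Longrightarrow> j \<le> m \<Longrightarrow> F i \<subseteq> F j"
proof (induction j)
  case (Suc j)
  show ?case
  proof (cases "i \<le> j")
    case True
    then have "F i \<subseteq> F j" using Suc by simp
    moreover have "F j \<subseteq> F (Suc j)" using Suc.prems by (simp add: chain_def)
    ultimately show ?thesis by blast
  qed (use Suc.prems in \<open>auto simp: le_Suc_eq\<close>)
qed auto

lemma good_mono: "good n k B m F \<Longrightarrow> l \<le> m \<Longrightarrow> good n k B l F"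
  by (auto simp: good_def chain_def)

text \<open>The last assumption says that the path never falls below its final height. Read from the
  right end, this is the column condition of a standard tableau.\<close>

locale ballot =
  fixes n k :: nat and B :: "nat set"
  assumes B_subset: "B \<subseteq> {1..n}" and card_B: "card B = k"
    and ht_ge: "i \<le> n \<Longrightarrow> 2 * int k - int n \<le> ht B i"
begin

lemma kn: "2 * k \<le> n" and kn': "k \<le> n"
  using ht_ge[of 0] by simp_all

lemma bcount_le_k: "bcount B i \<le> k"
  unfolding bcount_def card_B[symmetric]
  by (rule card_mono) (auto intro: finite_subset[OF B_subset])

text \<open>At a prefix minimum the left-hand side counts the rays passed so far.\<close>

lemma new_min_bound: "i \<le> n \<Longrightarrow> i - 2 * bcount B i \<le> n - 2 * k"
  using ht_ge[of i] by (auto simp: ht_def)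

text \<open>Induction that peels off the last cup; the exponents of the composed preimages add up to
  the half-length of the interval.\<close>

lemma good_balanced_subset:
  assumes "good n k B m F"
  shows "i \<le> m \<Longrightarrow> balanced B a i \<Longrightarrow> F i \<subseteq> Npre n k ((i - a) div 2) (F a)"
proof (induction i rule: less_induct)
  case (less i)
  show ?case
  proof (cases "a = i")
    case True
    then show ?thesis using assms less.prems by (auto simp: good_def chain_def Npre_0)
  next
    case False
    then have ai: "a < i" using less.prems by (auto simp: balanced_def)
    note p = balanced_par[OF less.prems(2) ai]
    have i: "i \<notin> B" "1 \<le> i" using balanced_not_bottom[OF less.prems(2) ai] ai by auto
    have "F i \<subseteq> Npre n k (drop_exp B i) (drop_tgt n k B F i)"
      using assms less.prems i by (auto simp: good_def)
    then have "F i \<subseteq> Npre n k ((i - par B i) div 2) (F (par B i))"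
      using i p by (simp add: drop_exp_def drop_tgt_def)
    also have "\<dots> \<subseteq> Npre n k ((i - par B i) div 2) (Npre n k ((par B i - a) div 2) (F a))"
      using less.IH[OF p(3) _ p(4)] less.prems p by (intro Npre_mono) auto
    also have "(i - par B i) div 2 + (par B i - a) div 2 = (i - a) div 2"
      using balanced_count(1)[OF p(4)] balanced_count(1)[OF par_props(6)[OF i(2,1) p(1)]] by linarith
    then have "Npre n k ((i - par B i) div 2) (Npre n k ((par B i - a) div 2) (F a)) = Npre n k ((i - a) div 2) (F a)"
      by (simp add: Npre_Npre)
    finally show ?thesis .
  qed
qed

text \<open>The preimage on the right has dimension at most \<open>a + (i - a)\<close>, which is
  already the dimension of \<open>F i\<close>.\<close>

lemma good_balanced:
  assumes "good n k B m F" "i \<le> m" "balanced B a i"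
  shows "F i = Npre n k ((i - a) div 2) (F a)"
proof (rule csubspace_eqI[of _ _ n])
  have "a \<le> m" using assms by (auto simp: balanced_def)
  then have a: "cv.subspace (F a)" "F a \<subseteq> Vsp n" "cv.dim (F a) = a"
    and i: "cv.subspace (F i)" "cv.dim (F i) = i"
    using assms by (auto simp: good_def chain_def)
  show "cv.subspace (F i)" by fact
  show "F i \<subseteq> Npre n k ((i - a) div 2) (F a)" by (rule good_balanced_subset[OF assms])
  show "Npre n k ((i - a) div 2) (F a) \<subseteq> Vsp n" by (rule Npre_subset_Vsp)
  show "cv.dim (Npre n k ((i - a) div 2) (F a)) \<le> cv.dim (F i)"
    using dim_Npre_le[OF kn a(1,2), of "(i - a) div 2"] a(3) i(2) balanced_count(1)[OF assms(3)] by linarith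
qed

text \<open>A prefix minimum is either a ray, where the claim is the imposed condition, or the end
  of a cup that starts at an earlier prefix minimum with the same number of rays.\<close>

lemma good_prefix_min_subset:
  assumes "good n k B m F"
  shows "i \<le> m \<Longrightarrow> prefix_min B i \<Longrightarrow> F i \<subseteq> Npre n k (bcount B i) (Nim n k (n - k - (i - 2 * bcount B i)))"
proof (induction i rule: less_induct)
  case (less i)
  show ?case
  proof (cases "i = 0")
    case True
    then show ?thesis using assms by (auto simp: good_def chain_def Npre_def Nim_full[OF kn] Vsp_def)
  next
    case False
    then have i: "1 \<le> i" "i \<notin> B" using prefix_min_not_bottom[OF less.prems(2)] by auto
    have F: "F i \<subseteq> Npre n k (drop_exp B i) (drop_tgt n k B F i)"
      using assms less.prems i by (auto simp: good_def)
    show ?thesis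
    proof (cases "has_par B i")
      case False
      then show ?thesis using F i by (simp add: drop_exp_def drop_tgt_def)
    next
      case True
      note p = par_props[OF i True]
      note c = balanced_count[OF p(6)]
      have pb: "2 * bcount B (par B i) \<le> par B i"
        by (rule prefix_min_bcount[OF prefix_min_par[OF less.prems(2) i(1) True]])
      have e: "i - 2 * bcount B i = par B i - 2 * bcount B (par B i)"
        using c p(1) by linarith
      have "F i \<subseteq> Npre n k ((i - par B i) div 2) (F (par B i))"
        using F i True by (simp add: drop_exp_def drop_tgt_def)
      also have "\<dots> \<subseteq> Npre n k ((i - par B i) div 2) (Npre n k (bcount B (par B i))
           (Nim n k (n - k - (i - 2 * bcount B i))))"
        using less.IH[OF p(1) _ prefix_min_par[OF less.prems(2) i(1) True]] p less.prems
        unfolding e by (intro Npre_mono) auto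
      also have "\<dots> = Npre n k (bcount B i) (Nim n k (n - k - (i - 2 * bcount B i)))"
        unfolding Npre_Npre using c(2) by (simp add: add.commute)
      finally show ?thesis .
    qed
  qed
qed

lemma good_prefix_min:
  assumes "good n k B m F" "i \<le> m" "i \<le> n" "prefix_min B i"
  shows "F i = Npre n k (bcount B i) (Nim n k (n - k - (i - 2 * bcount B i)))"
proof (rule csubspace_eqI[of _ _ n])
  have i: "cv.subspace (F i)" "cv.dim (F i) = i"
    using assms by (auto simp: good_def chain_def)
  show "cv.subspace (F i)" by fact
  show "F i \<subseteq> Npre n k (bcount B i) (Nim n k (n - k - (i - 2 * bcount B i)))"
    by (rule good_prefix_min_subset[OF assms(1,2,4)])
  show "Npre n k (bcount B i) (Nim n k (n - k - (i - 2 * bcount B i))) \<subseteq> Vsp n" by (rule Npre_subset_Vsp)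
  show "cv.dim (Npre n k (bcount B i) (Nim n k (n - k - (i - 2 * bcount B i)))) \<le> cv.dim (F i)"
    using dim_Npre_le[OF kn Nim_subspace Nim_subset_Vsp, of "bcount B i" k "n - k - (i - 2 * bcount B i)"]
      dim_Nim[OF kn new_min_bound[OF assms(3)]] i(2) prefix_min_bcount[OF assms(4)] by simp
qed

text \<open>Invariance is imposed only at bottom entries. At a top entry \<open>F (i - 1)\<close> is
  already known as a preimage, by \<open>good_balanced\<close> for the interior of the cup or by
  \<open>good_prefix_min\<close>, and the condition at \<open>i\<close> maps into it.\<close>

lemma good_invariant:
  assumes "good n k B m F" "1 \<le> i" "i \<le> m" "m \<le> n"
  shows "F i \<subseteq> Npre n k 1 (F (i - 1))"
proof -
  have F: "F i \<subseteq> Npre n k (drop_exp B i) (drop_tgt n k B F i)"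
    using assms by (auto simp: good_def)
  consider "i \<in> B" | "i \<notin> B" "has_par B i" | "i \<notin> B" "\<not> has_par B i" by blast
  then show ?thesis
  proof cases
    case 1
    then show ?thesis using F by (simp add: drop_exp_def drop_tgt_def)
  next
    case 2
    note p = par_props[OF assms(2) 2]
    \<comment> \<open>The half-length of the interior of the cup; the cup itself has half-length
      \<open>d + 1\<close>.\<close>
    define d where "d = (i - 1 - Suc (par B i)) div 2"
    have F1: "F (i - 1) = Npre n k d (F (Suc (par B i)))"
      unfolding d_def using assms p by (intro good_balanced[of m]) auto
    have e: "(i - par B i) div 2 = 1 + d"
      unfolding d_def using p(4) by simp
    have "F i \<subseteq> Npre n k (1 + d) (F (par B i))"
      using F 2 by (simp add: drop_exp_def drop_tgt_def e)
    also have "\<dots> \<subseteq> Npre n k (1 + d) (F (Suc (par B i)))"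
      using assms p by (intro Npre_mono chain_mono[of n m]) (auto simp: good_def)
    also have "\<dots> = Npre n k 1 (F (i - 1))" unfolding F1 Npre_Npre ..
    finally show ?thesis .
  next
    case 3
    have F1: "F (i - 1) = Npre n k (bcount B (i - 1)) (Nim n k (n - k - (i - 1 - 2 * bcount B (i - 1))))"
      using assms no_par_new_min[OF assms(2) 3] by (intro good_prefix_min[of m]) auto
    have b: "bcount B i = bcount B (i - 1)" using bcount_Suc[of B "i - 1"] assms(2) 3 by simp
    have j: "2 * bcount B i \<le> i - 1" using prefix_min_bcount[OF no_par_new_min(2)[OF assms(2) 3]] b by simp
    have j': "i - 2 * bcount B i \<le> n - 2 * k" using assms by (intro new_min_bound) auto
    \<comment> \<open>One more ray means one power of \<open>N\<close> less in the image; the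
      preceding bounds keep the truncated subtractions exact.\<close>
    have e: "n - k - (i - 1 - 2 * bcount B i) = n - k - (i - 2 * bcount B i) + 1"
      using j j' assms kn by linarith
    have "F i \<subseteq> Npre n k (bcount B i) (Nim n k (n - k - (i - 2 * bcount B i)))"
      using F 3 by (simp add: drop_exp_def drop_tgt_def)
    also have "\<dots> \<subseteq> Npre n k (bcount B i) (Npre n k 1 (Nim n k (n - k - (i - 2 * bcount B i) + 1)))"
      by (intro Npre_mono Nim_subset_Npre kn')
    also have "\<dots> = Npre n k 1 (F (i - 1))" unfolding F1 Npre_Npre b[symmetric] e by (simp add: add.commute)
    finally show ?thesis .
  qed
qed

text \<open>The part of the flag already built satisfies the next condition by itself, so only the
  newly added vector will have to be checked.\<close>

lemma drop_tgt_prefix: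
  assumes "good n k B (i - 1) F" "1 \<le> i" "i \<le> n"
  shows "F (i - 1) \<subseteq> Npre n k (drop_exp B i) (drop_tgt n k B F i)"
proof -
  consider "i \<in> B" | "i \<notin> B" "has_par B i" | "i \<notin> B" "\<not> has_par B i" by blast
  then show ?thesis
  proof cases
    case 1
    have "F (i - 1) \<subseteq> Npre n k 1 (F (i - 1))"
    proof (cases "i = 1")
      case True
      have "(Nop n k) 0 = 0" by (auto simp: Nop_def)
      then show ?thesis using True assms by (auto simp: good_def chain_def Npre_def Vsp_def)
    next
      case False
      have "F (i - 1) \<subseteq> Npre n k 1 (F (i - 1 - 1))"
        using assms False by (intro good_invariant[of "i - 1"]) auto
      also have "\<dots> \<subseteq> Npre n k 1 (F (i - 1))"
        using assms by (intro Npre_mono chain_mono[of n "i - 1"]) (auto simp: good_def)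
      finally show ?thesis .
    qed
    then show ?thesis using 1 by (simp add: drop_exp_def drop_tgt_def)
  next
    case 2
    note p = par_props[OF assms(2) 2]
    define d where "d = (i - 1 - Suc (par B i)) div 2"
    have F1: "F (i - 1) = Npre n k d (F (Suc (par B i)))"
      unfolding d_def using assms p by (intro good_balanced[of "i - 1"]) auto
    have e: "(i - par B i) div 2 = d + 1"
      unfolding d_def using p(4) by simp
    have "F (Suc (par B i)) \<subseteq> Npre n k (drop_exp B (Suc (par B i))) (drop_tgt n k B F (Suc (par B i)))"
      using assms p by (auto simp: good_def)
    then have "F (Suc (par B i)) \<subseteq> Npre n k 1 (F (par B i))"
      using p(3) by (simp add: drop_exp_def drop_tgt_def)
    then have "F (i - 1) \<subseteq> Npre n k d (Npre n k 1 (F (par B i)))"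
      unfolding F1 by (rule Npre_mono)
    then show ?thesis using 2 by (simp add: drop_exp_def drop_tgt_def e Npre_Npre)
  next
    case 3
    have F1: "F (i - 1) = Npre n k (bcount B (i - 1)) (Nim n k (n - k - (i - 1 - 2 * bcount B (i - 1))))"
      using assms no_par_new_min[OF assms(2) 3] by (intro good_prefix_min[of "i - 1"]) auto
    have b: "bcount B i = bcount B (i - 1)" using bcount_Suc[of B "i - 1"] assms(2) 3 by simp
    have "F (i - 1) \<subseteq> Npre n k (bcount B i) (Nim n k (n - k - (i - 2 * bcount B i)))"
      unfolding F1 b by (intro Npre_mono Nim_antimono kn') auto
    then show ?thesis using 3 by (simp add: drop_exp_def drop_tgt_def)
  qed
qed

text \<open>Each preimage under \<open>N\<close> costs one power in the image, and the powers spent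
  up to \<open>i\<close> are counted by the bottom entries up to \<open>i\<close>, of which there
  are \<open>k\<close> in total. This provides the image hypotheses for \<open>dim_Npre\<close> and
  for lifting by \<open>shift\<close>.\<close>

lemma good_subset_Nim:
  assumes "good n k B m F"
  shows "i \<le> m \<Longrightarrow> i \<le> n \<Longrightarrow> F i \<subseteq> Nim n k (k - bcount B i)"
proof (induction i rule: less_induct)
  case (less i)
  show ?case
  proof (cases "i = 0")
    case True
    then show ?thesis using assms cv.subspace_0[OF Nim_subspace] by (auto simp: good_def chain_def)
  next
    case False
    then have i: "1 \<le> i" by simp
    have F: "F i \<subseteq> Npre n k (drop_exp B i) (drop_tgt n k B F i)"
      using assms less.prems i by (auto simp: good_def)
    have bk: "bcount B i \<le> k" by (rule bcount_le_k)
    consider "i \<in> B" | "i \<notin> B" "has_par B i" | "i \<notin> B" "\<not> has_par B i" by blast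
    then show ?thesis
    proof cases
      case 1
      have "bcount B i = bcount B (i - 1) + 1" using bcount_Suc[of B "i - 1"] i 1 by simp
      then have e: "k - bcount B (i - 1) = k - bcount B i + 1" using bk by simp
      have "F i \<subseteq> Npre n k 1 (F (i - 1))" using F 1 by (simp add: drop_exp_def drop_tgt_def)
      also have "\<dots> \<subseteq> Npre n k 1 (Nim n k (k - bcount B i + 1))"
        using less.IH[of "i - 1"] i less.prems unfolding e by (intro Npre_mono) auto
      also have "\<dots> \<subseteq> Nim n k (k - bcount B i)"
        using bk \<open>bcount B i = bcount B (i - 1) + 1\<close> by (intro Npre_Nim_subset kn) auto
      finally show ?thesis .
    next
      case 2
      note p = par_props[OF i 2]
      define d where "d = (i - par B i) div 2"
      have e: "k - bcount B (par B i) = k - bcount B i + d"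
        using balanced_count(2)[OF p(6)] bk d_def by linarith
      have "F i \<subseteq> Npre n k d (F (par B i))" using F 2 by (simp add: drop_exp_def drop_tgt_def d_def)
      also have "\<dots> \<subseteq> Npre n k d (Nim n k (k - bcount B i + d))"
        using less.IH[of "par B i"] p less.prems unfolding e by (intro Npre_mono) auto
      also have "\<dots> \<subseteq> Nim n k (k - bcount B i)"
        using e by (intro Npre_Nim_subset kn) auto
      finally show ?thesis .
    next
      case 3
      have "F i \<subseteq> Npre n k (bcount B i) (Nim n k (n - k - (i - 2 * bcount B i)))"
        using F 3 by (simp add: drop_exp_def drop_tgt_def)
      \<comment> \<open>At most \<open>n - 2 * k\<close> rays occur, so the exponent of the image on
        the left is at least \<open>k\<close>.\<close>
      also have "\<dots> \<subseteq> Npre n k (bcount B i) (Nim n k (k - bcount B i + bcount B i))"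
        using bk new_min_bound[OF less.prems(2)] kn by (intro Npre_mono Nim_antimono kn') linarith
      also have "\<dots> \<subseteq> Nim n k (k - bcount B i)"
        using bk by (intro Npre_Nim_subset kn) auto
      finally show ?thesis .
    qed
  qed
qed

lemma drop_exp_le:
  assumes "1 \<le> i"
  shows "drop_exp B i \<le> k"
proof -
  consider "i \<in> B" | "i \<notin> B" "has_par B i" | "i \<notin> B" "\<not> has_par B i" by blast
  then show ?thesis
  proof cases
    case 1
    have "bcount B i = bcount B (i - 1) + 1" using bcount_Suc[of B "i - 1"] assms 1 by simp
    then show ?thesis using bcount_le_k[of i] 1 by (simp add: drop_exp_def)
  next
    case 2
    then show ?thesis
      using balanced_count(2)[OF par_props(6)[OF assms 2]] bcount_le_k[of i] by (simp add: drop_exp_def)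
  next
    case 3
    then show ?thesis using bcount_le_k by (simp add: drop_exp_def)
  qed
qed

lemma drop_tgt_subset_Nim:
  assumes "good n k B (i - 1) F" "1 \<le> i" "i \<le> n"
  shows "drop_tgt n k B F i \<subseteq> Nim n k (drop_exp B i)"
proof -
  have bk: "bcount B i \<le> k" by (rule bcount_le_k)
  consider "i \<in> B" | "i \<notin> B" "has_par B i" | "i \<notin> B" "\<not> has_par B i" by blast
  then show ?thesis
  proof cases
    case 1
    have b: "bcount B i = bcount B (i - 1) + 1" using bcount_Suc[of B "i - 1"] assms 1 by simp
    have "F (i - 1) \<subseteq> Nim n k (k - bcount B (i - 1))"
      using assms by (intro good_subset_Nim[of "i - 1"]) auto
    also have "\<dots> \<subseteq> Nim n k 1" using b bk by (intro Nim_antimono kn') auto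
    finally show ?thesis using 1 by (simp add: drop_exp_def drop_tgt_def)
  next
    case 2
    note p = par_props[OF assms(2) 2]
    have "F (par B i) \<subseteq> Nim n k (k - bcount B (par B i))"
      using assms p by (intro good_subset_Nim[of "i - 1"]) auto
    also have "\<dots> \<subseteq> Nim n k ((i - par B i) div 2)"
      using balanced_count(2)[OF p(6)] bk by (intro Nim_antimono kn') auto
    finally show ?thesis using 2 by (simp add: drop_exp_def drop_tgt_def)
  next
    case 3
    have "n - k - (i - 2 * bcount B i) \<ge> bcount B i"
      using bk new_min_bound[OF assms(3)] kn by linarith
    then show ?thesis using 3 by (simp add: drop_exp_def drop_tgt_def Nim_antimono kn')
  qed
qed

lemma drop_tgt_subspace:
  assumes "good n k B (i - 1) F" "1 \<le> i"
  shows "cv.subspace (drop_tgt n k B F i)"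
proof -
  have "par B i \<le> i - 1" if "i \<notin> B" "has_par B i"
    using par_props(1)[OF assms(2) that] by simp
  then show ?thesis using assms by (auto simp: drop_tgt_def good_def chain_def)
qed

text \<open>The dimension of the space in which \<open>F i\<close> may be chosen. It contains
  \<open>F (i - 1)\<close>, so a bottom entry leaves a projective line of choices and a top entry
  none.\<close>

lemma dim_drop_pre:
  assumes "good n k B (i - 1) F" "1 \<le> i" "i \<le> n"
  shows "cv.dim (Npre n k (drop_exp B i) (drop_tgt n k B F i)) = (if i \<in> B then i + 1 else i)"
proof -
  have "cv.dim (Npre n k (drop_exp B i) (drop_tgt n k B F i)) = cv.dim (drop_tgt n k B F i) + 2 * drop_exp B i"
    using assms by (intro dim_Npre kn drop_exp_le drop_tgt_subspace drop_tgt_subset_Nim) auto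
  also have "\<dots> = (if i \<in> B then i + 1 else i)"
  proof -
    consider "i \<in> B" | "i \<notin> B" "has_par B i" | "i \<notin> B" "\<not> has_par B i" by blast
    then show ?thesis
    proof cases
      case 1
      then show ?thesis using assms by (auto simp: drop_exp_def drop_tgt_def good_def chain_def)
    next
      case 2
      note p = par_props[OF assms(2) 2]
      have "cv.dim (F (par B i)) = par B i" using assms p by (auto simp: good_def chain_def)
      then show ?thesis using balanced_count(1)[OF p(6)] 2 by (simp add: drop_exp_def drop_tgt_def)
    next
      case 3
      then show ?thesis
        using dim_Nim[OF kn new_min_bound[OF assms(3)]] prefix_min_bcount[OF no_par_new_min(1)[OF assms(2) 3]]
        by (simp add: drop_exp_def drop_tgt_def)
    qed
  qed
  finally show ?thesis .
qed

end

section \<open>The forced relations\<close>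

lemma balanced_trans:
  assumes "balanced B a m" "balanced B m i"
  shows "balanced B a i"
  unfolding balanced_def
proof (intro conjI allI impI)
  show "a \<le> i" "ht B a = ht B i" using assms by (auto simp: balanced_def)
  fix x assume "a \<le> x \<and> x \<le> i"
  then show "ht B i \<le> ht B x" using assms by (cases "x \<le> m") (auto simp: balanced_def)
qed

lemma set_full_type [simp]: "set (full_type n) = {1..n}"
  by (auto simp: full_type_def)

lemma nth_full_type: "l < n \<Longrightarrow> full_type n ! l = Suc l"
  by (simp add: full_type_def nth_append del: upt_Suc)

lemma length_full_type [simp]: "length (full_type n) = n"
  by (simp add: full_type_def)

lemma pflags_full_iff:
  "F \<in> pflags n (full_type n) \<longleftrightarrow> (\<forall>j. j \<notin> {1..n} \<longrightarrow> F j = {}) \<and> chain n n (Fz F)"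
proof -
  have d0: "cv.dim {0} = 0"
    by (metis cv.dim_span_eq_card_independent cv.independent_empty card.empty cv.span_empty)
  have A: "(\<forall>l. Suc l < n \<longrightarrow> F (full_type n ! l) \<subseteq> F (full_type n ! Suc l)) \<longleftrightarrow>
      (\<forall>i. 1 \<le> i \<and> i < n \<longrightarrow> F i \<subseteq> F (Suc i))" (is "?L \<longleftrightarrow> ?R")
  proof
    assume L: ?L
    show ?R
    proof (intro allI impI)
      fix i assume "1 \<le> i \<and> i < n"
      then obtain l where "i = Suc l" "Suc l < n" by (cases i) auto
      then show "F i \<subseteq> F (Suc i)" using L[rule_format, of l] by (simp add: nth_full_type)
    qed
  qed (auto simp: nth_full_type)
  have B: "(\<forall>i\<in>{1..n}. cv.subspace (F i) \<and> F i \<subseteq> Vsp n \<and> cv.dim (F i) = i) \<longleftrightarrow>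
      (\<forall>i\<le>n. cv.subspace (Fz F i) \<and> Fz F i \<subseteq> Vsp n \<and> cv.dim (Fz F i) = i)"
  proof (intro iffI ballI allI impI)
    fix i assume a: "\<forall>i\<in>{1..n}. cv.subspace (F i) \<and> F i \<subseteq> Vsp n \<and> cv.dim (F i) = i" "i \<le> n"
    show "cv.subspace (Fz F i) \<and> Fz F i \<subseteq> Vsp n \<and> cv.dim (Fz F i) = i"
    proof (cases "i = 0")
      case True
      then show ?thesis using cv.subspace_0[OF subspace_Vsp] by (simp add: Fz_def d0)
    next
      case False
      then have "i \<in> {1..n}" using a(2) by simp
      then show ?thesis using a(1) False unfolding Fz_def by simp
    qed
  next
    fix i assume a: "\<forall>i\<le>n. cv.subspace (Fz F i) \<and> Fz F i \<subseteq> Vsp n \<and> cv.dim (Fz F i) = i" "i \<in> {1..n}"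
    then have "cv.subspace (Fz F i) \<and> Fz F i \<subseteq> Vsp n \<and> cv.dim (Fz F i) = i" by simp
    then show "cv.subspace (F i) \<and> F i \<subseteq> Vsp n \<and> cv.dim (F i) = i"
      using a(2) by (simp add: Fz_def)
  qed
  have C: "(\<forall>i<n. Fz F i \<subseteq> Fz F (Suc i)) \<longleftrightarrow> (\<forall>i. 1 \<le> i \<and> i < n \<longrightarrow> F i \<subseteq> F (Suc i))"
    if "\<forall>i\<in>{1..n}. cv.subspace (F i)"
  proof (intro iffI allI impI)
    fix i assume a: "\<forall>i. 1 \<le> i \<and> i < n \<longrightarrow> F i \<subseteq> F (Suc i)" "i < n"
    show "Fz F i \<subseteq> Fz F (Suc i)"
    proof (cases "i = 0")
      case True
      then have "0 \<in> F (Suc i)" using that a(2) by (intro cv.subspace_0) auto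
      then show ?thesis using True by (simp add: Fz_def)
    next
      case False
      then show ?thesis using a by (simp add: Fz_def)
    qed
  next
    fix i assume a: "\<forall>i<n. Fz F i \<subseteq> Fz F (Suc i)" "1 \<le> i \<and> i < n"
    then have "Fz F i \<subseteq> Fz F (Suc i)" by blast
    then show "F i \<subseteq> F (Suc i)" using a(2) by (simp add: Fz_def)
  qed
  \<comment> \<open>The equivalence \<open>C\<close> is available only once the members are known to
    be subspaces, which the second conjunct supplies; this propositional scheme combines the three
    equivalences accordingly.\<close>
  have taut: "(E \<and> Q \<and> P) = (E \<and> Z \<and> Q' \<and> R')"
    if "P = P'" "Q = Q'" "S \<Longrightarrow> R' = P'" "Q \<Longrightarrow> S" Z for E P P' Q Q' R' S Z
    using that by iprover
  show ?thesis
    unfolding pflags_def chain_def set_full_type length_full_type csubspace_def cdim_def mem_Collect_eq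
    by (rule taut[OF A B C]) (assumption, simp, simp add: Fz_def)
qed

context ballot
begin

text \<open>Rule by rule: \<open>ftrans\<close> concatenates intervals, \<open>fii\<close> and
  \<open>fiii1\<close> enclose one between an up-step and a down-step, and \<open>fiii2\<close>
  appends a ray. Every forced relation is thus an instance of \<open>good_balanced\<close> or
  \<open>good_prefix_min\<close>.\<close>

lemma forced_sound:
  assumes top: "\<And>i. in_top \<sigma> i \<longleftrightarrow> i = 0 \<or> (1 \<le> i \<and> i \<le> n \<and> i \<notin> B)"
    and bot: "\<And>i. in_bot \<sigma> i \<longleftrightarrow> i \<in> B"
    and "(i, d, X) \<in> forced n k \<sigma>"
  shows "i \<le> n \<and> (case X of Ref m \<Rightarrow> balanced B m i \<and> d = (i - m) div 2
    | Img j \<Rightarrow> prefix_min B i \<and> d = bcount B i \<and> j = i - 2 * bcount B i)"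
  using assms(3)
proof (induction rule: forced.induct)
  case f0
  then show ?case by (simp add: prefix_min_def)
next
  case (fii i)
  then have i: "i \<notin> B" "i \<le> n" "i - 1 \<in> B" using top bot by auto
  then have i2: "2 \<le> i" using B_subset fii(2) by (cases "i = 1") auto
  have h: "ht B (i - 1) = ht B i + 1" "ht B (i - 2) = ht B i"
    using ht_pred[of i B] ht_pred[of "i - 1" B] i i2 by (auto simp: numeral_2_eq_2)
  have "x = i - 2 \<or> x = i - 1 \<or> x = i" if "i - 2 \<le> x" "x \<le> i" for x using that by linarith
  then have "balanced B (i - 2) i" using h by (fastforce simp: balanced_def)
  then show ?case using i i2 by simp
next
  case (ftrans i a m b X)
  then have im: "balanced B m i" "a = (i - m) div 2" "i \<le> n" by auto
  note c = balanced_count[OF im(1)]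
  show ?case
  proof (cases X)
    case (Ref l)
    then have ml: "balanced B l m" "b = (m - l) div 2" using ftrans by auto
    then have "a + b = (i - l) div 2"
      using c(1) balanced_count(1)[OF ml(1)] im(2) by linarith
    then show ?thesis using Ref ml im balanced_trans by auto
  next
    case (Img j)
    then have m: "prefix_min B m" "b = bcount B m" "j = m - 2 * bcount B m" using ftrans by auto
    have "prefix_min B i"
      unfolding prefix_min_def
    proof (intro allI impI)
      fix x assume "x \<le> i"
      then show "ht B i \<le> ht B x"
        using m(1) im(1) by (cases "x \<le> m") (auto simp: balanced_def prefix_min_def)
    qed
    moreover have "j = i - 2 * bcount B i" using c m(3) by linarith
    moreover have "a + b = bcount B i" using c(2) im(2) m(2) by simp
    ultimately show ?thesis using Img im(3) by simp
  qed
next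
  case (fiii1 i d r)
  then have i: "i \<notin> B" "i \<le> n" "1 \<le> i" "r \<in> B" using top bot by auto
  have r: "balanced B r (i - 1)" "d = (i - 1 - r) div 2" using fiii1 by auto
  have r1: "1 \<le> r" "r \<le> i - 1" using i B_subset r by (auto simp: balanced_def)
  have h: "ht B (i - 1) = ht B i + 1" "ht B (r - 1) = ht B r - 1"
    using ht_pred[of i B] ht_pred[of r B] i r1 by auto
  have "balanced B (r - 1) i"
    unfolding balanced_def
  proof (intro conjI allI impI)
    show "r - 1 \<le> i" using r1 by simp
    show "ht B (r - 1) = ht B i" using r h by (simp add: balanced_def)
    fix x assume "r - 1 \<le> x \<and> x \<le> i"
    then consider "x = r - 1" | "x = i" | "r \<le> x" "x \<le> i - 1" using r1 by linarith
    then show "ht B i \<le> ht B x"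
    proof cases
      case 3
      then have "ht B (i - 1) \<le> ht B x" using r(1) unfolding balanced_def by blast
      then show ?thesis using h by simp
    qed (use r h in \<open>auto simp: balanced_def\<close>)
  qed
  moreover have "d + 1 = (i - (r - 1)) div 2" using r(2) r1 i balanced_count(1)[OF r(1)] by linarith
  ultimately show ?case using i by simp
next
  case (fiii2 i d j)
  then have i: "i \<notin> B" "i \<le> n" "1 \<le> i" using top by auto
  have p: "prefix_min B (i - 1)" "d = bcount B (i - 1)" "j = i - 1 - 2 * bcount B (i - 1)"
    using fiii2 by auto
  have h: "ht B (i - 1) = ht B i + 1" using ht_pred[of i B] i by simp
  have b: "bcount B i = bcount B (i - 1)" using bcount_Suc[of B "i - 1"] i by simp
  have "prefix_min B i"
    unfolding prefix_min_def
  proof (intro allI impI)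
    fix x assume "x \<le> i"
    then consider "x = i" | "x \<le> i - 1" by linarith
    then show "ht B i \<le> ht B x"
    proof cases
      case 2
      then have "ht B (i - 1) \<le> ht B x" using p(1) unfolding prefix_min_def by blast
      then show ?thesis using h by simp
    qed auto
  qed
  moreover have "j + 1 = i - 2 * bcount B i"
    using i p(3) b prefix_min_bcount[OF p(1)] by linarith
  ultimately show ?case using i p b by simp
qed

text \<open>The last cup comes from \<open>fii\<close> if its interior is empty and otherwise from
  \<open>fiii1\<close> applied to the relation of its interior; \<open>ftrans\<close> then joins the
  cups to its left.\<close>

lemma forced_balanced:
  assumes top: "\<And>i. in_top \<sigma> i \<longleftrightarrow> i = 0 \<or> (1 \<le> i \<and> i \<le> n \<and> i \<notin> B)"
    and bot: "\<And>i. in_bot \<sigma> i \<longleftrightarrow> i \<in> B"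
  shows "balanced B m i \<Longrightarrow> m < i \<Longrightarrow> i \<le> n \<Longrightarrow> (i, (i - m) div 2, Ref m) \<in> forced n k \<sigma>"
proof (induction i arbitrary: m rule: less_induct)
  case (less i)
  have i: "1 \<le> i" "i \<notin> B" using less.prems balanced_not_bottom by auto
  note bp = balanced_par[OF less.prems(1,2)]
  note p = par_props[OF i bp(1)]
  let ?y = "par B i"
  have ti: "in_top \<sigma> i" using top i less.prems by simp
  have F: "(i, (i - ?y) div 2, Ref ?y) \<in> forced n k \<sigma>"
  proof (cases "Suc ?y = i - 1")
    case True
    have "in_bot \<sigma> (i - 1)" using bot p(3) True by simp
    have "(i, 1, Ref (i - 2)) \<in> forced n k \<sigma>" by (rule forced.fii[OF ti i(1) \<open>in_bot \<sigma> (i - 1)\<close>])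
    moreover have "i = ?y + 2" using True i by linarith
    then have "i - 2 = ?y" "(i - ?y) div 2 = 1" by linarith+
    ultimately show ?thesis by simp
  next
    case False
    then have lt: "Suc ?y < i - 1" using p(4) by simp
    have "in_top \<sigma> (i - 1)" using balanced_not_bottom[OF p(5) lt] top less.prems lt by auto
    moreover have "(i - 1, (i - 1 - Suc ?y) div 2, Ref (Suc ?y)) \<in> forced n k \<sigma>"
      using less.IH[OF _ p(5) lt] i less.prems by simp
    moreover have "in_bot \<sigma> (Suc ?y)" using bot p(3) by simp
    ultimately have "(i, (i - 1 - Suc ?y) div 2 + 1, Ref (Suc ?y - 1)) \<in> forced n k \<sigma>"
      using ti i by (intro forced.fiii1) auto
    moreover have "(i - 1 - Suc ?y) div 2 + 1 = (i - ?y) div 2" using lt by linarith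
    ultimately show ?thesis by simp
  qed
  show ?case
  proof (cases "m = ?y")
    case False
    then have "(?y, (?y - m) div 2, Ref m) \<in> forced n k \<sigma>"
      using bp less.prems by (intro less.IH) auto
    from forced.ftrans[OF F this]
    have "(i, (i - ?y) div 2 + (?y - m) div 2, Ref m) \<in> forced n k \<sigma>" .
    moreover have "(i - ?y) div 2 + (?y - m) div 2 = (i - m) div 2"
      using balanced_count(1)[OF bp(4)] balanced_count(1)[OF p(6)] bp(2,3) by linarith
    ultimately show ?thesis by simp
  qed (use F in simp)
qed

text \<open>A final cup is attached by \<open>ftrans\<close> and a ray by \<open>fiii2\<close>,
  whose side condition holds by the bound on the number of rays.\<close>

lemma forced_prefix_min:
  assumes top: "\<And>i. in_top \<sigma> i \<longleftrightarrow> i = 0 \<or> (1 \<le> i \<and> i \<le> n \<and> i \<notin> B)"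
    and bot: "\<And>i. in_bot \<sigma> i \<longleftrightarrow> i \<in> B"
  shows "prefix_min B i \<Longrightarrow> i \<le> n \<Longrightarrow> (i, bcount B i, Img (i - 2 * bcount B i)) \<in> forced n k \<sigma>"
proof (induction i rule: less_induct)
  case (less i)
  show ?case
  proof (cases "i = 0")
    case True
    then show ?thesis using forced.f0 by simp
  next
    case False
    then have i: "1 \<le> i" "i \<notin> B" using less.prems prefix_min_not_bottom by auto
    show ?thesis
    proof (cases "has_par B i")
      case True
      note p = par_props[OF i True]
      note c = balanced_count[OF p(6)]
      have "(par B i, bcount B (par B i), Img (par B i - 2 * bcount B (par B i))) \<in> forced n k \<sigma>"
        using less prefix_min_par[OF less.prems(1) i(1) True] p(1) by auto
      from forced.ftrans[OF forced_balanced[OF top bot p(6,1) less.prems(2)] this]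
      have "(i, (i - par B i) div 2 + bcount B (par B i), Img (par B i - 2 * bcount B (par B i))) \<in> forced n k \<sigma>" .
      moreover have "(i - par B i) div 2 + bcount B (par B i) = bcount B i" using c(2) by simp
      moreover have "par B i - 2 * bcount B (par B i) = i - 2 * bcount B i" using c by linarith
      ultimately show ?thesis by simp
    next
      case False
      note p = no_par_new_min[OF i False]
      have b: "bcount B i = bcount B (i - 1)" using bcount_Suc[of B "i - 1"] i by simp
      have c: "2 * bcount B (i - 1) \<le> i - 1" by (rule prefix_min_bcount[OF p(2)])
      have F: "(i - 1, bcount B (i - 1), Img (i - 1 - 2 * bcount B (i - 1))) \<in> forced n k \<sigma>"
        using less.IH[of "i - 1"] less.prems p i by simp
      have "in_top \<sigma> i" using top i less.prems by simp
      moreover have "in_top \<sigma> (i - 1)" using top prefix_min_not_bottom[OF p(2)] less.prems by force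
      moreover have "i - 1 - 2 * bcount B (i - 1) < n - 2 * k"
        using new_min_bound[OF less.prems(2)] b c i by linarith
      ultimately have "(i, bcount B (i - 1), Img (i - 1 - 2 * bcount B (i - 1) + 1)) \<in> forced n k \<sigma>"
        using F i by (intro forced.fiii2) auto
      moreover have "i - 1 - 2 * bcount B (i - 1) + 1 = i - 2 * bcount B i" using b c i by linarith
      ultimately show ?thesis using b by simp
    qed
  qed
qed

text \<open>Each imposed condition is invariance or contained in a forced equality; conversely all
  forced equalities were derived from the imposed conditions.\<close>

lemma Ycomp_eq:
  assumes top: "\<And>i. in_top \<sigma> i \<longleftrightarrow> i = 0 \<or> (1 \<le> i \<and> i \<le> n \<and> i \<notin> B)"
    and bot: "\<And>i. in_bot \<sigma> i \<longleftrightarrow> i \<in> B"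
  shows "Ycomp n k \<sigma> = {F \<in> pflags n (full_type n). good n k B n (Fz F)}"
proof (intro Set.set_eqI iffI)
  fix F assume F: "F \<in> Ycomp n k \<sigma>"
  then have fl: "F \<in> pflags n (full_type n)"
    and inv: "\<And>i. i \<in> {1..n} \<Longrightarrow> F i \<subseteq> Npre n k 1 (Fz F (i - 1))"
    and forced: "\<And>i d X. (i, d, X) \<in> forced n k \<sigma> \<Longrightarrow> Fz F i = Npre n k d (eval_base n k F X)"
    by (auto simp: Ycomp_def)
  have "Fz F i \<subseteq> Npre n k (drop_exp B i) (drop_tgt n k B (Fz F) i)" if i: "i \<in> {1..n}" for i
  proof -
    consider "i \<in> B" | "i \<notin> B" "has_par B i" | "i \<notin> B" "\<not> has_par B i" by blast
    then show ?thesis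
    proof cases
      case 1
      then show ?thesis using inv[OF i] i by (simp add: drop_exp_def drop_tgt_def Fz_def)
    next
      case 2
      then show ?thesis
        using forced[OF forced_balanced[OF top bot, of "par B i" i]] par_props[of i B] i
        by (simp add: drop_exp_def drop_tgt_def)
    next
      case 3
      then show ?thesis
        using forced[OF forced_prefix_min[OF top bot, of i]] no_par_new_min[of i B] i
        by (simp add: drop_exp_def drop_tgt_def)
    qed
  qed
  then show "F \<in> {F \<in> pflags n (full_type n). good n k B n (Fz F)}"
    using fl by (auto simp: good_def pflags_full_iff)
next
  fix F assume "F \<in> {F \<in> pflags n (full_type n). good n k B n (Fz F)}"
  then have fl: "F \<in> pflags n (full_type n)" and g: "good n k B n (Fz F)" by auto
  have "F i \<subseteq> Npre n k 1 (Fz F (i - 1))" if "i \<in> {1..n}" for i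
    using good_invariant[OF g, of i] that by (auto simp: Fz_def)
  moreover have "Fz F i = Npre n k d (eval_base n k F X)" if "(i, d, X) \<in> forced n k \<sigma>" for i d X
    using forced_sound[OF top bot that] good_balanced[OF g, of i] good_prefix_min[OF g, of i]
    by (cases X) auto
  ultimately show "F \<in> Ycomp n k \<sigma>" using fl by (auto simp: Ycomp_def)
qed

end

section \<open>Bases and the Zariski topology\<close>

text \<open>Independence of an ordered family in incremental form. It suits vector-by-vector
  constructions and, unlike independence of the set of values, excludes repetitions.\<close>

definition lind :: "nat \<Rightarrow> (nat \<Rightarrow> nat \<Rightarrow> complex) \<Rightarrow> bool" where
  "lind m w \<longleftrightarrow> (\<forall>j<m. w j \<notin> cv.span (w ` {..<j}))"

lemma lind_Suc: "lind (Suc m) w \<longleftrightarrow> lind m w \<and> w m \<notin> cv.span (w ` {..<m})"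
  by (auto simp: lind_def less_Suc_eq)

lemma dim_lind:
  assumes "lind m w" "\<And>j. j < m \<Longrightarrow> w j \<in> Vsp n"
  shows "cv.dim (cv.span (w ` {..<m})) = m"
  using assms
proof (induction m)
  case 0
  then show ?case by (metis cv.dim_span_eq_card_independent cv.independent_empty card.empty image_empty lessThan_0)
next
  case (Suc m)
  have "cv.dim (insert (w m) (w ` {..<m})) = Suc (cv.dim (w ` {..<m}))"
    using Suc.prems by (intro cdim_insert[of _ n]) (auto simp: lind_Suc)
  then show ?case using Suc by (simp add: lessThan_Suc lind_Suc)
qed

lemma span_initial_iff:
  fixes m :: nat
  shows "v \<in> cv.span (w ` {..<m}) \<longleftrightarrow> (\<exists>a. v = (\<Sum>i<m. cscale (a i) (w i)))"
proof
  assume "v \<in> cv.span (w ` {..<m})"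
  then show "\<exists>a. v = (\<Sum>i<m. cscale (a i) (w i))"
  proof (induction m arbitrary: v rule: nat_induct)
    case 0
    then show ?case by simp
  next
    case (Suc m)
    then obtain c where "v - cscale c (w m) \<in> cv.span (w ` {..<m})"
      by (auto simp: lessThan_Suc cv.span_breakdown_eq)
    then obtain a where "v - cscale c (w m) = (\<Sum>i<m. cscale (a i) (w i))" using Suc.IH by blast
    then have "v = (\<Sum>i<Suc m. cscale ((a(m := c)) i) (w i))"
      by (simp add: algebra_simps)
    then show ?case by blast
  qed
next
  assume "\<exists>a. v = (\<Sum>i<m. cscale (a i) (w i))"
  then show "v \<in> cv.span (w ` {..<m})"
    by (auto intro!: cv.span_sum cv.span_scale intro: cv.span_base)
qed

lemma lind_zeroD:
  assumes "lind m w" "(\<Sum>i<m. cscale (c i) (w i)) = 0" "i < m"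
  shows "c i = 0"
  using assms
proof (induction m)
  case (Suc m)
  have "c m = 0"
  proof (rule ccontr)
    assume cm: "c m \<noteq> 0"
    have "cscale (c m) (w m) = - (\<Sum>i<m. cscale (c i) (w i))"
      using Suc.prems(2) unfolding sum.lessThan_Suc by (metis add.commute eq_neg_iff_add_eq_0)
    then have "cscale (c m) (w m) \<in> cv.span (w ` {..<m})"
      using span_initial_iff cv.span_neg by metis
    then have "cscale (inverse (c m)) (cscale (c m) (w m)) \<in> cv.span (w ` {..<m})"
      by (rule cv.span_scale)
    then show False using cm Suc.prems(1) by (simp add: lind_Suc)
  qed
  moreover from this have "(\<Sum>i<m. cscale (c i) (w i)) = 0"
    using Suc.prems(2) unfolding sum.lessThan_Suc by (metis add.right_neutral cv.scale_zero_left)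
  moreover have "lind m w" using Suc.prems(1) by (simp only: lind_Suc)
  ultimately show ?case using Suc.IH Suc.prems(3) by (metis less_antisym)
qed simp

lemma GL_iff: "g \<in> GL n \<longleftrightarrow> (\<forall>i j. n \<le> i \<or> n \<le> j \<longrightarrow> g i j = 0) \<and> lind n (Defs.col g)"
proof -
  have "cv.span (Defs.col g ` {..<n}) = Vsp n \<longleftrightarrow> lind n (Defs.col g)"
    if g: "\<forall>i j. n \<le> i \<or> n \<le> j \<longrightarrow> g i j = 0"
  proof
    let ?w = "Defs.col g"
    assume sp: "cv.span (?w ` {..<n}) = Vsp n"
    show "lind n ?w"
      unfolding lind_def
    proof (intro allI impI notI)
      fix j assume j: "j < n" "?w j \<in> cv.span (?w ` {..<j})"
      let ?S = "?w ` ({..<n} - {j})"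
      have "?w j \<in> cv.span ?S"
        using j cv.span_mono[of "?w ` {..<j}" ?S] by fastforce
      then have "?w ` {..<n} \<subseteq> cv.span ?S"
        by (auto simp: image_iff intro: cv.span_base)
      then have "cv.dim (?w ` {..<n}) \<le> card ?S" by (intro cv.dim_le_card) auto
      also have "\<dots> \<le> card ({..<n} - {j})" by (rule card_image_le) auto
      also have "\<dots> < n" using j by simp
      finally show False using sp by (metis cv.dim_span dim_Vsp less_irrefl)
    qed
  next
    assume l: "lind n (Defs.col g)"
    have V: "Defs.col g j \<in> Vsp n" for j using g by (auto simp: Defs.col_def Vsp_def)
    have "cv.dim (cv.span (Defs.col g ` {..<n})) = n" using l V by (rule dim_lind)
    then show "cv.span (Defs.col g ` {..<n}) = Vsp n"
      using V by (intro csubspace_eqI[of _ _ n] cv.span_minimal) auto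
  qed
  then show ?thesis unfolding GL_def by auto
qed

lemma col_in_Vsp: "g \<in> GL n \<Longrightarrow> Defs.col g j \<in> Vsp n"
  by (auto simp: GL_def Defs.col_def Vsp_def)

section \<open>Invertibility and membership in spans through determinants\<close>

definition Dt :: "nat \<Rightarrow> (nat \<Rightarrow> nat \<Rightarrow> complex) \<Rightarrow> complex" where
  "Dt n h = det (mat n n (\<lambda>(i, j). h i j))"

lemma Dt_eq_0_iff:
  "Dt n h = 0 \<longleftrightarrow> (\<exists>c. (\<exists>j<n. c j \<noteq> 0) \<and> (\<forall>i<n. (\<Sum>j<n. c j * h i j) = 0))"
proof -
  let ?A = "mat n n (\<lambda>(i, j). h i j)"
  have prod: "(?A *\<^sub>v v) $ i = (\<Sum>j<n. v $ j * h i j)" if "v \<in> carrier_vec n" "i < n" for v i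
    using that by (auto simp: scalar_prod_def row_def lessThan_atLeast0 mult.commute intro!: sum.cong)
  have "Dt n h = 0 \<longleftrightarrow> (\<exists>v. v \<in> carrier_vec n \<and> v \<noteq> 0\<^sub>v n \<and> ?A *\<^sub>v v = 0\<^sub>v n)"
    unfolding Dt_def by (rule det_0_iff_vec_prod_zero_field) simp
  also have "\<dots> \<longleftrightarrow> (\<exists>c. (\<exists>j<n. c j \<noteq> 0) \<and> (\<forall>i<n. (\<Sum>j<n. c j * h i j) = 0))"
  proof
    assume "\<exists>v. v \<in> carrier_vec n \<and> v \<noteq> 0\<^sub>v n \<and> ?A *\<^sub>v v = 0\<^sub>v n"
    then obtain v where v: "v \<in> carrier_vec n" "v \<noteq> 0\<^sub>v n" "?A *\<^sub>v v = 0\<^sub>v n" by blast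
    have "\<exists>j<n. v $ j \<noteq> 0" using v(1,2) by (auto simp: vec_eq_iff)
    moreover have "\<forall>i<n. (\<Sum>j<n. v $ j * h i j) = 0" using prod[OF v(1)] v(3) by (metis index_zero_vec(1))
    ultimately show "\<exists>c. (\<exists>j<n. c j \<noteq> 0) \<and> (\<forall>i<n. (\<Sum>j<n. c j * h i j) = 0)" by blast
  next
    assume "\<exists>c. (\<exists>j<n. c j \<noteq> 0) \<and> (\<forall>i<n. (\<Sum>j<n. c j * h i j) = 0)"
    then obtain c where c: "\<exists>j<n. c j \<noteq> 0" "\<forall>i<n. (\<Sum>j<n. c j * h i j) = 0" by blast
    have 1: "vec n c \<in> carrier_vec n" by simp
    have "?A *\<^sub>v vec n c = 0\<^sub>v n"
    proof (rule eq_vecI)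
      show "dim_vec (?A *\<^sub>v vec n c) = dim_vec (0\<^sub>v n)" by simp
      fix i assume "i < dim_vec (0\<^sub>v n)"
      then show "(?A *\<^sub>v vec n c) $ i = 0\<^sub>v n $ i" using prod[OF 1, of i] c(2) by simp
    qed
    moreover have "vec n c \<noteq> 0\<^sub>v n" using c(1) by (auto simp: vec_eq_iff)
    ultimately show "\<exists>v. v \<in> carrier_vec n \<and> v \<noteq> 0\<^sub>v n \<and> ?A *\<^sub>v v = 0\<^sub>v n" using 1 by blast
  qed
  finally show ?thesis .
qed

lemma combination_Vsp_iff:
  assumes "\<And>j. j < n \<Longrightarrow> w j \<in> Vsp n"
  shows "(\<Sum>j<n. cscale (c j) (w j)) = 0 \<longleftrightarrow> (\<forall>i<n. (\<Sum>j<n. c j * w j i) = 0)"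
proof -
  have "(\<Sum>j<n. c j * w j i) = 0" if "\<not> i < n" for i
    using assms that by (intro sum.neutral) (auto simp: Vsp_def)
  then show ?thesis
    by (auto simp: fun_eq_iff sum_fun_apply cscale_apply)
qed

lemma GL_iff_Dt: "g \<in> GL n \<longleftrightarrow> (\<forall>i j. n \<le> i \<or> n \<le> j \<longrightarrow> g i j = 0) \<and> Dt n g \<noteq> 0"
proof -
  have "lind n (Defs.col g) \<longleftrightarrow> Dt n g \<noteq> 0" if g: "\<forall>i j. n \<le> i \<or> n \<le> j \<longrightarrow> g i j = 0"
  proof -
    let ?w = "Defs.col g"
    have V: "?w j \<in> Vsp n" for j using g by (auto simp: Defs.col_def Vsp_def)
    have D: "Dt n g = 0 \<longleftrightarrow> (\<exists>c. (\<exists>j<n. c j \<noteq> 0) \<and> (\<Sum>j<n. cscale (c j) (?w j)) = 0)"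
      unfolding Dt_eq_0_iff combination_Vsp_iff[OF V] by (simp add: Defs.col_def)
    have "\<exists>c. (\<exists>j<n. c j \<noteq> 0) \<and> (\<Sum>j<n. cscale (c j) (?w j)) = 0" if nl: "\<not> lind n ?w"
    proof -
      obtain j where j: "j < n" "?w j \<in> cv.span (?w ` {..<j})" using nl by (auto simp: lind_def)
      then obtain a where a: "?w j = (\<Sum>i<j. cscale (a i) (?w i))" using span_initial_iff by blast
      define c where "c = (\<lambda>i. if i < j then a i else if i = j then - 1 else 0)"
      have "(\<Sum>i<n. cscale (c i) (?w i)) = (\<Sum>i\<in>{..<Suc j}. cscale (c i) (?w i))"
        using j by (intro sum.mono_neutral_right) (auto simp: c_def)
      also have "\<dots> = (\<Sum>i<j. cscale (c i) (?w i)) - ?w j" by (simp add: c_def)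
      also have "(\<Sum>i<j. cscale (c i) (?w i)) = ?w j" unfolding a by (intro sum.cong) (auto simp: c_def)
      finally have "(\<Sum>i<n. cscale (c i) (?w i)) = 0" by (simp add: zero_fun_def)
      moreover have "c j \<noteq> 0" by (simp add: c_def)
      ultimately show ?thesis using j by blast
    qed
    then show ?thesis using D lind_zeroD[of n ?w] by blast
  qed
  then show ?thesis unfolding GL_iff by blast
qed

text \<open>The idea of Cramer's rule: the determinant with column \<open>q\<close> replaced by
  \<open>v\<close> vanishes exactly when the \<open>q\<close>-th coordinate of \<open>v\<close> in
  the basis of columns does. This tests the span without inverting \<open>g\<close>, hence by
  polynomials.\<close>

lemma span_iff_Dt:
  assumes g: "g \<in> GL n" and v: "v \<in> Vsp n" and "m \<le> n"
  shows "v \<in> cv.span (Defs.col g ` {..<m}) \<longleftrightarrow>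
    (\<forall>q. m \<le> q \<and> q < n \<longrightarrow> Dt n (\<lambda>i j. if j = q then v i else g i j) = 0)" (is "_ \<longleftrightarrow> ?R")
proof -
  let ?w = "Defs.col g"
  have V: "?w j \<in> Vsp n" for j using col_in_Vsp[OF g] .
  have l: "lind n ?w" using g GL_iff by blast
  have "v \<in> cv.span (?w ` {..<n})" using g v by (simp add: GL_def)
  then obtain a where a: "v = (\<Sum>i<n. cscale (a i) (?w i))" using span_initial_iff by blast
  define u where "u q = ?w(q := v)" for q
  have uV: "u q j \<in> Vsp n" for q j using V v by (auto simp: u_def)
  have D: "Dt n (\<lambda>i j. if j = q then v i else g i j) = 0 \<longleftrightarrow>
     (\<exists>c. (\<exists>j<n. c j \<noteq> 0) \<and> (\<Sum>j<n. cscale (c j) (u q j)) = 0)" for q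
    unfolding Dt_eq_0_iff combination_Vsp_iff[OF uV]
    by (simp add: u_def Defs.col_def fun_upd_def if_distrib[of "\<lambda>f. f _"] cong: if_cong)
  \<comment> \<open>Rewrites a combination of the replaced columns in the original basis, where the
    coefficient at \<open>q\<close> becomes \<open>c q * a q\<close>.\<close>
  have expand: "(\<Sum>j<n. cscale (c j) (u q j)) = (\<Sum>j<n. cscale (if j = q then c q * a q else c j + c q * a j) (?w j))"
    if "q < n" for c q
  proof -
    have "(\<Sum>j<n. cscale (c j) (u q j)) = cscale (c q) v + (\<Sum>j\<in>{..<n} - {q}. cscale (c j) (?w j))"
      using that by (subst sum.remove[of _ q]) (auto simp: u_def intro!: sum.cong)
    also have "cscale (c q) v = (\<Sum>j<n. cscale (c q * a j) (?w j))"
      by (simp add: a cv.scale_sum_right)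
    also have "\<dots> = cscale (c q * a q) (?w q) + (\<Sum>j\<in>{..<n} - {q}. cscale (c q * a j) (?w j))"
      using that by (subst sum.remove[of _ q]) auto
    also have "\<dots> + (\<Sum>j\<in>{..<n} - {q}. cscale (c j) (?w j)) =
       cscale (c q * a q) (?w q) + (\<Sum>j\<in>{..<n} - {q}. cscale (c j + c q * a j) (?w j))"
      by (simp add: sum.distrib[symmetric] cv.scale_left_distrib[symmetric] add.assoc add.commute)
    also have "\<dots> = (\<Sum>j<n. cscale (if j = q then c q * a q else c j + c q * a j) (?w j))"
      using that by (subst (2) sum.remove[of _ q]) (auto intro!: sum.cong)
    finally show ?thesis .
  qed
  have key: "Dt n (\<lambda>i j. if j = q then v i else g i j) = 0 \<longleftrightarrow> a q = 0" if q: "q < n" for q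
  proof
    assume "Dt n (\<lambda>i j. if j = q then v i else g i j) = 0"
    then obtain c where c: "\<exists>j<n. c j \<noteq> 0" "(\<Sum>j<n. cscale (c j) (u q j)) = 0" using D by blast
    have z: "(if j = q then c q * a q else c j + c q * a j) = 0" if "j < n" for j
      by (rule lind_zeroD[OF l _ that]) (use c(2) expand[OF q, of c] in simp)
    show "a q = 0"
    proof (rule ccontr)
      assume "a q \<noteq> 0"
      then have "c q = 0" using z[OF q] by simp
      then have "c j = 0" if "j < n" for j using z[OF that] by (auto split: if_splits)
      then show False using c(1) by blast
    qed
  next
    assume aq: "a q = 0"
    \<comment> \<open>If \<open>a q = 0\<close>, the expansion of \<open>v\<close> uses only the
      other columns and is itself a dependency among the replaced ones.\<close>
    define c where "c = (\<lambda>j. if j = q then 1 else - a j)"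
    have "(\<Sum>j<n. cscale (c j) (u q j)) = 0"
      unfolding expand[OF q] by (intro sum.neutral) (auto simp: c_def aq)
    moreover have "c q \<noteq> 0" by (simp add: c_def)
    ultimately show "Dt n (\<lambda>i j. if j = q then v i else g i j) = 0" using D q by blast
  qed
  show ?thesis
  proof
    assume "v \<in> cv.span (?w ` {..<m})"
    then obtain b where b: "v = (\<Sum>i<m. cscale (b i) (?w i))" using span_initial_iff by blast
    have "(\<Sum>i<n. cscale (if i < m then b i else 0) (?w i)) = (\<Sum>i<m. cscale (if i < m then b i else 0) (?w i))"
      using assms(3) by (intro sum.mono_neutral_right) auto
    also have "\<dots> = v" unfolding b by (intro sum.cong) auto
    finally have z: "(\<Sum>i<n. cscale (a i - (if i < m then b i else 0)) (?w i)) = 0"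
      using a by (simp add: cv.scale_left_diff_distrib sum_subtractf)
    have "a i - (if i < m then b i else 0) = 0" if "i < n" for i
      by (rule lind_zeroD[OF l z that])
    then show ?R using key by force
  next
    assume ?R
    then have z: "a q = 0" if "m \<le> q" "q < n" for q using key that by blast
    have "v = (\<Sum>i<m. cscale (a i) (?w i))"
      unfolding a using z assms(3) by (intro sum.mono_neutral_right) auto
    then show "v \<in> cv.span (?w ` {..<m})" using span_initial_iff by blast
  qed
qed

lemma polyfun_sum: "(\<And>a. a \<in> A \<Longrightarrow> f a \<in> polyfun n) \<Longrightarrow> (\<lambda>g. \<Sum>a\<in>A. f a g) \<in> polyfun n"
  by (induction A rule: infinite_finite_induct) (auto intro: polyfun.intros)

lemma polyfun_prod: "(\<And>a. a \<in> A \<Longrightarrow> f a \<in> polyfun n) \<Longrightarrow> (\<lambda>g. \<Prod>a\<in>A. f a g) \<in> polyfun n"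
  by (induction A rule: infinite_finite_induct) (auto intro: polyfun.intros)

lemma polyfun_Dt:
  assumes "\<And>i j. i < n \<Longrightarrow> j < n \<Longrightarrow> (\<lambda>g. f g i j) \<in> polyfun n"
  shows "(\<lambda>g. Dt n (f g)) \<in> polyfun n"
proof -
  have "Dt n (f g) = (\<Sum>p\<in>{p. p permutes {0..<n}}. signof p * (\<Prod>i = 0..<n. f g i (p i)))" for g
    unfolding Dt_def det_def
    by (auto intro!: sum.cong prod.cong simp: permutes_in_image)
  moreover have "(\<lambda>g. \<Sum>p\<in>{p. p permutes {0..<n}}. signof p * (\<Prod>i = 0..<n. f g i (p i))) \<in> polyfun n"
    by (intro polyfun_sum polyfun.pmult polyfun.pconst polyfun_prod assms)
       (auto simp: permutes_in_image dest: permutes_in_image)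
  ultimately show ?thesis by simp
qed

section \<open>Partial flags and the matrices that represent them\<close>

lemma is_type_bounds:
  assumes "is_type n is" "i \<in> set is"
  shows "1 \<le> i" "i \<le> n"
proof -
  have s: "sorted is" "is \<noteq> []" "0 < hd is" "last is = n"
    using assms(1) by (auto simp: is_type_def intro: strict_sorted_imp_sorted)
  obtain l where l: "l < length is" "i = is ! l" using assms(2) by (auto simp: in_set_conv_nth)
  have "is ! 0 \<le> is ! l" "is ! l \<le> is ! (length is - 1)"
    using s l by (auto intro!: sorted_nth_mono)
  then show "1 \<le> i" "i \<le> n" using s l by (auto simp: hd_conv_nth last_conv_nth)
qed

lemma is_type_last: "is_type n is \<Longrightarrow> n \<in> set is"
  using last_in_set by (auto simp: is_type_def)

lemma is_type_pos: "is_type n is \<Longrightarrow> 1 \<le> n"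
  using is_type_bounds is_type_last by blast

lemma pflags_mono:
  assumes "is_type n is" "F \<in> pflags n is" "i \<in> set is" "j \<in> set is" "i \<le> j"
  shows "F i \<subseteq> F j"
proof -
  have st: "sorted_wrt (<) is" using assms(1) by (simp add: is_type_def)
  obtain a b where ab: "a < length is" "i = is ! a" "b < length is" "j = is ! b"
    using assms by (auto simp: in_set_conv_nth)
  have "a \<le> b"
  proof (rule ccontr)
    assume "\<not> a \<le> b"
    then have "is ! b < is ! a" using sorted_wrt_nth_less[OF st, of b a] ab by simp
    then show False using ab assms(5) by simp
  qed
  then have "F (is ! a) \<subseteq> F (is ! b)"
    using ab(3)
  proof (induction b rule: dec_induct)
    case (step c)
    then have "F (is ! c) \<subseteq> F (is ! Suc c)" using assms(2) by (simp add: pflags_def)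
    then show ?case using step by simp
  qed simp
  then show ?thesis using ab by simp
qed

lemma pflagsI:
  assumes "is_type n is" "\<And>j. j \<notin> set is \<Longrightarrow> F j = {}"
    "\<And>i. i \<in> set is \<Longrightarrow> cv.subspace (F i)" "\<And>i. i \<in> set is \<Longrightarrow> F i \<subseteq> Vsp n"
    "\<And>i. i \<in> set is \<Longrightarrow> cv.dim (F i) = i"
    "\<And>i j. i \<in> set is \<Longrightarrow> j \<in> set is \<Longrightarrow> i < j \<Longrightarrow> F i \<subseteq> F j"
  shows "F \<in> pflags n is"
proof -
  have st: "sorted_wrt (<) is" using assms(1) by (simp add: is_type_def)
  show ?thesis
    unfolding pflags_def mem_Collect_eq csubspace_def cdim_def
  proof (intro conjI allI ballI impI)
    fix l assume "Suc l < length is"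
    then show "F (is ! l) \<subseteq> F (is ! Suc l)"
      using sorted_wrt_nth_less[OF st, of l "Suc l"] by (intro assms(6)) auto
  qed (use assms in simp_all)
qed

lemma is_type_full: "1 \<le> n \<Longrightarrow> is_type n (full_type n)"
  by (auto simp: is_type_def full_type_def simp del: upt_Suc)

lemma flag_of_in_pflags:
  assumes "is_type n is" "g \<in> GL n"
  shows "flag_of is g \<in> pflags n is"
proof (rule pflagsI[OF assms(1)])
  note b = is_type_bounds[OF assms(1)]
  have l: "lind n (Defs.col g)" using assms GL_iff by blast
  show "flag_of is g j = {}" if "j \<notin> set is" for j using that by (simp add: flag_of_def)
  show "cv.subspace (flag_of is g i)" if "i \<in> set is" for i using that by (simp add: flag_of_def)
  show "flag_of is g i \<subseteq> Vsp n" if "i \<in> set is" for i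
  proof -
    have "cv.span (Defs.col g ` {..<i}) \<subseteq> Vsp n"
      using col_in_Vsp[OF assms(2)] by (intro cv.span_minimal) auto
    then show ?thesis using that by (simp add: flag_of_def)
  qed
  show "cv.dim (flag_of is g i) = i" if i: "i \<in> set is" for i
  proof -
    have "lind i (Defs.col g)" using l b[OF i] by (auto simp: lind_def)
    then show ?thesis using dim_lind[of i "Defs.col g" n] i col_in_Vsp[OF assms(2)] by (simp add: flag_of_def)
  qed
  show "flag_of is g i \<subseteq> flag_of is g j" if "i \<in> set is" "j \<in> set is" "i < j" for i j
  proof -
    have "cv.span (Defs.col g ` {..<i}) \<subseteq> cv.span (Defs.col g ` {..<j})"
      using that(3) by (intro cv.span_mono image_mono) auto
    then show ?thesis using that by (simp add: flag_of_def)
  qed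
qed

lemma flag_of_surj:
  assumes "is_type n is" "F \<in> pflags n is"
  obtains g where "g \<in> GL n" "flag_of is g = F"
proof -
  note b = is_type_bounds[OF assms(1)]
  have F: "cv.subspace (F i)" "F i \<subseteq> Vsp n" "cv.dim (F i) = i" if "i \<in> set is" for i
    using assms(2) that by (auto simp: pflags_def)
  have "\<exists>w. lind m w \<and> (\<forall>l<m. \<forall>i\<in>set is. l < i \<longrightarrow> w l \<in> F i)" if "m \<le> n" for m
    using that
  proof (induction m)
    case 0
    then show ?case by (auto simp: lind_def)
  next
    case (Suc m)
    then obtain w where w: "lind m w" "\<And>l i. l < m \<Longrightarrow> i \<in> set is \<Longrightarrow> l < i \<Longrightarrow> w l \<in> F i" by auto
    \<comment> \<open>The new vector comes from the smallest member of dimension above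
      \<open>m\<close>: it has room outside the current span, and its vectors lie in all larger
      members.\<close>
    define i' where "i' = Min {i \<in> set is. m < i}"
    have "n \<in> {i \<in> set is. m < i}" using is_type_last[OF assms(1)] Suc.prems by simp
    then have "i' \<in> {i \<in> set is. m < i}"
      unfolding i'_def by (intro Min_in) auto
    then have i': "i' \<in> set is" "m < i'" by auto
    have i'_min: "i' \<le> i" if "i \<in> set is" "m < i" for i
      unfolding i'_def using that by (intro Min_le) auto
    have sub: "cv.span (w ` {..<m}) \<subseteq> F i'"
      using w i' F by (intro cv.span_minimal) auto
    have "cv.dim (cv.span (w ` {..<m})) = m"
    proof (rule dim_lind[of _ _ n])
      show "w j \<in> Vsp n" if "j < m" for j
        using w(2)[OF that i'(1)] i'(2) that F(2)[OF i'(1)] by auto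
    qed (rule w(1))
    then have "cv.span (w ` {..<m}) \<noteq> F i'" using F(3)[OF i'(1)] i'(2) by (metis less_irrefl)
    then obtain v where v: "v \<in> F i'" "v \<notin> cv.span (w ` {..<m})" using sub by blast
    have eq: "(w(m := v)) ` {..<j} = w ` {..<j}" if "j \<le> m" for j using that by auto
    have "lind (Suc m) (w(m := v))"
      unfolding lind_def
    proof (intro allI impI)
      fix j assume "j < Suc m"
      then have "j \<le> m" by simp
      then show "(w(m := v)) j \<notin> cv.span ((w(m := v)) ` {..<j})"
        unfolding eq[OF \<open>j \<le> m\<close>] using w(1) v(2) by (cases "j = m") (simp_all add: lind_def)
    qed
    moreover have "(w(m := v)) l \<in> F i" if "l < Suc m" "i \<in> set is" "l < i" for l i
    proof (cases "l = m")
      case True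
      have "F i' \<subseteq> F i" using pflags_mono[OF assms i'(1) that(2)] i'_min that True by simp
      then show ?thesis using v True by auto
    qed (use that w in auto)
    ultimately show ?case by blast
  qed
  then obtain w where w: "lind n w" "\<And>l i. l < n \<Longrightarrow> i \<in> set is \<Longrightarrow> l < i \<Longrightarrow> w l \<in> F i"
    by (metis le_refl)
  have wV: "w l \<in> Vsp n" if "l < n" for l
    using w(2)[OF that is_type_last[OF assms(1)] that] F(2) is_type_last[OF assms(1)] by blast
  define g where "g = (\<lambda>i j. if j < n then w j i else 0)"
  have col: "Defs.col g j = w j" if "j < n" for j using that by (simp add: Defs.col_def g_def)
  have im: "Defs.col g ` {..<j} = w ` {..<j}" if "j \<le> n" for j using col that by auto
  have "lind n (Defs.col g)" using w(1) by (auto simp: lind_def col im)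
  moreover have "\<forall>i j. n \<le> i \<or> n \<le> j \<longrightarrow> g i j = 0"
    using wV by (auto simp: g_def Vsp_def)
  ultimately have G: "g \<in> GL n" by (simp add: GL_iff)
  have "flag_of is g = F"
  proof
    fix i
    show "flag_of is g i = F i"
    proof (cases "i \<in> set is")
      case True
      have "cv.span (w ` {..<i}) = F i"
      proof (rule csubspace_eqI[of _ _ n])
        show "cv.span (w ` {..<i}) \<subseteq> F i"
        proof (rule cv.span_minimal)
          have "w l \<in> F i" if "l < i" for l
            using w(2)[of l i] that True b(2)[OF True] by simp
          then show "w ` {..<i} \<subseteq> F i" by blast
        qed (use F True in simp)
        have "lind i w" using w(1) b[OF True] by (auto simp: lind_def)
        then have "cv.dim (cv.span (w ` {..<i})) = i"
          using wV b[OF True] by (intro dim_lind[of _ _ n]) auto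
        then show "cv.dim (F i) \<le> cv.dim (cv.span (w ` {..<i}))" using F True by simp
      qed (use F True in auto)
      then show ?thesis using True im[of i] b by (simp add: flag_of_def)
    next
      case False
      then show ?thesis using assms(2) by (simp add: flag_of_def pflags_def)
    qed
  qed
  then show ?thesis using that G by blast
qed

section \<open>Closed sets of partial flags\<close>

lemma zclosed_Un:
  assumes "zclosed n is C1" "zclosed n is C2"
  shows "zclosed n is (C1 \<union> C2)"
proof -
  obtain P1 where P1: "P1 \<subseteq> polyfun n" "{g \<in> GL n. flag_of is g \<in> C1} = {g \<in> GL n. \<forall>p\<in>P1. p g = 0}"
    using assms(1) by (auto simp: zclosed_def)
  obtain P2 where P2: "P2 \<subseteq> polyfun n" "{g \<in> GL n. flag_of is g \<in> C2} = {g \<in> GL n. \<forall>p\<in>P2. p g = 0}"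
    using assms(2) by (auto simp: zclosed_def)
  define P where "P = (\<lambda>(p, q) g. p g * q g) ` (P1 \<times> P2)"
  have "P \<subseteq> polyfun n" using P1(1) P2(1) by (auto simp: P_def intro!: polyfun.pmult)
  moreover have "flag_of is g \<in> C1 \<union> C2 \<longleftrightarrow> (\<forall>p\<in>P. p g = 0)" if "g \<in> GL n" for g
  proof -
    have "flag_of is g \<in> C1 \<longleftrightarrow> (\<forall>p\<in>P1. p g = 0)" "flag_of is g \<in> C2 \<longleftrightarrow> (\<forall>p\<in>P2. p g = 0)"
      using P1(2) P2(2) that by blast+
    then show ?thesis unfolding P_def by auto
  qed
  ultimately show ?thesis using assms unfolding zclosed_def by (intro conjI exI[of _ P]) auto
qed

lemma zclosed_empty: "zclosed n is {}"
  unfolding zclosed_def by (intro conjI exI[of _ "{\<lambda>_. 1}"]) (auto intro: polyfun.pconst)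

lemma zclosed_Union: "finite A \<Longrightarrow> (\<And>C. C \<in> A \<Longrightarrow> zclosed n is C) \<Longrightarrow> zclosed n is (\<Union>A)"
  by (induction A rule: finite_induct) (auto intro: zclosed_Un zclosed_empty)

lemma zclosed_Collect_all:
  assumes "\<And>a. a \<in> A \<Longrightarrow> zclosed n is {F \<in> pflags n is. Q a F}" "is_type n is"
  shows "zclosed n is {F \<in> pflags n is. \<forall>a\<in>A. Q a F}"
proof -
  have "\<forall>a\<in>A. \<exists>P. P \<subseteq> polyfun n \<and>
      {g \<in> GL n. flag_of is g \<in> {F \<in> pflags n is. Q a F}} = {g \<in> GL n. \<forall>p\<in>P. p g = 0}"
    using assms(1) unfolding zclosed_def by blast
  from bchoice[OF this] obtain P where PP: "\<forall>a\<in>A. P a \<subseteq> polyfun n \<and>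
      {g \<in> GL n. flag_of is g \<in> {F \<in> pflags n is. Q a F}} = {g \<in> GL n. \<forall>p\<in>P a. p g = 0}" ..
  then have P: "\<And>a. a \<in> A \<Longrightarrow> P a \<subseteq> polyfun n"
    "\<And>a. a \<in> A \<Longrightarrow> {g \<in> GL n. flag_of is g \<in> {F \<in> pflags n is. Q a F}} = {g \<in> GL n. \<forall>p\<in>P a. p g = 0}"
    by simp_all
  have "flag_of is g \<in> {F \<in> pflags n is. \<forall>a\<in>A. Q a F} \<longleftrightarrow> (\<forall>p\<in>\<Union>(P ` A). p g = 0)" if "g \<in> GL n" for g
  proof -
    have "Q a (flag_of is g) \<longleftrightarrow> (\<forall>p\<in>P a. p g = 0)" if "a \<in> A" for a
    proof -
      have "g \<in> {g \<in> GL n. flag_of is g \<in> {F \<in> pflags n is. Q a F}} \<longleftrightarrow> g \<in> {g \<in> GL n. \<forall>p\<in>P a. p g = 0}"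
        unfolding P(2)[OF that] ..
      then show ?thesis using \<open>g \<in> GL n\<close> flag_of_in_pflags[OF assms(2) \<open>g \<in> GL n\<close>] by simp
    qed
    then show ?thesis using flag_of_in_pflags[OF assms(2) that] by auto
  qed
  moreover have "\<Union>(P ` A) \<subseteq> polyfun n" using P(1) by blast
  ultimately show ?thesis
    unfolding zclosed_def by (intro conjI exI[of _ "\<Union>(P ` A)"]) auto
qed

lemma polyfun_Nop:
  assumes "i < n" "l < n"
  shows "(\<lambda>g. if in_range n k e i then g (i + e) l else 0) \<in> polyfun n"
  using assms by (cases "in_range n k e i") (auto simp: in_range_def intro: polyfun.intros)

lemma Fz_flag_of:
  assumes "m \<in> insert 0 (set is)"
  shows "Fz (flag_of is g) m = cv.span (Defs.col g ` {..<m})"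
  using assms by (auto simp: Fz_def flag_of_def)

text \<open>It suffices to test the images of the first \<open>i\<close> columns, and
  \<open>span_iff_Dt\<close> turns each test into determinants whose entries are coordinates of
  \<open>g\<close>.\<close>

lemma zclosed_pre_flag:
  assumes "is_type n is" "i \<in> set is" "m \<in> insert 0 (set is)"
  shows "zclosed n is {F \<in> pflags n is. F i \<subseteq> Npre n k e (Fz F m)}"
proof -
  define p where "p l q = (\<lambda>g. Dt n (\<lambda>a b. if b = q then (if in_range n k e a then g (a + e) l else 0) else g a b))"
    for l q
  define P where "P = {p l q | l q. l < i \<and> m \<le> q \<and> q < n}"
  have i: "i \<le> n" using is_type_bounds assms by blast
  have m: "m \<le> n" using is_type_bounds[OF assms(1), of m] assms by auto
  have "P \<subseteq> polyfun n"
  proof -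
    have "p l q \<in> polyfun n" if "l < i" for l q
      unfolding p_def
    proof (rule polyfun_Dt)
      fix a b assume "a < n" "b < n"
      then show "(\<lambda>g. if b = q then (if in_range n k e a then g (a + e) l else 0) else g a b) \<in> polyfun n"
        using polyfun_Nop[of a n l k e] that i by (cases "b = q") (auto intro: polyfun.pcoord)
    qed
    then show ?thesis by (auto simp: P_def)
  qed
  moreover have "flag_of is g \<in> {F \<in> pflags n is. F i \<subseteq> Npre n k e (Fz F m)} \<longleftrightarrow> (\<forall>f\<in>P. f g = 0)"
    if g: "g \<in> GL n" for g
  proof -
    have N: "(Nop n k ^^ e) (Defs.col g l) = (\<lambda>a. if in_range n k e a then g (a + e) l else 0)" for l
      unfolding Nop_pow_apply[OF col_in_Vsp[OF g]] by (auto simp: Defs.col_def fun_eq_iff)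
    have "flag_of is g i \<subseteq> Npre n k e (Fz (flag_of is g) m) \<longleftrightarrow>
        cv.span (Defs.col g ` {..<i}) \<subseteq> Npre n k e (cv.span (Defs.col g ` {..<m}))"
      using Fz_flag_of[OF assms(3), of g] assms(2) by (simp add: flag_of_def)
    also have "\<dots> \<longleftrightarrow> Defs.col g ` {..<i} \<subseteq> Npre n k e (cv.span (Defs.col g ` {..<m}))"
      using cv.span_minimal cv.span_superset by (meson Npre_subspace cv.subspace_span order_trans)
    also have "\<dots> \<longleftrightarrow> (\<forall>l<i. (Nop n k ^^ e) (Defs.col g l) \<in> cv.span (Defs.col g ` {..<m}))"
      using col_in_Vsp[OF g] by (auto simp: Npre_def)
    also have "\<dots> \<longleftrightarrow> (\<forall>l<i. \<forall>q. m \<le> q \<and> q < n \<longrightarrow> p l q g = 0)"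
      unfolding span_iff_Dt[OF g Nop_pow_in_Vsp[OF col_in_Vsp[OF g]] m]
      unfolding N p_def by (rule refl)
    also have "\<dots> \<longleftrightarrow> (\<forall>f\<in>P. f g = 0)" by (auto simp: P_def)
    finally show ?thesis using flag_of_in_pflags[OF assms(1) g] by simp
  qed
  ultimately show ?thesis unfolding zclosed_def by (intro conjI exI[of _ P]) auto
qed

text \<open>The target is a fixed coordinate subspace, so the equations are single coordinates of
  the images of the columns.\<close>

lemma zclosed_pre_Nim:
  assumes "is_type n is" "i \<in> set is" "k \<le> n"
  shows "zclosed n is {F \<in> pflags n is. F i \<subseteq> Npre n k e (Nim n k a)}"
proof -
  define p where "p l j = (\<lambda>g :: nat \<Rightarrow> nat \<Rightarrow> complex. if in_range n k e j then g (j + e) l else 0)" for l j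
  define P where "P = {p l j | l j. l < i \<and> j < n \<and> \<not> in_range n k a j}"
  have i: "i \<le> n" using is_type_bounds assms by blast
  have "P \<subseteq> polyfun n" using polyfun_Nop i by (auto simp: P_def p_def)
  moreover have "flag_of is g \<in> {F \<in> pflags n is. F i \<subseteq> Npre n k e (Nim n k a)} \<longleftrightarrow> (\<forall>f\<in>P. f g = 0)"
    if g: "g \<in> GL n" for g
  proof -
    have N: "(Nop n k ^^ e) (Defs.col g l) = (\<lambda>j. p l j g)" for l
      unfolding Nop_pow_apply[OF col_in_Vsp[OF g]] by (auto simp: Defs.col_def p_def fun_eq_iff)
    have "flag_of is g i \<subseteq> Npre n k e (Nim n k a) \<longleftrightarrow> cv.span (Defs.col g ` {..<i}) \<subseteq> Npre n k e (Nim n k a)"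
      using assms(2) by (simp add: flag_of_def)
    also have "\<dots> \<longleftrightarrow> Defs.col g ` {..<i} \<subseteq> Npre n k e (Nim n k a)"
      using cv.span_minimal cv.span_superset by (meson Npre_subspace Nim_subspace order_trans)
    also have "\<dots> \<longleftrightarrow> (\<forall>l<i. (Nop n k ^^ e) (Defs.col g l) \<in> Nim n k a)"
      using col_in_Vsp[OF g] by (auto simp: Npre_def)
    also have "\<dots> \<longleftrightarrow> (\<forall>l<i. \<forall>j<n. \<not> in_range n k a j \<longrightarrow> p l j g = 0)"
    proof -
      have "p l j g = 0" if "\<not> j < n" for l j using that by (auto simp: p_def in_range_def)
      then show ?thesis unfolding N Nim_iff[OF assms(3)] by blast
    qed
    also have "\<dots> \<longleftrightarrow> (\<forall>f\<in>P. f g = 0)" by (auto simp: P_def)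
    finally show ?thesis using flag_of_in_pflags[OF assms(1) g] by simp
  qed
  ultimately show ?thesis unfolding zclosed_def by (intro conjI exI[of _ P]) auto
qed

section \<open>Irreducibility\<close>

definition spans :: "(nat \<Rightarrow> nat \<Rightarrow> complex) \<Rightarrow> nat \<Rightarrow> (nat \<Rightarrow> complex) set" where
  "spans w i = cv.span (w ` {..<i})"

lemma spans_0 [simp]: "spans w 0 = {0}"
  by (simp add: spans_def)

lemma spans_subspace [simp]: "cv.subspace (spans w i)"
  by (simp add: spans_def)

lemma spans_cong: "(\<And>j. j < i \<Longrightarrow> w j = w' j) \<Longrightarrow> spans w i = spans w' i"
  unfolding spans_def by (rule arg_cong[where f = cv.span]) (auto intro: image_cong)

lemma spans_mono: "i \<le> j \<Longrightarrow> spans w i \<subseteq> spans w j"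
  unfolding spans_def by (intro cv.span_mono image_mono) auto

lemma spans_Suc_subset:
  assumes "cv.subspace U" "spans w m \<subseteq> U" "w m \<in> U"
  shows "spans w (Suc m) \<subseteq> U"
proof -
  have "w ` {..<m} \<subseteq> spans w m" unfolding spans_def by (rule cv.span_superset)
  then have "w ` {..<Suc m} \<subseteq> U" using assms(2,3) by (auto simp: lessThan_Suc)
  then show ?thesis unfolding spans_def using assms(1) by (rule cv.span_minimal)
qed

lemma in_spans: "j < i \<Longrightarrow> w j \<in> spans w i"
  unfolding spans_def by (rule cv.span_base) auto

lemma chain_spans:
  assumes "lind m w" "\<And>j. j < m \<Longrightarrow> w j \<in> Vsp n"
  shows "chain n m (spans w)"
  unfolding chain_def
proof (intro conjI allI impI)
  fix i assume i: "i \<le> m"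
  have "lind i w" using assms(1) i by (auto simp: lind_def)
  then show "cv.dim (spans w i) = i"
    unfolding spans_def using assms(2) i by (intro dim_lind[of _ _ n]) auto
  show "spans w i \<subseteq> Vsp n"
    unfolding spans_def using assms(2) i by (intro cv.span_minimal) auto
qed (simp_all add: spans_mono)

lemma chain_spansD:
  assumes "chain n m (spans w)"
  shows "lind m w" "j < m \<Longrightarrow> w j \<in> Vsp n"
proof -
  have c: "spans w i \<subseteq> Vsp n" "cv.dim (spans w i) = i" if "i \<le> m" for i
    using assms that by (auto simp: chain_def)
  show "j < m \<Longrightarrow> w j \<in> Vsp n" using in_spans[of j m w] c(1)[of m] by auto
  show "lind m w"
    unfolding lind_def
  proof (intro allI impI notI)
    fix j assume j: "j < m" "w j \<in> cv.span (w ` {..<j})"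
    then have "spans w (Suc j) \<subseteq> spans w j"
      by (intro spans_Suc_subset) (auto simp: spans_def)
    then have "cv.dim (spans w (Suc j)) \<le> cv.dim (spans w j)"
      using c(1)[of j] j(1) by (intro cdim_mono) auto
    then show False using c(2)[of j] c(2)[of "Suc j"] j(1) by simp
  qed
qed

text \<open>The target at \<open>i\<close> refers to earlier members only, so changing or adding a
  later vector leaves it intact.\<close>

lemma drop_tgt_cong:
  assumes "\<And>j. j < i \<Longrightarrow> F j = G j" "1 \<le> i"
  shows "drop_tgt n k B F i = drop_tgt n k B G i"
  using assms par_props(1)[OF assms(2)] by (auto simp: drop_tgt_def)

lemma good_cong:
  assumes "\<And>j. j \<le> m \<Longrightarrow> F j = G j"
  shows "good n k B m F \<longleftrightarrow> good n k B m G"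
proof -
  have "drop_tgt n k B F i = drop_tgt n k B G i" if "i \<in> {1..m}" for i
    using assms that by (intro drop_tgt_cong) auto
  moreover have "chain n m F \<longleftrightarrow> chain n m G" using assms by (auto simp: chain_def)
  ultimately show ?thesis using assms by (auto simp: good_def)
qed

context ballot
begin

lemma good_spans_Suc:
  assumes "good n k B m (spans w)" "m < n" "w m \<in> Vsp n" "w m \<notin> spans w m"
    "(Nop n k ^^ drop_exp B (Suc m)) (w m) \<in> drop_tgt n k B (spans w) (Suc m)"
  shows "good n k B (Suc m) (spans w)"
proof -
  have ch: "chain n m (spans w)" using assms(1) by (simp add: good_def)
  have l: "lind (Suc m) w"
    using chain_spansD(1)[OF ch] assms(4) by (simp add: lind_Suc spans_def)
  have "w j \<in> Vsp n" if "j < Suc m" for j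
    using chain_spansD(2)[OF ch, of j] assms(3) that by (cases "j = m") auto
  then have "chain n (Suc m) (spans w)" using l by (intro chain_spans)
  moreover have "spans w (Suc m) \<subseteq> Npre n k (drop_exp B (Suc m)) (drop_tgt n k B (spans w) (Suc m))"
  proof (rule spans_Suc_subset)
    show "spans w m \<subseteq> Npre n k (drop_exp B (Suc m)) (drop_tgt n k B (spans w) (Suc m))"
      using drop_tgt_prefix[of "Suc m"] assms(1,2) by simp
    show "cv.subspace (Npre n k (drop_exp B (Suc m)) (drop_tgt n k B (spans w) (Suc m)))"
      using assms(1) by (intro Npre_subspace drop_tgt_subspace) auto
    show "w m \<in> Npre n k (drop_exp B (Suc m)) (drop_tgt n k B (spans w) (Suc m))"
      using assms(3,5) by (simp add: Npre_def)
  qed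
  moreover have "\<forall>i\<in>{1..m}. spans w i \<subseteq> Npre n k (drop_exp B i) (drop_tgt n k B (spans w) i)"
    using assms(1) by (simp add: good_def)
  moreover have "{1..Suc m} = insert (Suc m) {1..m}" by auto
  ultimately show ?thesis unfolding good_def by simp
qed

text \<open>The admissible space is too large to fit into \<open>W\<close>. Taking \<open>W\<close>
  to be the current span extends the flag; taking it to be a first choice of the next member yields
  a second, different choice at a bottom entry.\<close>

lemma good_spans_extend_1:
  assumes "good n k B m (spans w)" "m < n" "cv.subspace W" "spans w m \<subseteq> W" "W \<subseteq> Vsp n"
    "cv.dim W < (if Suc m \<in> B then m + 2 else Suc m)"
  obtains v where "v \<notin> W" "good n k B (Suc m) (spans (w(m := v)))"
proof -
  let ?P = "Npre n k (drop_exp B (Suc m)) (drop_tgt n k B (spans w) (Suc m))"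
  have "cv.dim ?P = (if Suc m \<in> B then m + 2 else Suc m)"
    using dim_drop_pre[of "Suc m" "spans w"] assms(1,2) by simp
  then have "\<not> ?P \<subseteq> W" using assms(6) cdim_mono[OF _ assms(5), of ?P] by linarith
  then obtain v where v: "v \<in> ?P" "v \<notin> W" by blast
  have eq: "spans (w(m := v)) j = spans w j" if "j \<le> m" for j
    using that by (intro spans_cong) auto
  have "good n k B (Suc m) (spans (w(m := v)))"
  proof (rule good_spans_Suc)
    show "good n k B m (spans (w(m := v)))" using assms(1) good_cong[of m "spans (w(m := v))" "spans w", OF eq] by blast
    show "(w(m := v)) m \<notin> spans (w(m := v)) m" using v assms(4) eq[of m] by auto
    have "drop_tgt n k B (spans (w(m := v))) (Suc m) = drop_tgt n k B (spans w) (Suc m)"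
      using eq by (intro drop_tgt_cong) auto
    then show "(Nop n k ^^ drop_exp B (Suc m)) ((w(m := v)) m) \<in> drop_tgt n k B (spans (w(m := v))) (Suc m)"
      using v by (simp add: Npre_def)
    show "(w(m := v)) m \<in> Vsp n" using v by (simp add: Npre_def)
  qed (rule assms(2))
  then show ?thesis using that v by blast
qed

lemma good_spans_extend:
  assumes "good n k B m (spans w)" "m \<le> n"
  obtains w' where "\<And>j. j < m \<Longrightarrow> w' j = w j" "good n k B n (spans w')"
proof -
  have "\<exists>w'. (\<forall>j<m. w' j = w j) \<and> good n k B l (spans w')" if "m \<le> l" "l \<le> n" for l
    using that
  proof (induction l rule: dec_induct)
    case base
    then show ?case using assms by blast
  next
    case (step l)
    then obtain w' where w': "\<forall>j<m. w' j = w j" "good n k B l (spans w')" by auto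
    then have "spans w' l \<subseteq> Vsp n" "cv.dim (spans w' l) = l" by (auto simp: good_def chain_def)
    moreover from this have "cv.dim (spans w' l) < (if Suc l \<in> B then l + 2 else Suc l)" by simp
    ultimately obtain v where "good n k B (Suc l) (spans (w'(l := v)))"
      using good_spans_extend_1[OF w'(2) _ spans_subspace order_refl] step.prems
      by (metis Suc_le_lessD)
    moreover have "\<forall>j<m. (w'(l := v)) j = w j" using w'(1) step.hyps by auto
    ultimately show ?case by blast
  qed
  then show ?thesis using that assms(2) by blast
qed

lemma good_exists: obtains w where "good n k B n (spans w)"
proof -
  have "good n k B 0 (spans (\<lambda>_. 0))"
    by (auto simp: good_def intro: chain_spans simp: lind_def)
  then show ?thesis using good_spans_extend[of 0] that by blast
qed

end

section \<open>Polynomial curves of bases\<close>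

definition polyc :: "(complex \<Rightarrow> complex) \<Rightarrow> bool" where
  "polyc f \<longleftrightarrow> (\<exists>p. \<forall>t. f t = poly p t)"

definition polyvec :: "(complex \<Rightarrow> nat \<Rightarrow> complex) \<Rightarrow> bool" where
  "polyvec f \<longleftrightarrow> (\<forall>i. polyc (\<lambda>t. f t i))"

lemma polyc_const: "polyc (\<lambda>_. c)"
  unfolding polyc_def by (rule exI[of _ "[:c:]"]) simp

lemma polyc_ident: "polyc (\<lambda>t. t)"
  unfolding polyc_def by (rule exI[of _ "[:0, 1:]"]) simp

lemma polyc_add: "polyc f \<Longrightarrow> polyc g \<Longrightarrow> polyc (\<lambda>t. f t + g t)"
  unfolding polyc_def by (metis poly_add)

lemma polyc_diff: "polyc f \<Longrightarrow> polyc g \<Longrightarrow> polyc (\<lambda>t. f t - g t)"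
  unfolding polyc_def by (metis poly_diff)

lemma polyc_mult: "polyc f \<Longrightarrow> polyc g \<Longrightarrow> polyc (\<lambda>t. f t * g t)"
  unfolding polyc_def by (metis poly_mult)

lemma polyc_sum: "(\<And>a. a \<in> A \<Longrightarrow> polyc (f a)) \<Longrightarrow> polyc (\<lambda>t. \<Sum>a\<in>A. f a t)"
  by (induction A rule: infinite_finite_induct) (auto intro: polyc_add polyc_const)

lemma polyvec_const: "polyvec (\<lambda>_. v)"
  by (simp add: polyvec_def polyc_const)

lemma polyvec_add: "polyvec f \<Longrightarrow> polyvec g \<Longrightarrow> polyvec (\<lambda>t. f t + g t)"
  by (simp add: polyvec_def polyc_add)

lemma polyvec_scale: "polyc c \<Longrightarrow> polyvec f \<Longrightarrow> polyvec (\<lambda>t. cscale (c t) (f t))"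
  by (simp add: polyvec_def cscale_apply polyc_mult)

lemma polyvec_sum: "(\<And>a. a \<in> A \<Longrightarrow> polyvec (f a)) \<Longrightarrow> polyvec (\<lambda>t. \<Sum>a\<in>A. f a t)"
  by (simp add: polyvec_def sum_fun_apply polyc_sum)

lemma polyvec_shift:
  assumes "polyvec f"
  shows "polyvec (\<lambda>t. shift n k e (f t))"
  unfolding polyvec_def
proof
  fix i
  show "polyc (\<lambda>t. shift n k e (f t) i)"
  proof (cases "(e \<le> i \<and> i < n - k) \<or> (n - k + e \<le> i \<and> i < n)")
    case True
    then have "(\<lambda>t. shift n k e (f t) i) = (\<lambda>t. f t (i - e))" by (simp add: shift_def)
    then show ?thesis using assms by (simp add: polyvec_def)
  next
    case False
    then have "(\<lambda>t. shift n k e (f t) i) = (\<lambda>t. 0)" by (auto simp: shift_def)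
    then show ?thesis by (simp add: polyc_const)
  qed
qed

lemma polyc_polyfun:
  assumes "q \<in> polyfun n" "\<And>i j. i < n \<Longrightarrow> j < n \<Longrightarrow> polyc (\<lambda>t. G t i j)"
  shows "polyc (\<lambda>t. q (G t))"
  using assms(1)
  by (induction rule: polyfun.induct) (auto intro: polyc_const polyc_add polyc_mult assms(2))

text \<open>A product of nonzero polynomials is not identically zero. The three factors will be the
  determinant of the curve and one equation from each of two closed sets.\<close>

lemma polyc_common_nonzero:
  assumes "polyc f" "polyc g" "polyc h" "f a \<noteq> 0" "g b \<noteq> 0" "h c \<noteq> 0"
  obtains t where "f t \<noteq> 0" "g t \<noteq> 0" "h t \<noteq> 0"
proof -
  obtain p q r where pq: "\<And>t. f t = poly p t" "\<And>t. g t = poly q t" "\<And>t. h t = poly r t"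
    using assms(1-3) unfolding polyc_def by metis
  have "p \<noteq> 0" "q \<noteq> 0" "r \<noteq> 0" using assms(4-6) pq by auto
  then have "p * q * r \<noteq> 0" by simp
  then obtain t where "poly (p * q * r) t \<noteq> 0" using poly_all_0_iff_0 by blast
  then show ?thesis using that[of t] pq by simp
qed

lemma Fz_flag_of_full: "i \<le> n \<Longrightarrow> Fz (flag_of (full_type n) g) i = spans (Defs.col g) i"
  using Fz_flag_of[of i "full_type n" g] by (cases "i = 0") (simp_all add: spans_def Fz_def)

lemma pr_flag_of:
  assumes "is_type n is"
  shows "pr is (flag_of (full_type n) g) = flag_of is g"
  using is_type_bounds[OF assms] by (auto simp: pr_def flag_of_def fun_eq_iff)

context ballot
begin

text \<open>A vector of the curve is lifted through a power of the nilpotent operator by the shift;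
  the lift is correct as soon as the target subspace lies in the image of that power.\<close>

lemma good_curve:
  assumes u: "good n k B n (spans u)" and v: "good n k B n (spans v)"
  shows "m \<le> n \<Longrightarrow> \<exists>\<gamma>. (\<forall>j<m. polyvec (\<gamma> j) \<and> \<gamma> j 0 = u j \<and> \<gamma> j 1 = v j \<and> (\<forall>t. \<gamma> j t \<in> Vsp n))
    \<and> (\<forall>t. lind m (\<lambda>j. \<gamma> j t) \<longrightarrow> good n k B m (spans (\<lambda>j. \<gamma> j t)))"
proof (induction m)
  case 0
  have "good n k B 0 (spans w)" for w
    by (auto simp: good_def intro: chain_spans simp: lind_def)
  then show ?case by blast
next
  case (Suc m)
  then obtain \<gamma> where \<gamma>: "\<And>j. j < m \<Longrightarrow> polyvec (\<gamma> j)" "\<And>j. j < m \<Longrightarrow> \<gamma> j 0 = u j"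
      "\<And>j. j < m \<Longrightarrow> \<gamma> j 1 = v j" "\<And>j t. j < m \<Longrightarrow> \<gamma> j t \<in> Vsp n"
      "\<And>t. lind m (\<lambda>j. \<gamma> j t) \<Longrightarrow> good n k B m (spans (\<lambda>j. \<gamma> j t))"
    by auto
  define e where "e = drop_exp B (Suc m)"
  define X where "X F = drop_tgt n k B F (Suc m)" for F
  have mn: "m < n" using Suc.prems by simp
  have uV: "u m \<in> Vsp n" and vV: "v m \<in> Vsp n"
    using chain_spansD(2)[of n n u m] chain_spansD(2)[of n n v m] u v mn by (auto simp: good_def)
  have uX: "(Nop n k ^^ e) (u m) \<in> X (spans u)" and vX: "(Nop n k ^^ e) (v m) \<in> X (spans v)"
    using u v mn in_spans[of m "Suc m" u] in_spans[of m "Suc m" v]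
    unfolding good_def X_def e_def Npre_def by fastforce+
  have XN: "X (spans w) \<subseteq> Nim n k e" if "good n k B m (spans w)" for w
    unfolding X_def e_def using that mn by (intro drop_tgt_subset_Nim) auto
  \<comment> \<open>The condition on the new vector is demanded only at parameters where the earlier
    vectors span a good flag, since the lift is justified only there.\<close>
  have "\<exists>f. polyvec f \<and> f 0 = u m \<and> f 1 = v m \<and> (\<forall>t. f t \<in> Vsp n) \<and>
      (\<forall>t. good n k B m (spans (\<lambda>j. \<gamma> j t)) \<longrightarrow> (Nop n k ^^ e) (f t) \<in> X (spans (\<lambda>j. \<gamma> j t)))"
  proof (cases "Suc m \<in> B \<or> has_par B (Suc m)")
    case True
    define p where "p = (if Suc m \<in> B then m else par B (Suc m))"
    have X: "X F = F p" for F using True by (auto simp: X_def p_def drop_tgt_def)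
    have pm: "p \<le> m" using True par_props(1)[of "Suc m" B] by (auto simp: p_def)
    obtain a where a: "(Nop n k ^^ e) (u m) = (\<Sum>l<p. cscale (a l) (u l))"
      using uX unfolding X spans_def span_initial_iff by blast
    obtain b where b: "(Nop n k ^^ e) (v m) = (\<Sum>l<p. cscale (b l) (v l))"
      using vX unfolding X spans_def span_initial_iff by blast
    \<comment> \<open>The kernel component lost when \<open>u m\<close> is mapped by
      \<open>N\<^sup>e\<close> and lifted back. Interpolating these components restores the
      prescribed endpoints without affecting the image.\<close>
    define \<kappa>0 where "\<kappa>0 = u m - shift n k e ((Nop n k ^^ e) (u m))"
    define \<kappa>1 where "\<kappa>1 = v m - shift n k e ((Nop n k ^^ e) (v m))"
    have V: "\<kappa>0 \<in> Vsp n" "\<kappa>1 \<in> Vsp n"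
      unfolding \<kappa>0_def \<kappa>1_def using uV vV shift_in_Vsp by (auto intro: cv.subspace_diff[OF subspace_Vsp])
    have Nu: "(Nop n k ^^ e) x \<in> Nim n k e" if "x \<in> Vsp n" for x using that by (auto simp: Nim_def)
    have N0: "(Nop n k ^^ e) (x - shift n k e ((Nop n k ^^ e) x)) = 0" if "x \<in> Vsp n" for x
      using Nop_pow_shift[OF kn' Nu[OF that]] by (simp add: cvp.linear_diff[OF linear_Nop_pow])
    \<comment> \<open>The coefficients are interpolated in the moving basis, so \<open>s t\<close>
      stays in the moving target and has the right values at 0 and 1.\<close>
    define s where "s t = (\<Sum>l<p. cscale ((1 - t) * a l + t * b l) (\<gamma> l t))" for t
    define f where "f t = shift n k e (s t) + (cscale (1 - t) \<kappa>0 + cscale t \<kappa>1)" for t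
    have "polyvec f"
      unfolding f_def s_def
      by (intro polyvec_add polyvec_shift polyvec_sum polyvec_scale polyvec_const polyc_add polyc_mult
          polyc_diff polyc_const polyc_ident \<gamma>(1)) (use pm in auto)
    moreover have "f 0 = u m"
    proof -
      have "s 0 = (Nop n k ^^ e) (u m)" unfolding s_def a using pm \<gamma>(2) by (intro sum.cong) auto
      then show ?thesis by (simp add: f_def \<kappa>0_def)
    qed
    moreover have "f 1 = v m"
    proof -
      have "s 1 = (Nop n k ^^ e) (v m)" unfolding s_def b using pm \<gamma>(3) by (intro sum.cong) auto
      then show ?thesis by (simp add: f_def \<kappa>1_def)
    qed
    moreover have "f t \<in> Vsp n" for t
      unfolding f_def using V by (intro cv.subspace_add[OF subspace_Vsp] cv.subspace_scale[OF subspace_Vsp] shift_in_Vsp)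
    moreover have "(Nop n k ^^ e) (f t) \<in> X (spans (\<lambda>j. \<gamma> j t))"
      if g: "good n k B m (spans (\<lambda>j. \<gamma> j t))" for t
    proof -
      have "s t \<in> X (spans (\<lambda>j. \<gamma> j t))"
        unfolding X spans_def s_def by (auto intro!: cv.span_sum cv.span_scale intro: cv.span_base)
      moreover from this have "(Nop n k ^^ e) (shift n k e (s t)) = s t"
        using XN[OF g] by (intro Nop_pow_shift kn') auto
      then have "(Nop n k ^^ e) (f t) = s t"
        unfolding f_def \<kappa>0_def \<kappa>1_def Nop_pow_add Nop_pow_scale N0[OF uV] N0[OF vV] by simp
      ultimately show ?thesis by simp
    qed
    ultimately show ?thesis by blast
  next
    case False
    define a where "a = n - k - (Suc m - 2 * bcount B (Suc m))"
    have X: "X F = Nim n k a" for F using False by (auto simp: X_def drop_tgt_def a_def)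
    \<comment> \<open>For a ray the target does not depend on the flag, so a straight segment stays
      in it.\<close>
    define f where "f t = cscale (1 - t) (u m) + cscale t (v m)" for t
    have "polyvec f"
      unfolding f_def
      by (intro polyvec_add polyvec_scale polyvec_const polyc_diff polyc_const polyc_ident)
    moreover have "f 0 = u m" "f 1 = v m" by (simp_all add: f_def)
    moreover have "f t \<in> Vsp n" for t
      unfolding f_def using uV vV by (intro cv.subspace_add[OF subspace_Vsp] cv.subspace_scale[OF subspace_Vsp])
    moreover have "(Nop n k ^^ e) (f t) \<in> Nim n k a" for t
      unfolding f_def Nop_pow_add Nop_pow_scale using uX vX unfolding X
      by (intro cv.subspace_add[OF Nim_subspace] cv.subspace_scale[OF Nim_subspace])
    ultimately show ?thesis unfolding X by blast
  qed
  then obtain f where f: "polyvec f" "f 0 = u m" "f 1 = v m" "\<And>t. f t \<in> Vsp n"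
      "\<And>t. good n k B m (spans (\<lambda>j. \<gamma> j t)) \<Longrightarrow> (Nop n k ^^ e) (f t) \<in> X (spans (\<lambda>j. \<gamma> j t))"
    by blast
  define \<delta> where "\<delta> = \<gamma>(m := f)"
  have "good n k B (Suc m) (spans (\<lambda>j. \<delta> j t))" if l: "lind (Suc m) (\<lambda>j. \<delta> j t)" for t
  proof -
    have eq: "spans (\<lambda>j. \<delta> j t) i = spans (\<lambda>j. \<gamma> j t) i" if "i \<le> m" for i
      using that by (intro spans_cong) (auto simp: \<delta>_def)
    have img: "(\<lambda>j. \<delta> j t) ` {..<i} = (\<lambda>j. \<gamma> j t) ` {..<i}" if "i \<le> m" for i
      using that by (intro image_cong) (auto simp: \<delta>_def)
    have "lind m (\<lambda>j. \<gamma> j t)"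
      unfolding lind_def
    proof (intro allI impI)
      fix j assume j: "j < m"
      then have "\<delta> j t \<notin> cv.span ((\<lambda>j. \<delta> j t) ` {..<j})" using l unfolding lind_def by simp
      moreover have "\<delta> j t = \<gamma> j t" using j by (simp add: \<delta>_def)
      ultimately show "\<gamma> j t \<notin> cv.span ((\<lambda>j. \<gamma> j t) ` {..<j})"
        unfolding img[OF less_imp_le[OF j]] by simp
    qed
    then have g: "good n k B m (spans (\<lambda>j. \<gamma> j t))" by (rule \<gamma>(5))
    show ?thesis
    proof (rule good_spans_Suc)
      show "good n k B m (spans (\<lambda>j. \<delta> j t))"
        using g good_cong[of m _ "spans (\<lambda>j. \<gamma> j t)", OF eq] by blast
      show "\<delta> m t \<notin> spans (\<lambda>j. \<delta> j t) m" using l by (simp add: lind_Suc spans_def)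
      have "X (spans (\<lambda>j. \<delta> j t)) = X (spans (\<lambda>j. \<gamma> j t))"
        unfolding X_def using eq by (intro drop_tgt_cong) auto
      then show "(Nop n k ^^ drop_exp B (Suc m)) (\<delta> m t) \<in> drop_tgt n k B (spans (\<lambda>j. \<delta> j t)) (Suc m)"
        using f(5)[OF g] by (simp add: \<delta>_def X_def e_def)
      show "\<delta> m t \<in> Vsp n" using f(4) by (simp add: \<delta>_def)
    qed (rule mn)
  qed
  moreover have "polyvec (\<delta> j) \<and> \<delta> j 0 = u j \<and> \<delta> j 1 = v j \<and> (\<forall>t. \<delta> j t \<in> Vsp n)" if "j < Suc m" for j
    using that f \<gamma> by (cases "j = m") (auto simp: \<delta>_def)
  ultimately show ?case by blast
qed

section \<open>Irreducibility of the components and of their projections\<close>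

definition Yset :: "(nat \<Rightarrow> (nat \<Rightarrow> complex) set) set" where
  "Yset = {F \<in> pflags n (full_type n). good n k B n (Fz F)}"

lemma flag_of_in_Yset:
  assumes "g \<in> GL n" "1 \<le> n"
  shows "flag_of (full_type n) g \<in> Yset \<longleftrightarrow> good n k B n (spans (Defs.col g))"
  unfolding Yset_def
  using flag_of_in_pflags[OF is_type_full[OF assms(2)] assms(1)] good_cong[of n, OF Fz_flag_of_full] by auto

lemma matrix_of_good:
  assumes "good n k B n (spans w)"
  defines "g \<equiv> \<lambda>i j. if j < n then w j i else 0"
  shows "g \<in> GL n" "\<And>j. j < n \<Longrightarrow> Defs.col g j = w j" "\<And>i. i \<le> n \<Longrightarrow> spans (Defs.col g) i = spans w i"
proof -
  have ch: "chain n n (spans w)" using assms(1) by (simp add: good_def)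
  show c: "\<And>j. j < n \<Longrightarrow> Defs.col g j = w j" by (simp add: Defs.col_def g_def)
  then show s: "\<And>i. i \<le> n \<Longrightarrow> spans (Defs.col g) i = spans w i" by (intro spans_cong) auto
  then have "lind n (Defs.col g)"
    using chain_spansD(1)[OF ch] c by (simp add: lind_def spans_def)
  moreover have "g i j = 0" if "n \<le> i \<or> n \<le> j" for i j
    using chain_spansD(2)[OF ch, of j] that by (auto simp: g_def Vsp_def)
  ultimately show "g \<in> GL n" by (simp add: GL_iff)
qed

text \<open>Pick one point outside each closed set and join them by a curve. Keeping independence
  and avoiding both sets are non-vanishing conditions on polynomials in \<open>t\<close>, each
  nonzero at 0 or 1, so a common parameter exists. Full and partial flag are read off the same
  matrix, so the equations of \<open>C1\<close> and \<open>C2\<close> apply directly along the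
  curve.\<close>

lemma irreducible_pr_Yset:
  assumes "is_type n is"
  shows "irreducible_set n is (pr is ` Yset)"
  unfolding irreducible_set_def
proof (intro conjI allI impI)
  have n1: "1 \<le> n" by (rule is_type_pos[OF assms])
  obtain w where w: "good n k B n (spans w)" by (rule good_exists)
  note m = matrix_of_good[OF w]
  have "flag_of (full_type n) (\<lambda>i j. if j < n then w j i else 0) \<in> Yset"
    using flag_of_in_Yset[OF m(1) n1] good_cong[of n _ "spans w", OF m(3)] w by blast
  then show "pr is ` Yset \<noteq> {}" by blast
  fix C1 C2
  assume C1: "zclosed n is C1" and C2: "zclosed n is C2" and cov: "pr is ` Yset \<subseteq> C1 \<union> C2"
  show "pr is ` Yset \<subseteq> C1 \<or> pr is ` Yset \<subseteq> C2"
  proof (rule ccontr)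
    assume "\<not> (pr is ` Yset \<subseteq> C1 \<or> pr is ` Yset \<subseteq> C2)"
    then obtain F1 F2 where F: "F1 \<in> Yset" "pr is F1 \<notin> C1" "F2 \<in> Yset" "pr is F2 \<notin> C2" by blast
    have "F1 \<in> pflags n (full_type n)" "F2 \<in> pflags n (full_type n)" using F by (auto simp: Yset_def)
    then obtain g1 g2 where g: "g1 \<in> GL n" "flag_of (full_type n) g1 = F1"
        "g2 \<in> GL n" "flag_of (full_type n) g2 = F2"
      using flag_of_surj[OF is_type_full[OF n1]] by metis
    obtain P1 where P1: "P1 \<subseteq> polyfun n" "{g \<in> GL n. flag_of is g \<in> C1} = {g \<in> GL n. \<forall>p\<in>P1. p g = 0}"
      using C1 by (auto simp: zclosed_def)
    obtain P2 where P2: "P2 \<subseteq> polyfun n" "{g \<in> GL n. flag_of is g \<in> C2} = {g \<in> GL n. \<forall>p\<in>P2. p g = 0}"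
      using C2 by (auto simp: zclosed_def)
    have "flag_of is g1 \<notin> C1" "flag_of is g2 \<notin> C2" using F g pr_flag_of[OF assms] by auto
    then obtain p1 p2 where p: "p1 \<in> P1" "p1 g1 \<noteq> 0" "p2 \<in> P2" "p2 g2 \<noteq> 0"
      using P1(2) P2(2) g by blast
    have "good n k B n (spans (Defs.col g1))" "good n k B n (spans (Defs.col g2))"
      using flag_of_in_Yset[OF _ n1] g F by blast+
    from good_curve[OF this le_refl] obtain \<gamma> where
      \<gamma>: "\<And>j. j < n \<Longrightarrow> polyvec (\<gamma> j)" "\<And>j. j < n \<Longrightarrow> \<gamma> j 0 = Defs.col g1 j"
         "\<And>j. j < n \<Longrightarrow> \<gamma> j 1 = Defs.col g2 j" "\<And>j t. j < n \<Longrightarrow> \<gamma> j t \<in> Vsp n"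
         "\<And>t. lind n (\<lambda>j. \<gamma> j t) \<Longrightarrow> good n k B n (spans (\<lambda>j. \<gamma> j t))"
      by auto
    define G where "G t = (\<lambda>i j. if j < n then \<gamma> j t i else 0)" for t
    have G0: "G 0 = g1" and G1: "G 1 = g2"
      using \<gamma>(2,3) g by (auto simp: G_def fun_eq_iff Defs.col_def GL_def)
    have pc: "polyc (\<lambda>t. G t i j)" if "j < n" for i j
      using \<gamma>(1)[OF that] that by (simp add: G_def polyvec_def)
    have "polyc (\<lambda>t. Dt n (G t))"
      by (rule polyc_polyfun[OF polyfun_Dt[of n "\<lambda>g. g"]]) (auto intro: polyfun.pcoord pc)
    moreover have "polyc (\<lambda>t. p1 (G t))"
      by (rule polyc_polyfun[OF subsetD[OF P1(1) p(1)] pc])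
    moreover have "polyc (\<lambda>t. p2 (G t))"
      by (rule polyc_polyfun[OF subsetD[OF P2(1) p(3)] pc])
    moreover have "Dt n (G 0) \<noteq> 0" using g G0 GL_iff_Dt by auto
    moreover have "p1 (G 0) \<noteq> 0" "p2 (G 1) \<noteq> 0" using p G0 G1 by auto
    ultimately obtain t where t: "Dt n (G t) \<noteq> 0" "p1 (G t) \<noteq> 0" "p2 (G t) \<noteq> 0"
      by (rule polyc_common_nonzero)
    have "G t i j = 0" if "n \<le> i \<or> n \<le> j" for i j
      using \<gamma>(4)[of j t] that by (auto simp: G_def Vsp_def)
    then have GL: "G t \<in> GL n" using t(1) by (simp add: GL_iff_Dt)
    have col: "Defs.col (G t) j = \<gamma> j t" if "j < n" for j using that by (simp add: G_def Defs.col_def)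
    have sp: "spans (Defs.col (G t)) i = spans (\<lambda>j. \<gamma> j t) i" if "i \<le> n" for i
      using that col by (intro spans_cong) auto
    have "lind n (\<lambda>j. \<gamma> j t)"
      using GL sp col unfolding GL_iff lind_def spans_def by simp
    then have "good n k B n (spans (Defs.col (G t)))"
      using \<gamma>(5) good_cong[of n _ "spans (\<lambda>j. \<gamma> j t)", OF sp] by blast
    then have "flag_of (full_type n) (G t) \<in> Yset" using flag_of_in_Yset[OF GL n1] by blast
    then have "flag_of is (G t) \<in> C1 \<union> C2" using cov pr_flag_of[OF assms] by (metis image_eqI subsetD)
    moreover have "flag_of is (G t) \<notin> C1" using P1(2) GL p(1) t(2) by blast
    moreover have "flag_of is (G t) \<notin> C2" using P2(2) GL p(3) t(3) by blast
    ultimately show False by blast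
  qed
qed

end

section \<open>Partial flags\<close>

text \<open>The sets of bottom entries that arise from tableaux of type \<open>is\<close>: a dimension missing from \<open>is\<close> is
  \<open>x - 1\<close> for a double entry \<open>x\<close>.\<close>

definition compat :: "nat \<Rightarrow> nat list \<Rightarrow> nat set \<Rightarrow> bool" where
  "compat n is B \<longleftrightarrow>
    (\<forall>j\<in>{1..n} - set is. j \<in> B \<and> Suc j \<in> set is \<and> Suc j \<notin> B \<and> j - 1 \<in> insert 0 (set is))"

definition prevn :: "nat list \<Rightarrow> nat \<Rightarrow> nat" where
  "prevn is l = (if l = 0 then 0 else is ! (l - 1))"

lemma prevF_eq:
  assumes "is_type n is" "l < length is"
  shows "prevF is F l = Fz F (prevn is l)"
  using is_type_bounds[OF assms(1), of "is ! (l - 1)"] assms(2)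
  by (auto simp: prevF_def Fz_def prevn_def)

lemma gap_eq: "gap is l = is ! l - prevn is l"
  by (simp add: gap_def prevn_def)

lemma prevn_props:
  assumes "is_type n is" "l < length is"
  shows "prevn is l \<in> insert 0 (set is)" "prevn is l < is ! l" "is ! l \<le> n"
    "\<And>j. prevn is l < j \<Longrightarrow> j < is ! l \<Longrightarrow> j \<notin> set is"
proof -
  have st: "sorted_wrt (<) is" using assms(1) by (simp add: is_type_def)
  note b = is_type_bounds[OF assms(1)]
  show "prevn is l \<in> insert 0 (set is)" using assms(2) by (auto simp: prevn_def)
  show "prevn is l < is ! l"
    using sorted_wrt_nth_less[OF st, of "l - 1" l] assms(2) b[of "is ! l"] by (auto simp: prevn_def Suc_le_eq)
  show "is ! l \<le> n" using b assms(2) by simp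
  show "j \<notin> set is" if j: "prevn is l < j" "j < is ! l" for j
  proof
    assume "j \<in> set is"
    then obtain a where a: "a < length is" "j = is ! a" by (auto simp: in_set_conv_nth)
    have "a < l"
    proof (rule ccontr)
      assume "\<not> a < l"
      then show False using sorted_wrt_nth_less[OF st, of l a] a j(2) by (cases "a = l") auto
    qed
    moreover have "l - 1 < a"
    proof (rule ccontr)
      assume "\<not> l - 1 < a"
      then have "is ! a \<le> is ! (l - 1)"
        using sorted_wrt_nth_less[OF st, of a "l - 1"] assms(2) by (cases "a = l - 1") (auto simp: less_imp_diff_less)
      then show False using a j(1) \<open>a < l\<close> by (auto simp: prevn_def split: if_splits)
    qed
    ultimately show False by simp
  qed
qed

lemma pr_in_pflags:
  assumes "is_type n is" "F \<in> pflags n (full_type n)"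
  shows "pr is F \<in> pflags n is"
proof -
  obtain g where "g \<in> GL n" "flag_of (full_type n) g = F"
    using flag_of_surj[OF is_type_full[OF is_type_pos[OF assms(1)]] assms(2)] by blast
  then show ?thesis
    using flag_of_in_pflags[OF assms(1)] pr_flag_of[OF assms(1)] by metis
qed

lemma Fz_pr: "j \<in> insert 0 (set is) \<Longrightarrow> Fz (pr is F) j = Fz F j"
  by (auto simp: Fz_def pr_def)

locale typed_ballot = ballot +
  fixes "is" :: "nat list"
  assumes type: "is_type n is" and compat: "compat n is B"
begin

lemma missing:
  assumes "j \<in> {1..n}" "j \<notin> set is"
  shows "j \<in> B" "Suc j \<in> set is" "Suc j \<notin> B" "j - 1 \<in> insert 0 (set is)"
  using compat assms by (auto simp: compat_def)

text \<open>A missing dimension is followed by a top entry, so a bottom entry never follows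
  one.\<close>

lemma bottom_pred:
  assumes "i \<in> set is" "i \<in> B"
  shows "i - 1 \<in> insert 0 (set is)"
proof (rule ccontr)
  assume a: "i - 1 \<notin> insert 0 (set is)"
  then have "i - 1 \<in> {1..n}" "Suc (i - 1) = i" using is_type_bounds[OF type assms(1)] by auto
  then show False using missing(3)[of "i - 1"] a assms by auto
qed

text \<open>The index after \<open>par B i\<close> is a bottom entry, whereas a missing dimension is
  followed by a top entry. With \<open>bottom_pred\<close> this lets the conditions at surviving
  indices descend to partial flags.\<close>

lemma par_typed:
  assumes "i \<in> set is" "i \<notin> B" "has_par B i"
  shows "par B i \<in> insert 0 (set is)"
proof (rule ccontr)
  assume a: "par B i \<notin> insert 0 (set is)"
  have i: "1 \<le> i" "i \<le> n" using is_type_bounds[OF type assms(1)] by auto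
  note p = par_props[OF i(1) assms(2,3)]
  have "par B i \<in> {1..n}" using a p(1) i by auto
  then show False using missing(3)[of "par B i"] a p(3) by auto
qed

lemma drop_tgt_typed:
  assumes "i \<in> set is" "\<And>j. j \<in> insert 0 (set is) \<Longrightarrow> F j = G j"
  shows "drop_tgt n k B F i = drop_tgt n k B G i"
  using assms(2)[OF bottom_pred[OF assms(1)]] assms(2)[OF par_typed[OF assms(1)]] by (simp add: drop_tgt_def)

text \<open>The missing dimension and its successor form a cup with empty interior.\<close>

lemma missing_drop:
  assumes "j \<in> {1..n}" "j \<notin> set is"
  shows "drop_exp B (Suc j) = 1" "drop_tgt n k B F (Suc j) = F (j - 1)"
proof -
  note m = missing[OF assms]
  have h: "ht B j = ht B (j - 1) + 1" using ht_pred[of j B] assms(1) m(1) by simp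
  have h': "ht B (Suc j) = ht B (j - 1)" using ht_Suc[of B j] m(3) h by simp
  have hp: "has_par B (Suc j)" unfolding has_par_def using h' by (intro exI[of _ "j - 1"]) auto
  have "y \<le> j - 1" if "y < Suc j" "ht B y = ht B (Suc j)" for y
  proof -
    have "y \<noteq> j" using that h h' by auto
    then show ?thesis using that by simp
  qed
  then have "par B (Suc j) = j - 1"
    unfolding par_def using h' by (intro Max_eqI) auto
  then show "drop_exp B (Suc j) = 1" "drop_tgt n k B F (Suc j) = F (j - 1)"
    using m(3) hp assms(1) by (auto simp: drop_exp_def drop_tgt_def)
qed

text \<open>Any refinement of the partial flag works: for a missing \<open>j\<close> the condition
  at \<open>Suc j\<close> gives that \<open>F j \<subseteq> F (Suc j)\<close> is mapped by
  \<open>N\<close> into \<open>F (j - 1)\<close>, which is the condition at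
  \<open>j\<close>.\<close>

lemma pr_Yset_eq:
  "pr is ` Yset = {F \<in> pflags n is. \<forall>i\<in>set is. F i \<subseteq> Npre n k (drop_exp B i) (drop_tgt n k B (Fz F) i)}"
    (is "_ = ?R")
proof (intro Set.set_eqI iffI)
  fix F assume "F \<in> pr is ` Yset"
  then obtain F' where F': "F' \<in> Yset" "F = pr is F'" by blast
  have fl: "F' \<in> pflags n (full_type n)" and g: "good n k B n (Fz F')" using F' by (auto simp: Yset_def)
  have "F i \<subseteq> Npre n k (drop_exp B i) (drop_tgt n k B (Fz F) i)" if i: "i \<in> set is" for i
  proof -
    have b: "i \<in> {1..n}" using is_type_bounds[OF type i] by auto
    have "Fz F' i \<subseteq> Npre n k (drop_exp B i) (drop_tgt n k B (Fz F') i)" using g b by (auto simp: good_def)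
    moreover have "drop_tgt n k B (Fz F') i = drop_tgt n k B (Fz F) i"
      unfolding F'(2) using i by (intro drop_tgt_typed) (simp_all add: Fz_pr)
    moreover have "Fz F' i = F i" using i b F'(2) by (simp add: Fz_def pr_def)
    ultimately show ?thesis by simp
  qed
  then show "F \<in> ?R" using pr_in_pflags[OF type fl] F'(2) by blast
next
  fix F assume R: "F \<in> ?R"
  then obtain g where g: "g \<in> GL n" "flag_of is g = F" using flag_of_surj[OF type] by blast
  define F' where "F' = flag_of (full_type n) g"
  have fl: "F' \<in> pflags n (full_type n)"
    unfolding F'_def using flag_of_in_pflags[OF is_type_full[OF is_type_pos[OF type]] g(1)] .
  have prF: "pr is F' = F" unfolding F'_def using pr_flag_of[OF type] g(2) by simp
  have ch: "chain n n (Fz F')" using fl pflags_full_iff by blast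
  have eq: "Fz F' j = Fz F j" if "j \<in> insert 0 (set is)" for j using Fz_pr[OF that, of F'] prF by simp
  have typed: "Fz F' i \<subseteq> Npre n k (drop_exp B i) (drop_tgt n k B (Fz F') i)" if i: "i \<in> set is" for i
  proof -
    have "F i \<subseteq> Npre n k (drop_exp B i) (drop_tgt n k B (Fz F) i)" using R i by blast
    moreover have "drop_tgt n k B (Fz F') i = drop_tgt n k B (Fz F) i" using i eq by (rule drop_tgt_typed)
    moreover have "Fz F' i = F i" using eq[of i] i is_type_bounds[OF type i] by (simp add: Fz_def)
    ultimately show ?thesis by simp
  qed
  have "Fz F' i \<subseteq> Npre n k (drop_exp B i) (drop_tgt n k B (Fz F') i)" if i: "i \<in> {1..n}" for i
  proof (cases "i \<in> set is")
    case False
    note m = missing[OF i False] and d = missing_drop[OF i False]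
    have "Fz F' (Suc i) \<subseteq> Npre n k 1 (Fz F' (i - 1))"
      using typed[OF m(2)] unfolding d .
    moreover have "Fz F' i \<subseteq> Fz F' (Suc i)"
      using is_type_bounds[OF type m(2)] by (intro chain_mono[OF ch]) auto
    ultimately show ?thesis using m(1) by (auto simp: drop_exp_def drop_tgt_def)
  qed (rule typed)
  then have "F' \<in> Yset" using fl ch by (simp add: Yset_def good_def)
  then show "F \<in> pr is ` Yset" using prF by blast
qed

lemma zclosed_pr_Yset: "zclosed n is (pr is ` Yset)"
  unfolding pr_Yset_eq
proof (rule zclosed_Collect_all[OF _ type])
  fix i assume i: "i \<in> set is"
  show "zclosed n is {F \<in> pflags n is. F i \<subseteq> Npre n k (drop_exp B i) (drop_tgt n k B (Fz F) i)}"
  proof -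
    consider "i \<in> B" | "i \<notin> B" "has_par B i" | "i \<notin> B" "\<not> has_par B i" by blast
    then show ?thesis
    proof cases
      case 1
      then show ?thesis
        using zclosed_pre_flag[OF type i bottom_pred[OF i 1]] by (simp add: drop_tgt_def)
    next
      case 2
      then show ?thesis
        using zclosed_pre_flag[OF type i par_typed[OF i 2]] by (simp add: drop_tgt_def)
    next
      case 3
      then show ?thesis
        using zclosed_pre_Nim[OF type i kn'] by (simp add: drop_tgt_def)
    qed
  qed
qed

lemma pr_Yset_subset: "pr is ` Yset \<subseteq> Spalt n k is"
proof
  fix F assume "F \<in> pr is ` Yset"
  then obtain F' where F': "F' \<in> Yset" "F = pr is F'" by blast
  have fl: "F' \<in> pflags n (full_type n)" and g: "good n k B n (Fz F')" using F' by (auto simp: Yset_def)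
  have "Nop n k ` F (is ! l) \<subseteq> prevF is F l" if l: "l < length is" for l
  proof -
    define i where "i = is ! l"
    note p = prevn_props[OF type l, folded i_def]
    have i: "i \<in> set is" "i \<in> {1..n}" using l is_type_bounds[OF type] by (auto simp: i_def)
    have "Fz F' i \<subseteq> Npre n k 1 (Fz F' (prevn is l))"
    proof (cases "i - 1 \<in> insert 0 (set is)")
      case True
      then have "\<not> prevn is l < i - 1" using p(2) p(4)[of "i - 1"] i by (cases "i - 1 = 0") auto
      then have "prevn is l = i - 1" using p(2) by linarith
      then show ?thesis using good_invariant[OF g, of i] i by simp
    next
      case False
      then have j: "i - 1 \<in> {1..n}" "i - 1 \<notin> set is" "Suc (i - 1) = i" using i by auto
      note m = missing[OF j(1,2)]
      have "prevn is l = i - 1 - 1"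
      proof (rule ccontr)
        assume a: "prevn is l \<noteq> i - 1 - 1"
        have "prevn is l \<noteq> i - 1" using p(1) False by auto
        then have "prevn is l < i - 1 - 1" using a p(2) by linarith
        then show False using p(4)[of "i - 1 - 1"] m(4) i by auto
      qed
      moreover have "Fz F' i \<subseteq> Npre n k (drop_exp B i) (drop_tgt n k B (Fz F') i)"
        using g i by (auto simp: good_def)
      ultimately show ?thesis using missing_drop[OF j(1,2)] j(3) by simp
    qed
    moreover have "Fz F' i = F i" using i F'(2) by (simp add: Fz_def pr_def)
    moreover have "Fz F' (prevn is l) = prevF is F l"
      using prevF_eq[OF type l] Fz_pr[OF p(1)] F'(2) by simp
    ultimately have "F i \<subseteq> Npre n k 1 (prevF is F l)" by simp
    then show ?thesis by (auto simp: i_def Npre_def)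
  qed
  then show "F \<in> Spalt n k is"
    using pr_in_pflags[OF type fl] F'(2) by (auto simp: Spalt_def)
qed

end

section \<open>Incomparability of the projected components\<close>

lemma (in ballot) good_top_eq:
  assumes "good n k B n F" "1 \<le> i" "i \<le> n" "i \<notin> B"
  shows "F i = Npre n k (drop_exp B i) (drop_tgt n k B F i)"
proof (rule csubspace_eqI[of _ _ n])
  have g: "good n k B (i - 1) F" using assms by (auto intro: good_mono)
  show "cv.subspace (F i)" using assms by (auto simp: good_def chain_def)
  show "F i \<subseteq> Npre n k (drop_exp B i) (drop_tgt n k B F i)" using assms by (auto simp: good_def)
  show "Npre n k (drop_exp B i) (drop_tgt n k B F i) \<subseteq> Vsp n" by (rule Npre_subset_Vsp)
  have "cv.dim (F i) = i" using assms by (auto simp: good_def chain_def)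
  then show "cv.dim (Npre n k (drop_exp B i) (drop_tgt n k B F i)) \<le> cv.dim (F i)"
    using dim_drop_pre[OF g assms(2,3)] assms(4) by simp
qed

text \<open>At a bottom entry of \<open>B\<close> the flag member varies while all smaller ones stay fixed;
  at a top entry of \<open>B'\<close> it is determined by the smaller ones.\<close>

lemma (in typed_ballot) bottoms_subset:
  assumes "typed_ballot n k B' is" "pr is ` Yset \<subseteq> pr is ` ballot.Yset n k B'"
  shows "B \<subseteq> B'"
proof
  interpret B': typed_ballot n k B' "is" by (rule assms(1))
  fix i assume iB: "i \<in> B"
  show "i \<in> B'"
  proof (rule ccontr)
    assume nB: "i \<notin> B'"
    have i: "1 \<le> i" "i \<le> n" using iB B_subset by auto
    \<comment> \<open>All missing dimensions are bottom entries of \<open>B'\<close>, so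
      \<open>i\<close> survives the projection and the comparison can take place there.\<close>
    have is': "i \<in> set is" using B'.missing(1)[of i] i nB by auto
    define m where "m = i - 1"
    have m: "Suc m = i" "m < n" using i by (auto simp: m_def)
    obtain w where w: "good n k B n (spans w)" by (rule good_exists)
    then have gm: "good n k B m (spans w)" using m by (auto intro: good_mono)
    have c: "spans w m \<subseteq> Vsp n" "cv.dim (spans w m) = m" using gm by (auto simp: good_def chain_def)
    have lt: "cv.dim (spans w m) < (if Suc m \<in> B then m + 2 else Suc m)" using c(2) by simp
    obtain v1 where v1: "good n k B (Suc m) (spans (w(m := v1)))"
      using good_spans_extend_1[OF gm m(2) spans_subspace order_refl c(1) lt] by blast
    let ?W = "spans (w(m := v1)) (Suc m)"
    have W: "?W \<subseteq> Vsp n" "cv.dim ?W = Suc m" using v1 by (auto simp: good_def chain_def)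
    have wW: "spans w m \<subseteq> ?W"
      using spans_mono[of m "Suc m" "w(m := v1)"] spans_cong[of m w "w(m := v1)"] by simp
    \<comment> \<open>As \<open>i\<close> is a bottom entry of \<open>B\<close>, the admissible
      space has dimension \<open>i + 1\<close> and does not fit into the first choice
      \<open>?W\<close>.\<close>
    obtain v2 where v2: "v2 \<notin> ?W" "good n k B (Suc m) (spans (w(m := v2)))"
      using good_spans_extend_1[OF gm m(2) spans_subspace wW W(1)] W(2) iB m(1) by auto
    obtain w1 where w1: "\<And>j. j < Suc m \<Longrightarrow> w1 j = (w(m := v1)) j" "good n k B n (spans w1)"
      using good_spans_extend[OF v1] m by auto
    obtain w2 where w2: "\<And>j. j < Suc m \<Longrightarrow> w2 j = (w(m := v2)) j" "good n k B n (spans w2)"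
      using good_spans_extend[OF v2(2)] m by auto
    \<comment> \<open>The assumed inclusion replaces a flag good for \<open>B\<close> by one good
      for \<open>B'\<close> with the same surviving members, and the condition of \<open>B'\<close>
      at \<open>i\<close> involves only these.\<close>
    have det: "spans u i = Npre n k (drop_exp B' i) (drop_tgt n k B' (spans u) i)"
      if u: "good n k B n (spans u)" for u
    proof -
      define g where "g = (\<lambda>i j. if j < n then u j i else 0)"
      note mg = matrix_of_good[OF u, folded g_def]
      have Y: "flag_of (full_type n) g \<in> Yset"
        using flag_of_in_Yset[OF mg(1) is_type_pos[OF type]] good_cong[of n _ "spans u", OF mg(3)] u by blast
      then obtain F' where F': "F' \<in> B'.Yset" "pr is F' = pr is (flag_of (full_type n) g)"
        using assms(2) by (metis (no_types, lifting) image_iff subsetD)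
      have g': "good n k B' n (Fz F')" using F' by (simp add: B'.Yset_def)
      have eq: "Fz F' j = spans u j" if "j \<in> insert 0 (set is)" for j
      proof -
        have "j \<le> n" using that is_type_bounds[OF type, of j] by auto
        then show ?thesis
          using Fz_pr[OF that, of F'] Fz_pr[OF that, of "flag_of (full_type n) g"] F'(2)
            Fz_flag_of_full[of j n g] mg(3)[of j] by simp
      qed
      have "Fz F' i = Npre n k (drop_exp B' i) (drop_tgt n k B' (Fz F') i)"
        by (rule B'.good_top_eq[OF g' i nB])
      moreover have "drop_tgt n k B' (Fz F') i = drop_tgt n k B' (spans u) i"
        using is' eq by (rule B'.drop_tgt_typed)
      ultimately show ?thesis using eq[of i] is' by simp
    qed
    have "drop_tgt n k B' (spans w1) i = drop_tgt n k B' (spans w2) i"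
    proof (rule drop_tgt_cong[OF _ i(1)])
      fix j assume "j < i"
      then show "spans w1 j = spans w2 j" using w1(1) w2(1) m by (intro spans_cong) auto
    qed
    then have "spans w1 i = spans w2 i" using det[OF w1(2)] det[OF w2(2)] by simp
    moreover have "spans w1 i = ?W" unfolding m(1)[symmetric] using w1(1) by (intro spans_cong) auto
    moreover have "v2 \<in> spans w2 i" using in_spans[of m i w2] w2(1)[of m] m by simp
    ultimately show False using v2(1) by simp
  qed
qed

section \<open>Covering the Spaltenstein variety\<close>

text \<open>For \<open>F\<close> in the Spaltenstein variety let \<open>a i\<close> be minimal with \<open>im N\<^sup>a \<subseteq> F i\<close>. In each step \<open>a\<close> drops
  by at most one, and by exactly one if the dimension jumps by two; the entries at which it drops form the top row.
  At such an \<open>i\<close> with a jump of one, \<open>F i\<close> is the sum of its predecessor and \<open>im N\<^sup>a\<close>, which gives the condition at \<open>i\<close>.\<close>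

lemma Spalt_typed_ballot:
  assumes kn: "2 * k \<le> n" and type: "is_type n is" and F: "F \<in> Spalt n k is"
  obtains B where "typed_ballot n k B is" "F \<in> pr is ` ballot.Yset n k B"
proof -
  have kn': "k \<le> n" using kn by simp
  note bnd = is_type_bounds[OF type]
  have fl: "F \<in> pflags n is" using F by (simp add: Spalt_def)
  obtain g where g: "g \<in> GL n" "flag_of is g = F" using flag_of_surj[OF type fl] by blast
  define F' where "F' = spans (Defs.col g)"
  define J where "J = insert 0 (set is)"
  have J: "j \<le> n" if "j \<in> J" for j using that bnd by (auto simp: J_def)
  have eq: "Fz F j = F' j" if "j \<in> J" for j
    using Fz_flag_of[of j "is" g] that g(2) by (simp add: J_def F'_def spans_def)
  have ch: "chain n n F'"
    unfolding F'_def using g(1) col_in_Vsp by (intro chain_spans) (auto simp: GL_iff)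
  then have F': "cv.subspace (F' j)" "F' j \<subseteq> Vsp n" "cv.dim (F' j) = j" if "j \<le> n" for j
    using that by (auto simp: chain_def)
  define a where "a j = (LEAST a. Nim n k a \<subseteq> F' j)" for j
  have F'0: "F' 0 = {0}" by (simp add: F'_def)
  have a_ex: "Nim n k (n - k) \<subseteq> F' j" if "j \<le> n" for j
    using F'(1)[OF that] cv.subspace_0 by (auto simp: Nim_full[OF kn])
  have a_sub: "Nim n k (a j) \<subseteq> F' j" if "j \<le> n" for j
    unfolding a_def by (rule LeastI[of "\<lambda>a. Nim n k a \<subseteq> F' j", OF a_ex[OF that]])
  have a_le: "a j \<le> b" if "Nim n k b \<subseteq> F' j" for j b
    unfolding a_def using that by (rule Least_le)
  have n1: "1 \<le> n" by (rule is_type_pos[OF type])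
  have a0: "a 0 = n - k"
  proof (rule antisym)
    show "a 0 \<le> n - k" by (rule a_le[OF a_ex]) simp
    show "n - k \<le> a 0"
    proof (rule ccontr)
      assume "\<not> n - k \<le> a 0"
      then have "in_range n k (a 0) 0" by (simp add: in_range_def)
      then have "uvec 0 \<in> Nim n k (a 0)" by (auto simp: Nim_iff[OF kn'] uvec_def)
      then have "uvec 0 = 0" using a_sub[of 0] F'0 by auto
      then have "uvec 0 0 = 0" by simp
      then show False by (simp add: uvec_def)
    qed
  qed
  have an: "a n = 0"
  proof -
    have "F' n = Vsp n" using F'[of n] by (intro csubspace_eqI[of _ _ n]) auto
    then have "Nim n k 0 \<subseteq> F' n" using Nim_subset_Vsp by simp
    then show ?thesis using a_le by fastforce
  qed
  \<comment> \<open>The power \<open>a j\<close> of \<open>N\<close> maps the whole space into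
    \<open>F' j\<close>, so the preimage of this \<open>j\<close>-dimensional space is everything.
    The resulting estimate becomes the ballot inequality.\<close>
  have a_dim: "n \<le> j + 2 * a j" if "j \<le> n" for j
  proof -
    have "Vsp n \<subseteq> Npre n k (a j) (Nim n k (a j))" by (auto simp: Npre_def Nim_def)
    also have "\<dots> \<subseteq> Npre n k (a j) (F' j)" by (intro Npre_mono a_sub that)
    finally have "cv.dim (Vsp n) \<le> cv.dim (Npre n k (a j) (F' j))"
      by (rule cdim_mono[OF _ Npre_subset_Vsp])
    also have "\<dots> \<le> j + 2 * a j" using dim_Npre_le[OF kn F'(1,2)[OF that], of "a j"] F'(3)[OF that] by simp
    finally show ?thesis by simp
  qed
  define q where "q i = Max {j \<in> J. j < i}" for i
  have q_props: "q i \<in> J" "q i < i" "\<And>j. q i < j \<Longrightarrow> j < i \<Longrightarrow> j \<notin> set is" and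
    inv: "F' i \<subseteq> Npre n k 1 (F' (q i))" if i: "i \<in> set is" for i
  proof -
    obtain l where l: "l < length is" "i = is ! l" using i by (auto simp: in_set_conv_nth)
    note p = prevn_props[OF type l(1), folded l(2)]
    have "j \<le> prevn is l" if "j \<in> J" "j < i" for j
      using p(4)[of j] that by (cases "prevn is l < j") (auto simp: J_def)
    then have qi: "q i = prevn is l"
      unfolding q_def using p(1,2) by (intro Max_eqI) (auto simp: J_def)
    then show "q i \<in> J" "q i < i" "\<And>j. q i < j \<Longrightarrow> j < i \<Longrightarrow> j \<notin> set is"
      using p by (auto simp: J_def)
    have "Nop n k ` F i \<subseteq> Fz F (q i)"
    proof -
      have "Nop n k ` F (is ! l) \<subseteq> prevF is F l" using F l(1) by (simp add: Spalt_def)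
      then show ?thesis unfolding prevF_eq[OF type l(1)] qi l(2)[symmetric] .
    qed
    moreover have "Fz F (q i) = F' (q i)" using eq p(1) qi by (simp add: J_def)
    moreover have "F i = F' i" using eq[of i] i bnd[OF i] by (simp add: J_def Fz_def)
    moreover have "F' i \<subseteq> Vsp n" using F'(2) bnd[OF i] by blast
    ultimately show "F' i \<subseteq> Npre n k 1 (F' (q i))" by (auto simp: Npre_def)
  qed
  have gap: "i \<le> q i + 2" if i: "i \<in> set is" for i
  proof -
    have qn: "q i \<le> n" using q_props(2)[OF i] bnd[OF i] by simp
    have "cv.dim (F' i) \<le> cv.dim (Npre n k 1 (F' (q i)))"
      by (rule cdim_mono[OF inv[OF i] Npre_subset_Vsp])
    also have "\<dots> \<le> q i + 2" using dim_Npre_1_le[OF kn F'(1,2)[OF qn]] F'(3)[OF qn] by simp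
    finally show ?thesis using F'(3) bnd[OF i] by simp
  qed
  have a_pos: "a j \<noteq> 0" if "j < n" for j
    using a_dim[of j] that by auto
  have a_anti: "a i \<le> a (q i)" "a (q i) \<le> a i + 1" if i: "i \<in> set is" for i
  proof -
    have "F' (q i) \<subseteq> F' i" using q_props(2)[OF i] bnd[OF i] by (intro chain_mono[OF ch]) auto
    then show "a i \<le> a (q i)" using a_sub[of "q i"] q_props(2)[OF i] bnd[OF i] by (intro a_le) auto
    have "Nim n k (a i + 1) \<subseteq> F' (q i)"
    proof
      fix x assume "x \<in> Nim n k (a i + 1)"
      then obtain y where y: "y \<in> Vsp n" "x = (Nop n k ^^ (a i + 1)) y" by (auto simp: Nim_def)
      have "(Nop n k ^^ a i) y \<in> F' i" using a_sub[of i] bnd[OF i] y(1) by (auto simp: Nim_def)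
      then show "x \<in> F' (q i)" using inv[OF i] y(2) by (auto simp: Npre_def)
    qed
    then show "a (q i) \<le> a i + 1" by (rule a_le)
  qed
  \<comment> \<open>A jump by two leaves no slack in the invariance inclusion: \<open>F' i\<close>
    is the full preimage of its predecessor and contains an image of one power less.\<close>
  have double: "a (q i) = a i + 1" if i: "i \<in> set is" "i = q i + 2" for i
  proof -
    have qn: "q i < n" using q_props(2)[OF i(1)] bnd[OF i(1)] by simp
    have "F' i = Npre n k 1 (F' (q i))"
    proof (rule csubspace_eqI[of _ _ n])
      show "cv.dim (Npre n k 1 (F' (q i))) \<le> cv.dim (F' i)"
        using dim_Npre_1_le[OF kn F'(1,2)[of "q i"]] F'(3)[of "q i"] F'(3)[of i] qn i(2) bnd[OF i(1)] by simp
    qed (use F' bnd[OF i(1)] inv[OF i(1)] Npre_subset_Vsp in auto)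
    moreover have "Nim n k (a (q i) - 1) \<subseteq> Npre n k 1 (Nim n k (a (q i) - 1 + 1))"
      by (rule Nim_subset_Npre[OF kn'])
    moreover have "Npre n k 1 (Nim n k (a (q i))) \<subseteq> Npre n k 1 (F' (q i))"
      using a_sub qn by (intro Npre_mono) auto
    ultimately have "Nim n k (a (q i) - 1) \<subseteq> F' i" using a_pos[OF qn] by simp
    then have "a i \<le> a (q i) - 1" by (rule a_le)
    then show ?thesis using a_anti(2)[OF i(1)] a_pos[OF qn] by linarith
  qed
  \<comment> \<open>Taking the complement puts the missing dimensions among the bottom entries, as
    \<open>compat\<close> demands.\<close>
  define B where "B = {1..n} - {i \<in> set is. a i < a (q i)}"
  have notis_B: "j \<in> B" if "j \<in> {1..n}" "j \<notin> set is" for j using that by (simp add: B_def)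
  have B_is: "i \<in> B \<longleftrightarrow> a i = a (q i)" if "i \<in> set is" for i
    using that bnd[OF that] a_anti[OF that] by (auto simp: B_def)
  have compat: "compat n is B"
    unfolding compat_def
  proof (rule ballI)
    fix j assume j: "j \<in> {1..n} - set is"
    define i where "i = Min {i \<in> set is. j < i}"
    have "j \<noteq> n" using j is_type_last[OF type] by auto
    then have "n \<in> {i \<in> set is. j < i}" using is_type_last[OF type] j by auto
    then have "i \<in> {i \<in> set is. j < i}" unfolding i_def by (intro Min_in) auto
    then have i: "i \<in> set is" "j < i" by auto
    have "q i < j"
    proof (rule ccontr)
      assume "\<not> q i < j"
      moreover have "q i \<noteq> j" using q_props(1)[OF i(1)] j by (auto simp: J_def)
      ultimately have "q i \<in> {i \<in> set is. j < i}" using q_props(1)[OF i(1)] by (auto simp: J_def)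
      then have "i \<le> q i" unfolding i_def by (intro Min_le) auto
      then show False using q_props(2)[OF i(1)] by simp
    qed
    then have e: "q i = j - 1" "i = Suc j" "i = q i + 2" using gap[OF i(1)] i(2) by linarith+
    then show "j \<in> B \<and> Suc j \<in> set is \<and> Suc j \<notin> B \<and> j - 1 \<in> insert 0 (set is)"
      using notis_B[of j] j i(1) double[OF i(1) e(3)] B_is[OF i(1)] q_props(1)[OF i(1)] by (auto simp: J_def)
  qed
  have cnt_step: "bcount B i + a (q i) = bcount B (q i) + (i - q i) + a i" if i: "i \<in> set is" for i
  proof -
    have lt: "q i < i" by (rule q_props(2)[OF i])
    consider "i = Suc (q i)" | "i = Suc (Suc (q i))" using gap[OF i] lt by linarith
    then show ?thesis
    proof cases
      case 1
      then have "bcount B i = bcount B (q i) + (if i \<in> B then 1 else 0)"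
        using bcount_Suc[of B "q i"] by simp
      then show ?thesis using 1 B_is[OF i] a_anti[OF i] by auto
    next
      case 2
      then have "Suc (q i) \<notin> set is" using q_props(3)[OF i, of "Suc (q i)"] by simp
      then have "Suc (q i) \<in> B" using 2 bnd[OF i] by (intro notis_B) auto
      moreover have "i \<notin> B" "a (q i) = a i + 1" using double[OF i] B_is[OF i] 2 by auto
      ultimately have "bcount B i = bcount B (q i) + 1"
        using bcount_Suc[of B "q i"] bcount_Suc[of B "Suc (q i)"] 2 by simp
      then show ?thesis using 2 \<open>a (q i) = a i + 1\<close> by simp
    qed
  qed
  \<comment> \<open>Starting from \<open>n - k\<close> at index 0, \<open>a\<close> has dropped once
    for each top entry up to \<open>j\<close>.\<close>
  have cnt: "bcount B j + (n - k) = j + a j" if "j \<in> J" for j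
    using that
  proof (induction j rule: less_induct)
    case (less j)
    show ?case
    proof (cases "j = 0")
      case False
      then have j: "j \<in> set is" using less.prems by (auto simp: J_def)
      have "bcount B (q j) + (n - k) = q j + a (q j)" using less.IH q_props[OF j] by blast
      then show ?thesis using cnt_step[OF j] q_props(2)[OF j] by linarith
    qed (simp add: a0)
  qed
  have ht_J: "2 * int k - int n \<le> ht B j" if "j \<in> J" for j
    using cnt[OF that] a_dim[OF J[OF that]] kn J[OF that] by (simp add: ht_def)
  interpret typed_ballot n k B "is"
  proof (unfold_locales)
    show "B \<subseteq> {1..n}" by (auto simp: B_def)
    then have "B \<inter> {1..n} = B" by blast
    then have "card B = bcount B n" by (simp add: bcount_def)
    then show "card B = k" using cnt[of n] an is_type_last[OF type] kn' by (simp add: J_def)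
    show "2 * int k - int n \<le> ht B j" if "j \<le> n" for j
    proof (cases "j \<in> J")
      case False
      then have j: "j \<in> {1..n}" "j \<notin> set is" using that by (auto simp: J_def)
      \<comment> \<open>A missing index is reached by an up-step from a surviving one, so the height
        bound carries over.\<close>
      then have "j - 1 \<in> J" using compat by (auto simp: compat_def J_def)
      then show ?thesis using ht_J[of "j - 1"] ht_pred[of j B] notis_B[OF j] j by simp
    qed (rule ht_J)
  qed (rule type compat)+
  have "good n k B m F'" if "m \<le> n" for m
    using that
  proof (induction m)
    case 0
    then show ?case using F'[of 0] F'0 by (simp add: good_def chain_def)
  next
    case (Suc m)
    define i where "i = Suc m"
    have i: "1 \<le> i" "i \<le> n" "i - 1 = m" using Suc.prems by (auto simp: i_def)
    have gd: "good n k B (i - 1) F'" using Suc i by simp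
    let ?P = "Npre n k (drop_exp B i) (drop_tgt n k B F' i)"
    have "F' i \<subseteq> ?P"
    proof (cases "i \<in> set is")
      case False
      have ii: "i \<in> {1..n}" using i by simp
      note m = missing[OF ii False]
      have "q (Suc i) = i - 1"
      proof (rule ccontr)
        assume ne: "q (Suc i) \<noteq> i - 1"
        have "q (Suc i) \<noteq> i" using q_props(1)[OF m(2)] False i by (auto simp: J_def)
        then have "q (Suc i) < i - 1" using ne q_props(2)[OF m(2)] by linarith
        then show False using q_props(3)[OF m(2), of "i - 1"] m(4) by auto
      qed
      moreover have "F' i \<subseteq> F' (Suc i)" using bnd[OF m(2)] by (intro chain_mono[OF ch]) auto
      ultimately show ?thesis using inv[OF m(2)] m(1) by (auto simp: drop_exp_def drop_tgt_def)
    next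
      case True
      show ?thesis
      proof (cases "i = q i + 2")
        case gap2: True
        then have "i - 1 \<notin> set is" using q_props(3)[OF True, of "i - 1"] by simp
        moreover have "i - 1 \<in> {1..n}" "Suc (i - 1) = i" using gap2 i by auto
        moreover have "i - 1 - 1 = q i" using gap2 by linarith
        ultimately show ?thesis using missing_drop(1)[of "i - 1"] missing_drop(2)[of "i - 1" F'] inv[OF True] by simp
      next
        case gap1: False
        then have qi: "q i = i - 1" using gap[OF True] q_props(2)[OF True] by linarith
        show ?thesis
        proof (cases "i \<in> B")
          case True
          then show ?thesis using inv[OF \<open>i \<in> set is\<close>] qi by (simp add: drop_exp_def drop_tgt_def)
        next
          case nB: False
          then have lt: "a i < a (q i)" using B_is[OF True] a_anti(1)[OF True] by simp
          have "\<not> Nim n k (a i) \<subseteq> F' (q i)" using a_le[of "a i" "q i"] lt by auto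
          then obtain x where x: "x \<in> Nim n k (a i)" "x \<notin> F' (i - 1)" using qi by auto
          have xi: "x \<in> F' i" using a_sub[OF i(2)] x(1) by blast
          have b: "i \<in> J" using True by (simp add: J_def)
          have Nx: "x \<in> Npre n k e (Nim n k (a i + e))" for e
            using Nim_subset_Npre[OF kn'] x(1) by blast
          have "x \<in> ?P"
          proof (cases "has_par B i")
            case hp: True
            note p = par_props[OF i(1) nB hp]
            have pJ: "par B i \<in> J" using par_typed[OF True nB hp] by (simp add: J_def)
            define e where "e = (i - par B i) div 2"
            note c = balanced_count[OF p(6), folded e_def]
            \<comment> \<open>A cup of half-length \<open>e\<close> contains \<open>e\<close> top
              entries, and \<open>a\<close> drops once for each.\<close>
            have "a i + e = a (par B i)" using cnt[OF b] cnt[OF pJ] c by linarith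
            then have "Nim n k (a i + e) \<subseteq> F' (par B i)" using a_sub J[OF pJ] by simp
            then have "x \<in> Npre n k e (F' (par B i))" using Nx[of e] Npre_mono by blast
            then show ?thesis using nB hp by (simp add: drop_exp_def drop_tgt_def e_def)
          next
            case hp: False
            have "2 * bcount B i \<le> i"
              using prefix_min_bcount no_par_new_min[OF i(1) nB hp] by blast
            then have "a i + bcount B i = n - k - (i - 2 * bcount B i)"
              using cnt[OF b] new_min_bound[OF i(2)] kn by linarith
            then show ?thesis using Nx[of "bcount B i"] nB hp by (simp add: drop_exp_def drop_tgt_def)
          qed
          moreover have "F' (i - 1) \<subseteq> ?P" using gd i(1,2) by (rule drop_tgt_prefix)
          moreover have sub: "cv.subspace ?P" using gd i(1) by (intro Npre_subspace drop_tgt_subspace)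
          moreover have "cv.span (insert x (F' (i - 1))) = F' i"
          proof (rule csubspace_eqI[of _ _ n])
            have F'i: "F' (i - 1) \<subseteq> F' i" using i by (intro chain_mono[OF ch]) auto
            show "cv.span (insert x (F' (i - 1))) \<subseteq> F' i"
              using F'i xi F'(1)[OF i(2)] by (intro cv.span_minimal) auto
            have "cv.dim (insert x (F' (i - 1))) = Suc (cv.dim (F' (i - 1)))"
            proof (rule cdim_insert[of _ n])
              show "F' (i - 1) \<subseteq> Vsp n" using F'(2)[of "i - 1"] i by simp
              show "x \<in> Vsp n" using xi F'(2)[OF i(2)] by blast
              show "x \<notin> cv.span (F' (i - 1))"
                using x(2) F'(1)[of "i - 1"] i by (simp add: cv.span_eq_iff[THEN iffD2])
            qed
            then show "cv.dim (F' i) \<le> cv.dim (cv.span (insert x (F' (i - 1))))"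
              using F'(3)[of "i - 1"] F'(3)[OF i(2)] i by simp
          qed (use F'(2)[OF i(2)] in auto)
          ultimately show ?thesis using cv.span_minimal[of "insert x (F' (i - 1))" ?P] by auto
        qed
      qed
    qed
    moreover have "{1..i} = insert i {1..i - 1}" using i by auto
    ultimately have "\<forall>j\<in>{1..i}. F' j \<subseteq> Npre n k (drop_exp B j) (drop_tgt n k B F' j)"
      using gd by (simp add: good_def)
    moreover have "chain n i F'" using ch i by (auto simp: chain_def)
    ultimately show ?case by (simp add: good_def i_def)
  qed
  then have "flag_of (full_type n) g \<in> Yset"
    using flag_of_in_Yset[OF g(1) n1] by (simp add: F'_def)
  moreover have "pr is (flag_of (full_type n) g) = F" using pr_flag_of[OF type] g(2) by simp
  ultimately have "F \<in> pr is ` Yset" by blast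
  then show ?thesis using that typed_ballot_axioms by blast
qed

section \<open>Standard tableaux\<close>

lemma count_type_mset:
  "count (type_mset is) x = (\<Sum>l<length is. if is ! l = x then gap is l else 0)"
proof -
  have "type_mset is = (\<Sum>l\<leftarrow>[0..<length is]. replicate_mset (gap is l) (is ! l))"
    unfolding type_mset_def by (simp add: mset_concat comp_def)
  also have "\<dots> = (\<Sum>l\<in>{0..<length is}. replicate_mset (gap is l) (is ! l))"
    by (simp add: interv_sum_list_conv_sum_set_nat)
  finally show ?thesis
    by (auto simp: count_sum atLeast0LessThan intro!: sum.cong)
qed

lemma type_entry:
  assumes "is_type n is" "x \<in> set is"
  obtains q where "q \<in> insert 0 (set is)" "q < x" "\<And>j. q < j \<Longrightarrow> j < x \<Longrightarrow> j \<notin> set is"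
    "count (type_mset is) x = x - q" "double_entry is x \<longleftrightarrow> x - q = 2"
proof -
  obtain l where l: "l < length is" "x = is ! l" using assms(2) by (auto simp: in_set_conv_nth)
  have "sorted_wrt (<) is" using assms(1) by (simp add: is_type_def)
  then have "distinct is" by (simp add: strict_sorted_iff)
  then have uniq: "is ! l' = x \<longleftrightarrow> l' = l" if "l' < length is" for l'
    using l that by (auto simp: nth_eq_iff_index_eq)
  have "count (type_mset is) x = (\<Sum>l'<length is. if l' = l then gap is l' else 0)"
    unfolding count_type_mset using uniq by (intro sum.cong) auto
  also have "\<dots> = gap is l" using l by simp
  finally have "count (type_mset is) x = x - prevn is l" using l by (simp add: gap_eq)
  moreover have "double_entry is x \<longleftrightarrow> x - prevn is l = 2"
    unfolding double_entry_def using uniq l gap_eq by metis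
  ultimately show ?thesis using that prevn_props[OF assms(1) l(1)] l(2) by metis
qed

text \<open>The final height is \<open>2 * k - n\<close>, so the bound at \<open>j\<close> says that
  the path does not rise over the remaining steps. Suffixes are the right form because rows decrease
  and columns pair the large entries first.\<close>

lemma ballot_iff:
  assumes "B \<subseteq> {1..n}" "card B = k" "j \<le> n"
  shows "2 * int k - int n \<le> ht B j \<longleftrightarrow> card (B \<inter> {j<..n}) \<le> card (({1..n} - B) \<inter> {j<..n})"
proof -
  have fin: "finite B" using assms(1) by (rule finite_subset) simp
  have "B = (B \<inter> {1..j}) \<union> (B \<inter> {j<..n})" using assms(1) by fastforce
  then have "card B = card (B \<inter> {1..j}) + card (B \<inter> {j<..n})"
    using fin by (metis card_Un_disjoint finite_Int Int_assoc Int_left_commute ivl_disj_int_two(8) inf_bot_right)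
  then have 1: "card (B \<inter> {j<..n}) + bcount B j = k" using assms(2) by (simp add: bcount_def)
  have "{j<..n} = (B \<inter> {j<..n}) \<union> (({1..n} - B) \<inter> {j<..n})" by auto
  moreover have "card ((B \<inter> {j<..n}) \<union> (({1..n} - B) \<inter> {j<..n})) =
      card (B \<inter> {j<..n}) + card (({1..n} - B) \<inter> {j<..n})"
    by (rule card_Un_disjoint) auto
  ultimately have "n - j = card (B \<inter> {j<..n}) + card (({1..n} - B) \<inter> {j<..n})"
    by (metis card_greaterThanAtMost)
  then show ?thesis using 1 assms(3) by (auto simp: ht_def)
qed

lemma sorted_gr_nth_less: "sorted_wrt (>) xs \<Longrightarrow> i < j \<Longrightarrow> j < length xs \<Longrightarrow> xs ! j < (xs ! i :: nat)"
  by (rule sorted_wrt_nth_less)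

lemma sorted_gr_inj: "sorted_wrt (>) (xs :: nat list) \<Longrightarrow> inj_on (\<lambda>i. xs ! i) {..<length xs}"
proof (rule inj_onI)
  fix i j assume "sorted_wrt (>) xs" "i \<in> {..<length xs}" "j \<in> {..<length xs}" "xs ! i = xs ! j"
  then show "i = j"
    using sorted_gr_nth_less[of xs i j] sorted_gr_nth_less[of xs j i] by (cases i j rule: linorder_cases) auto
qed

lemma sorted_gr_distinct: "sorted_wrt (>) (xs :: nat list) \<Longrightarrow> distinct xs"
  using sorted_gr_inj[of xs] by (auto simp: distinct_conv_nth inj_on_def)

lemma sorted_gr_equal:
  assumes "sorted_wrt (>) xs" "sorted_wrt (>) ys" "set xs = set (ys :: nat list)"
  shows "xs = ys"
  using strict_sorted_equal[of "rev xs" "rev ys"] assms by (simp add: sorted_wrt_rev)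

text \<open>If column \<open>c\<close> were wrong, at least \<open>c + 1\<close> bottom entries but
  at most \<open>c\<close> top entries would reach the value \<open>b ! c\<close>.\<close>

lemma sorted_gr_columns:
  assumes "sorted_wrt (>) t" "sorted_wrt (>) (b :: nat list)" "c < length b" "c < length t"
    "card {y \<in> set b. b ! c \<le> y} \<le> card {y \<in> set t. b ! c \<le> y}"
  shows "b ! c \<le> t ! c"
proof (rule ccontr)
  assume lt: "\<not> b ! c \<le> t ! c"
  have "(\<lambda>i. b ! i) ` {..c} \<subseteq> {y \<in> set b. b ! c \<le> y}"
  proof
    fix y assume "y \<in> (\<lambda>i. b ! i) ` {..c}"
    then obtain i where "i \<le> c" "y = b ! i" by auto
    then show "y \<in> {y \<in> set b. b ! c \<le> y}"
      using sorted_gr_nth_less[OF assms(2), of i c] assms(3) by (cases "i = c") auto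
  qed
  then have le: "card ((\<lambda>i. b ! i) ` {..c}) \<le> card {y \<in> set b. b ! c \<le> y}" by (intro card_mono) auto
  have "card ((\<lambda>i. b ! i) ` {..c}) = c + 1"
  proof -
    have "{..c} \<subseteq> {..<length b}" using assms(3) by auto
    from card_image[OF inj_on_subset[OF sorted_gr_inj[OF assms(2)] this]] show ?thesis by simp
  qed
  then have card_b: "c + 1 \<le> card {y \<in> set b. b ! c \<le> y}" using le by simp
  have "{y \<in> set t. b ! c \<le> y} \<subseteq> (\<lambda>i. t ! i) ` {..<c}"
  proof
    fix y assume y: "y \<in> {y \<in> set t. b ! c \<le> y}"
    then obtain i where i: "i < length t" "y = t ! i" by (auto simp: in_set_conv_nth)
    have "i < c"
    proof (rule ccontr)
      assume "\<not> i < c"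
      then have "t ! i \<le> t ! c" using sorted_gr_nth_less[OF assms(1), of c i] i by (cases "i = c") auto
      then show False using y i lt by auto
    qed
    then show "y \<in> (\<lambda>i. t ! i) ` {..<c}" using i by blast
  qed
  then have "card {y \<in> set t. b ! c \<le> y} \<le> card ((\<lambda>i. t ! i) ` {..<c})" by (intro card_mono) auto
  also have "\<dots> \<le> c" using card_image_le[of "{..<c}" "\<lambda>i. t ! i"] by simp
  finally have "card {y \<in> set t. b ! c \<le> y} \<le> c" .
  with card_b show False using assms(5) by simp
qed

definition bottoms :: "nat list \<Rightarrow> tableau \<Rightarrow> nat set" where
  "bottoms is S = set (snd (phi is S))"

text \<open>Strict rows contain each value at most twice, so the gaps of the type are 1 or 2, and
  the dimensions missing from it are exactly the lowered copies of double entries. The columns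
  inject large bottom entries into large top entries, which is the ballot condition.\<close>

lemma std_tableau_typed:
  assumes kn2: "2 * k \<le> n" and type: "is_type n is" and S: "S \<in> std_tableaux n k is"
  shows "typed_ballot n k (bottoms is S) is" "set (fst S) = {1..n} - bottoms is S"
proof -
  obtain t b where tb: "S = (t, b)" by (cases S)
  have t: "length t = n - k" "length b = k" "mset (t @ b) = type_mset is"
      "sorted_wrt (>) t" "sorted_wrt (>) b" "\<And>c. c < k \<Longrightarrow> b ! c \<le> t ! c"
    using S by (auto simp: std_tableaux_def tb)
  note bnd = is_type_bounds[OF type]
  have dt: "distinct t" "distinct b" using t sorted_gr_distinct by auto
  have cnt: "(if x \<in> set t then 1 else 0) + (if x \<in> set b then 1 else 0) = count (type_mset is) x" for x
    using dt unfolding t(3)[symmetric] by (auto simp: distinct_count_atmost_1)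
  let ?D = "double_entry is"
  define f where "f x = (if ?D x then x - 1 else x)" for x
  have bot: "bottoms is S = f ` set b" by (simp add: bottoms_def phi_def tb f_def)
  have notis: "x \<notin> set t \<and> x \<notin> set b" if "x \<notin> set is" for x
  proof -
    have "count (type_mset is) x = 0"
      unfolding count_type_mset using that by (intro sum.neutral) auto
    then show ?thesis using cnt[of x] by (auto split: if_splits)
  qed
  have D: "x \<in> set t \<or> x \<in> set b" "?D x \<longleftrightarrow> x \<in> set t \<and> x \<in> set b"
    "?D x \<Longrightarrow> 2 \<le> x \<and> x - 1 \<notin> insert 0 (set is) \<and> x - 2 \<in> insert 0 (set is)"
    "\<not> ?D x \<Longrightarrow> x - 1 \<in> insert 0 (set is)" if x: "x \<in> set is" for x
  proof -
    obtain q where q: "q \<in> insert 0 (set is)" "q < x" "\<And>j. q < j \<Longrightarrow> j < x \<Longrightarrow> j \<notin> set is"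
      "count (type_mset is) x = x - q" "?D x \<longleftrightarrow> x - q = 2"
      using type_entry[OF type x] by blast
    show "x \<in> set t \<or> x \<in> set b" using cnt[of x] q(2,4) by (auto split: if_splits)
    show d: "?D x \<longleftrightarrow> x \<in> set t \<and> x \<in> set b" using cnt[of x] q(2,4,5) by (auto split: if_splits)
    show "2 \<le> x \<and> x - 1 \<notin> insert 0 (set is) \<and> x - 2 \<in> insert 0 (set is)" if "?D x"
    proof -
      have e: "x = q + 2" using that q(2,5) by linarith
      then show ?thesis using q(1) q(3)[of "x - 1"] by auto
    qed
    show "x - 1 \<in> insert 0 (set is)" if "\<not> ?D x"
    proof -
      have "x - q = 1" using cnt[of x] q(2,4) that d by (auto split: if_splits)
      then have "x - 1 = q" by linarith
      then show ?thesis using q(1) by simp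
    qed
  qed
  have b_is: "x \<in> set is" if "x \<in> set b" for x using notis that by blast
  have bot_is: "y \<in> bottoms is S \<longleftrightarrow> y \<in> set b \<and> \<not> ?D y" if y: "y \<in> set is" for y
  proof
    assume "y \<in> bottoms is S"
    then obtain x where x: "x \<in> set b" "y = f x" using bot by blast
    then have "\<not> ?D x" using D(3)[OF b_is[OF x(1)]] y by (auto simp: f_def)
    then show "y \<in> set b \<and> \<not> ?D y" using x by (simp add: f_def)
  next
    assume y: "y \<in> set b \<and> \<not> ?D y"
    then have "f y = y" by (simp add: f_def)
    then show "y \<in> bottoms is S" unfolding bot using y by force
  qed
  have miss: "y \<in> bottoms is S \<and> Suc y \<in> set is \<and> Suc y \<notin> bottoms is S \<and> y - 1 \<in> insert 0 (set is)"
    if y: "y \<in> {1..n}" "y \<notin> set is" for y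
  proof -
    define x where "x = Min {x \<in> set is. y < x}"
    have "y \<noteq> n" using y is_type_last[OF type] by auto
    then have "n \<in> {x \<in> set is. y < x}" using is_type_last[OF type] y by auto
    then have "x \<in> {x \<in> set is. y < x}" unfolding x_def by (intro Min_in) auto
    then have x: "x \<in> set is" "y < x" by auto
    have min: "\<not> (z \<in> insert 0 (set is) \<and> y \<le> z \<and> z < x)" for z
    proof
      assume z: "z \<in> insert 0 (set is) \<and> y \<le> z \<and> z < x"
      then have "z \<in> {x \<in> set is. y < x}" using y by (cases "z = y") auto
      then have "x \<le> z" unfolding x_def by (intro Min_le) auto
      then show False using z by simp
    qed
    have Dx: "?D x" using D(4)[OF x(1)] min[of "x - 1"] x(2) by force
    have e: "x = Suc y"
    proof (rule ccontr)
      assume "x \<noteq> Suc y"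
      then show False using D(3)[OF x(1) Dx] min[of "x - 2"] x(2) by force
    qed
    have "x \<in> set b" using D(2)[OF x(1)] Dx by simp
    moreover have "f x = y" using Dx e by (simp add: f_def)
    ultimately have "y \<in> bottoms is S" unfolding bot by blast
    moreover have "Suc y \<notin> bottoms is S" using bot_is[OF x(1)] Dx e by simp
    moreover have "y - 1 \<in> insert 0 (set is)" using D(3)[OF x(1) Dx] e by (simp add: numeral_2_eq_2)
    ultimately show ?thesis using x(1) e by simp
  qed
  have sub: "bottoms is S \<subseteq> {1..n}"
  proof
    fix y assume "y \<in> bottoms is S"
    then obtain x where x: "x \<in> set b" "y = f x" using bot by blast
    then show "y \<in> {1..n}" using D(3)[OF b_is[OF x(1)]] bnd[OF b_is[OF x(1)]] by (auto simp: f_def)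
  qed
  show tops: "set (fst S) = {1..n} - bottoms is S"
  proof (intro Set.set_eqI iffI)
    fix x assume x: "x \<in> set (fst S)"
    then have xi: "x \<in> set is" using notis tb by auto
    then show "x \<in> {1..n} - bottoms is S" using x tb bot_is[OF xi] D(2)[OF xi] bnd[OF xi] by auto
  next
    fix x assume x: "x \<in> {1..n} - bottoms is S"
    then have xi: "x \<in> set is" using miss[of x] by blast
    then show "x \<in> set (fst S)" using x tb bot_is[OF xi] D(1,2)[OF xi] by auto
  qed
  have kn: "k \<le> n" using kn2 by simp
  have cardB: "card (bottoms is S) = k"
  proof -
    have "card ({1..n} - bottoms is S) = n - k" using tops distinct_card[OF dt(1)] t(1) tb by simp
    moreover have "card (bottoms is S) \<le> n" using card_mono[OF _ sub] by simp
    ultimately show ?thesis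
      using card_Diff_subset[of "bottoms is S" "{1..n}"] sub finite_subset[OF sub] kn by simp
  qed
  show "typed_ballot n k (bottoms is S) is"
  proof (unfold_locales)
    show "compat n is (bottoms is S)" unfolding compat_def using miss by blast
    fix j assume j: "j \<le> n"
    \<comment> \<open>The columns whose bottom entry exceeds \<open>j\<close>. Lowering an entry
      cannot move it above \<open>j\<close>, so they account for all elements of
      \<open>bottoms is S\<close> beyond \<open>j\<close>.\<close>
    define C where "C = {c. c < k \<and> j < b ! c}"
    have Ck: "C \<subseteq> {..<k}" by (auto simp: C_def)
    have len: "k \<le> length t" using kn2 t(1) by simp
    show "2 * int k - int n \<le> ht (bottoms is S) j"
      unfolding ballot_iff[OF sub cardB j]
    proof -
      have "bottoms is S \<inter> {j<..n} \<subseteq> (\<lambda>c. f (b ! c)) ` C"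
      proof
        fix y assume y: "y \<in> bottoms is S \<inter> {j<..n}"
        then obtain x where x: "x \<in> set b" "y = f x" using bot by blast
        then obtain c where c: "c < k" "x = b ! c" using t(2) by (auto simp: in_set_conv_nth)
        have "j < b ! c" using y x c by (auto simp: f_def split: if_splits)
        then show "y \<in> (\<lambda>c. f (b ! c)) ` C" using c x by (auto simp: C_def)
      qed
      then have "card (bottoms is S \<inter> {j<..n}) \<le> card C"
        using Ck finite_subset[OF Ck] by (meson card_image_le card_mono finite_imageI finite_lessThan order_trans)
      also have "card C = card ((\<lambda>c. t ! c) ` C)"
      proof -
        have "C \<subseteq> {..<length t}" using Ck len by auto
        from card_image[OF inj_on_subset[OF sorted_gr_inj[OF t(4)] this]] show ?thesis by simp
      qed
      also have "\<dots> \<le> card (set t \<inter> {j<..n})"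
      proof (rule card_mono)
        show "(\<lambda>c. t ! c) ` C \<subseteq> set t \<inter> {j<..n}"
        proof
          fix y assume "y \<in> (\<lambda>c. t ! c) ` C"
          then obtain c where c: "c < k" "j < b ! c" "y = t ! c" by (auto simp: C_def)
          then have "y \<in> set t" "j < y" using len t(6)[OF c(1)] by auto
          then show "y \<in> set t \<inter> {j<..n}" using notis[of y] bnd[of y] by auto
        qed
      qed simp
      finally show "card (bottoms is S \<inter> {j<..n}) \<le> card (({1..n} - bottoms is S) \<inter> {j<..n})"
        using tops tb by simp
    qed
  qed (rule sub cardB type)+
qed

text \<open>The top row is the complement of the bottom entries, and the prescribed content then
  leaves only one multiset for the bottom row.\<close>

lemma bottoms_inj:
  assumes "2 * k \<le> n" "is_type n is" "S \<in> std_tableaux n k is" "S' \<in> std_tableaux n k is"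
    "bottoms is S = bottoms is S'"
  shows "S = S'"
proof -
  obtain t b t' b' where tb: "S = (t, b)" "S' = (t', b')" by (cases S; cases S')
  have t: "mset (t @ b) = type_mset is" "sorted_wrt (>) t" "sorted_wrt (>) b"
    and t': "mset (t' @ b') = type_mset is" "sorted_wrt (>) t'" "sorted_wrt (>) b'"
    using assms(3,4) by (auto simp: std_tableaux_def tb)
  have "set t = set t'"
    using std_tableau_typed(2)[OF assms(1,2,3)] std_tableau_typed(2)[OF assms(1,2,4)] assms(5) tb by simp
  then have tt: "t = t'" using t(2) t'(2) by (intro sorted_gr_equal)
  then have "mset b = mset b'" using t(1) t'(1) by (metis add_left_cancel mset_append)
  then have "set b = set b'" by (rule mset_eq_setD)
  then have "b = b'" using t(3) t'(3) by (intro sorted_gr_equal)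
  then show ?thesis using tt tb by simp
qed

text \<open>Inverts \<open>phi\<close>: each missing dimension is raised to its successor, which
  already stands in the top row and so becomes a double entry.\<close>

lemma (in typed_ballot) tableau_exists:
  obtains S where "S \<in> std_tableaux n k is" "bottoms is S = B"
proof -
  note bnd = is_type_bounds[OF type]
  define T where "T = {1..n} - B"
  define M where "M = {1..n} - set is"
  \<comment> \<open>The content of the bottom row after raising the missing dimensions;
    \<open>h\<close> lowers them again.\<close>
  define Bo where "Bo = (B \<inter> set is) \<union> Suc ` M"
  define h where "h y = (if y \<in> B then y else y - 1)" for y
  have finB: "finite B" using B_subset by (rule finite_subset) simp
  have fin: "finite T" "finite Bo" using finB by (auto simp: T_def Bo_def M_def)
  have M: "j \<in> B" "Suc j \<in> set is" "Suc j \<notin> B" "j - 1 \<in> insert 0 (set is)" "j \<in> {1..n}" "j \<notin> set is"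
    if "j \<in> M" for j using that missing[of j] by (auto simp: M_def)
  have T_is: "T \<subseteq> set is" using missing(1) unfolding T_def by blast
  have Bo_is: "Bo \<subseteq> set is" using M(2) by (auto simp: Bo_def)
  have Bo_cases: "(y \<in> B \<and> y \<in> set is) \<or> (\<exists>j\<in>M. y = Suc j \<and> y \<notin> B)" if "y \<in> Bo" for y
    using that M(3) by (auto simp: Bo_def)
  have h_inj: "inj_on h Bo"
  proof (rule inj_onI)
    fix y z assume yz: "y \<in> Bo" "z \<in> Bo" "h y = h z"
    show "y = z"
      using Bo_cases[OF yz(1)] Bo_cases[OF yz(2)] yz(3) M(6) by (auto simp: h_def)
  qed
  have h_img: "h ` Bo = B"
  proof (intro Set.set_eqI iffI)
    fix y assume "y \<in> h ` Bo"
    then obtain z where z: "z \<in> Bo" "y = h z" by blast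
    then show "y \<in> B" using Bo_cases[OF z(1)] M(1) by (auto simp: h_def)
  next
    fix y assume y: "y \<in> B"
    show "y \<in> h ` Bo"
    proof (cases "y \<in> set is")
      case True
      then have "h y = y" "y \<in> Bo" using y by (auto simp: h_def Bo_def)
      then show ?thesis by force
    next
      case False
      then have "y \<in> M" using y B_subset by (auto simp: M_def)
      then have "h (Suc y) = y" "Suc y \<in> Bo" using M(3) by (auto simp: h_def Bo_def)
      then show ?thesis by force
    qed
  qed
  have cardBo: "card Bo = k" using card_image[OF h_inj] h_img card_B by simp
  have cardT: "card T = n - k"
    unfolding T_def using card_Diff_subset[OF finB B_subset] card_B by simp
  define t where "t = rev (sorted_list_of_set T)"
  define b where "b = rev (sorted_list_of_set Bo)"
  have t: "set t = T" "length t = n - k" "sorted_wrt (>) t" "distinct t"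
    using fin cardT by (auto simp: t_def sorted_wrt_rev)
  have b: "set b = Bo" "length b = k" "sorted_wrt (>) b" "distinct b"
    using fin cardBo by (auto simp: b_def sorted_wrt_rev)
  have entry: "count (type_mset is) x = (if x \<in> T then 1 else 0) + (if x \<in> Bo then 1 else 0) \<and>
      (x \<in> Bo \<longrightarrow> (double_entry is x \<longleftrightarrow> x \<notin> B)) \<and>
      (\<exists>q. q \<in> insert 0 (set is) \<and> q < x \<and> (\<forall>j. q < j \<and> j < x \<longrightarrow> j \<notin> set is))"
    if x: "x \<in> set is" for x
  proof -
    obtain q where q: "q \<in> insert 0 (set is)" "q < x" "\<And>j. q < j \<Longrightarrow> j < x \<Longrightarrow> j \<notin> set is"
      "count (type_mset is) x = x - q" "double_entry is x \<longleftrightarrow> x - q = 2"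
      using type_entry[OF type x] by blast
    have qx: "q = x - 1" if "x - 1 \<in> insert 0 (set is)"
    proof (rule ccontr)
      assume "q \<noteq> x - 1"
      then have "q < x - 1" using q(2) by linarith
      then show False using q(3)[of "x - 1"] that by auto
    qed
    have "count (type_mset is) x = (if x \<in> T then 1 else 0) + (if x \<in> Bo then 1 else 0) \<and>
      (x \<in> Bo \<longrightarrow> (x - q = 2 \<longleftrightarrow> x \<notin> B))"
    proof (cases "x \<in> B")
      case True
      then have e: "x - q = 1" using qx[OF bottom_pred[OF x]] q(2) by linarith
      have "x \<in> Bo" "x \<notin> T" using True x by (auto simp: Bo_def T_def)
      then show ?thesis using e True q(4) by simp
    next
      case False
      then have xT: "x \<in> T" using bnd[OF x] by (auto simp: T_def)
      show ?thesis
      proof (cases "x - 1 \<in> insert 0 (set is)")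
        case True
        then have e: "x - q = 1" using qx q(2) by linarith
        have "x - 1 \<notin> M" using True by (auto simp: M_def)
        then have "x \<notin> Bo" using False by (auto simp: Bo_def)
        then show ?thesis using e xT q(4) by simp
      next
        case no: False
        then have m: "x - 1 \<in> M" "Suc (x - 1) = x" using bnd[OF x] by (auto simp: M_def)
        have "x \<in> Bo" unfolding Bo_def using m by (metis UnI2 image_eqI)
        moreover have "q = x - 2"
        proof (rule ccontr)
          assume "q \<noteq> x - 2"
          moreover have "q \<noteq> x - 1" using q(1) no by auto
          ultimately have "q < x - 2" using q(2) by linarith
          moreover have "x - 2 \<in> insert 0 (set is)" using M(4)[OF m(1)] by (simp add: numeral_2_eq_2)
          ultimately show False using q(3)[of "x - 2"] by auto
        qed
        moreover have "2 \<le> x" using no by (cases "x = 1") (use bnd[OF x] in auto)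
        ultimately show ?thesis using xT False q(4) by simp
      qed
    qed
    then show ?thesis using q by blast
  qed
  have "mset (t @ b) = type_mset is"
  proof (rule multiset_eqI)
    fix x
    have "count (mset (t @ b)) x = (if x \<in> T then 1 else 0) + (if x \<in> Bo then 1 else 0)"
      using t(1,4) b(1,4) by (auto simp: distinct_count_atmost_1)
    moreover have "count (type_mset is) x = 0" if "x \<notin> set is"
      unfolding count_type_mset using that by (intro sum.neutral) auto
    ultimately show "count (mset (t @ b)) x = count (type_mset is) x"
      using entry[of x] T_is Bo_is by (cases "x \<in> set is") auto
  qed
  moreover have "b ! c \<le> t ! c" if c: "c < k" for c
  proof (rule sorted_gr_columns[OF t(3) b(3)])
    show "c < length b" "c < length t" using c b(2) t(2) kn by auto
    define x where "x = b ! c"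
    have xBo: "x \<in> Bo" using c b(1,2) by (auto simp: x_def)
    \<comment> \<open>The suffix is cut at the preceding entry \<open>q\<close> of the type: a cut
      at \<open>x - 1\<close> would lose the lowered copy of a double entry \<open>x\<close>. No top
      entry lies strictly between \<open>q\<close> and \<open>x\<close>.\<close>
    obtain q where q: "q \<in> insert 0 (set is)" "q < x" "\<And>j. q < j \<Longrightarrow> j < x \<Longrightarrow> j \<notin> set is"
      using entry[of x] xBo Bo_is by blast
    have xn: "x \<le> n" using xBo Bo_is bnd by blast
    have "h ` {y \<in> Bo. x \<le> y} \<subseteq> B \<inter> {q<..n}"
    proof
      fix z assume "z \<in> h ` {y \<in> Bo. x \<le> y}"
      then obtain y where y: "y \<in> Bo" "x \<le> y" "z = h y" by blast
      from Bo_cases[OF y(1)] show "z \<in> B \<inter> {q<..n}"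
      proof
        assume "y \<in> B \<and> y \<in> set is"
        then show ?thesis using y q(2) bnd[of y] by (auto simp: h_def)
      next
        assume "\<exists>j\<in>M. y = Suc j \<and> y \<notin> B"
        then obtain j where j: "j \<in> M" "y = Suc j" "y \<notin> B" by blast
        have "j \<noteq> q" using M(5,6)[OF j(1)] q(1) by auto
        then have "q < j" using y(2) j(2) q(2) by linarith
        then show ?thesis using j y M(1,5)[OF j(1)] by (auto simp: h_def)
      qed
    qed
    then have "card (h ` {y \<in> Bo. x \<le> y}) \<le> card (B \<inter> {q<..n})" by (intro card_mono) auto
    moreover have "card (h ` {y \<in> Bo. x \<le> y}) = card {y \<in> Bo. x \<le> y}"
      by (rule card_image) (rule inj_on_subset[OF h_inj], blast)
    moreover have "card (B \<inter> {q<..n}) \<le> card (T \<inter> {q<..n})"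
      using ballot_iff[OF B_subset card_B, of q] ht_ge[of q] q(2) xn by (simp add: T_def)
    moreover have "T \<inter> {q<..n} \<subseteq> {y \<in> T. x \<le> y}"
    proof
      fix y assume y: "y \<in> T \<inter> {q<..n}"
      then have "\<not> y < x" using q(3)[of y] T_is by auto
      then show "y \<in> {y \<in> T. x \<le> y}" using y by simp
    qed
    then have "card (T \<inter> {q<..n}) \<le> card {y \<in> T. x \<le> y}" using fin(1) by (intro card_mono) auto
    ultimately show "card {y \<in> set b. b ! c \<le> y} \<le> card {y \<in> set t. b ! c \<le> y}"
      unfolding x_def[symmetric] t(1) b(1) by linarith
  qed
  ultimately have "(t, b) \<in> std_tableaux n k is" using t b by (simp add: std_tableaux_def)
  moreover have "bottoms is (t, b) = B"
  proof -
    have "(if double_entry is x then x - 1 else x) = h x" if "x \<in> Bo" for x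
      using entry[of x] that Bo_is by (auto simp: h_def)
    then have "(\<lambda>x. if double_entry is x then x - 1 else x) ` Bo = h ` Bo" by (intro image_cong) auto
    then show ?thesis using h_img b(1) by (simp add: bottoms_def phi_def)
  qed
  ultimately show ?thesis using that by blast
qed

section \<open>From a finite closed cover to the irreducible components\<close>

lemma finite_std_tableaux: "finite (std_tableaux n k is)"
proof (rule finite_subset)
  show "std_tableaux n k is \<subseteq>
      {xs. set xs \<subseteq> set_mset (type_mset is) \<and> length xs = n - k} \<times>
      {xs. set xs \<subseteq> set_mset (type_mset is) \<and> length xs = k}"
  proof
    fix S assume S: "S \<in> std_tableaux n k is"
    obtain t b where tb: "S = (t, b)" by (cases S)
    have "length t = n - k" "length b = k" "type_mset is = mset (t @ b)"
      using S by (auto simp: std_tableaux_def tb)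
    then show "S \<in> {xs. set xs \<subseteq> set_mset (type_mset is) \<and> length xs = n - k} \<times>
        {xs. set xs \<subseteq> set_mset (type_mset is) \<and> length xs = k}" by (simp add: tb)
  qed
qed (intro finite_cartesian_product finite_lists_length_eq finite_set_mset)

lemma pr_Ycomp_phi:
  assumes "2 * k \<le> n" "is_type n is" "S \<in> std_tableaux n k is"
  shows "pr is ` Ycomp n k (phi is S) = pr is ` ballot.Yset n k (bottoms is S)"
proof -
  interpret typed_ballot n k "bottoms is S" "is" by (rule std_tableau_typed(1)[OF assms])
  have "Ycomp n k (phi is S) = Yset"
    unfolding Yset_def
  proof (rule Ycomp_eq)
    show "in_top (phi is S) i \<longleftrightarrow> i = 0 \<or> (1 \<le> i \<and> i \<le> n \<and> i \<notin> bottoms is S)" for i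
      using std_tableau_typed(2)[OF assms] by (auto simp: in_top_def phi_def)
    show "in_bot (phi is S) i \<longleftrightarrow> i \<in> bottoms is S" for i
      by (simp add: in_bot_def bottoms_def)
  qed
  then show ?thesis by simp
qed

text \<open>An irreducible set covered by finitely many closed sets lies in one of them. So every
  irreducible subset of \<open>X\<close> lies in some \<open>Z a\<close>, and incomparability makes
  each \<open>Z a\<close> maximal and \<open>Z\<close> injective.\<close>

lemma bij_betw_irr_components:
  assumes "finite A" "\<And>a. a \<in> A \<Longrightarrow> zclosed n is (Z a)" "\<And>a. a \<in> A \<Longrightarrow> irreducible_set n is (Z a)"
    "X = \<Union>(Z ` A)" "\<And>a b. a \<in> A \<Longrightarrow> b \<in> A \<Longrightarrow> Z a \<subseteq> Z b \<Longrightarrow> a = b"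
  shows "bij_betw Z A (irr_components n is X)"
proof -
  have in_one: "\<exists>a\<in>A. W \<subseteq> Z a" if W: "irreducible_set n is W" "W \<subseteq> X" for W
  proof -
    have "C \<subseteq> A \<Longrightarrow> W \<subseteq> \<Union>(Z ` C) \<Longrightarrow> \<exists>a\<in>C. W \<subseteq> Z a" if "finite C" for C
      using that
    proof (induction C rule: finite_induct)
      case empty
      then show ?case using W(1) by (simp add: irreducible_set_def)
    next
      case (insert c C)
      have "zclosed n is (Z c)" "zclosed n is (\<Union>(Z ` C))"
        using insert assms(2) by (auto intro!: zclosed_Union)
      moreover have "W \<subseteq> Z c \<union> \<Union>(Z ` C)" using insert.prems by auto
      ultimately have "W \<subseteq> Z c \<or> W \<subseteq> \<Union>(Z ` C)" using W(1) by (simp add: irreducible_set_def)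
      then show ?case using insert by auto
    qed
    then show ?thesis using assms(1,4) W(2) by blast
  qed
  have "Z ` A = irr_components n is X"
  proof (intro Set.set_eqI iffI)
    fix Y assume "Y \<in> Z ` A"
    then obtain a where a: "a \<in> A" "Y = Z a" by blast
    have "W = Z a" if W: "irreducible_set n is W" "Z a \<subseteq> W" "W \<subseteq> X" for W
    proof -
      obtain b where b: "b \<in> A" "W \<subseteq> Z b" using in_one[OF W(1,3)] by blast
      then have "a = b" using assms(5)[OF a(1) b(1)] W(2) by blast
      then show ?thesis using b W(2) by blast
    qed
    then show "Y \<in> irr_components n is X"
      using a assms(3,4) by (auto simp: irr_components_def)
  next
    fix Y assume "Y \<in> irr_components n is X"
    then have Y: "Y \<subseteq> X" "irreducible_set n is Y"
      "\<And>W. irreducible_set n is W \<Longrightarrow> Y \<subseteq> W \<Longrightarrow> W \<subseteq> X \<Longrightarrow> W = Y" by (auto simp: irr_components_def)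
    obtain a where a: "a \<in> A" "Y \<subseteq> Z a" using in_one[OF Y(2,1)] by blast
    have "Z a = Y" using a assms(3,4) by (intro Y(3)) auto
    then show "Y \<in> Z ` A" using a by blast
  qed
  moreover have "inj_on Z A" using assms(5) by (auto intro: inj_onI)
  ultimately show ?thesis by (simp add: bij_betw_def)
qed

theorem theorem4p3:
  fixes n k :: nat and "is" :: "nat list"
  assumes "2 * k \<le> n"
    and "is_type n is"
  shows "bij_betw (\<lambda>S. pr is ` Ycomp n k (phi is S))
           (std_tableaux n k is) (irr_components n is (Spalt n k is))"
proof (rule bij_betw_irr_components)
  note typed = std_tableau_typed(1)[OF assms]
  show "finite (std_tableaux n k is)" by (rule finite_std_tableaux)
  show "zclosed n is (pr is ` Ycomp n k (phi is S))" if "S \<in> std_tableaux n k is" for S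
    unfolding pr_Ycomp_phi[OF assms that] by (rule typed_ballot.zclosed_pr_Yset[OF typed[OF that]])
  show "irreducible_set n is (pr is ` Ycomp n k (phi is S))" if "S \<in> std_tableaux n k is" for S
    unfolding pr_Ycomp_phi[OF assms that]
    by (rule ballot.irreducible_pr_Yset[OF typed_ballot.axioms(1)[OF typed[OF that]] assms(2)])
  show "Spalt n k is = (\<Union>S\<in>std_tableaux n k is. pr is ` Ycomp n k (phi is S))"
  proof (intro Set.set_eqI iffI)
    fix F assume "F \<in> Spalt n k is"
    then obtain B where B: "typed_ballot n k B is" "F \<in> pr is ` ballot.Yset n k B"
      by (rule Spalt_typed_ballot[OF assms])
    obtain S where S: "S \<in> std_tableaux n k is" "bottoms is S = B"
      by (rule typed_ballot.tableau_exists[OF B(1)])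
    then have "F \<in> pr is ` Ycomp n k (phi is S)" using B(2) pr_Ycomp_phi[OF assms S(1)] by simp
    then show "F \<in> (\<Union>S\<in>std_tableaux n k is. pr is ` Ycomp n k (phi is S))" using S(1) by blast
  next
    fix F assume "F \<in> (\<Union>S\<in>std_tableaux n k is. pr is ` Ycomp n k (phi is S))"
    then obtain S where S: "S \<in> std_tableaux n k is" "F \<in> pr is ` Ycomp n k (phi is S)" by blast
    then show "F \<in> Spalt n k is"
      using typed_ballot.pr_Yset_subset[OF typed[OF S(1)]] pr_Ycomp_phi[OF assms S(1)] by blast
  qed
  fix S S' assume S: "S \<in> std_tableaux n k is" "S' \<in> std_tableaux n k is"
    and le: "pr is ` Ycomp n k (phi is S) \<subseteq> pr is ` Ycomp n k (phi is S')"
  have "pr is ` ballot.Yset n k (bottoms is S) \<subseteq> pr is ` ballot.Yset n k (bottoms is S')"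
    using le unfolding pr_Ycomp_phi[OF assms S(1)] pr_Ycomp_phi[OF assms S(2)] .
  then have sub: "bottoms is S \<subseteq> bottoms is S'"
    by (rule typed_ballot.bottoms_subset[OF typed[OF S(1)] typed[OF S(2)]])
  interpret B: typed_ballot n k "bottoms is S" "is" by (rule typed[OF S(1)])
  interpret B': typed_ballot n k "bottoms is S'" "is" by (rule typed[OF S(2)])
  have "bottoms is S = bottoms is S'"
    using sub B.card_B B'.card_B finite_subset[OF B'.B_subset] by (intro card_subset_eq) auto
  then show "S = S'" by (rule bottoms_inj[OF assms S])
qed

end
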